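(* Let $q\in L^{1}[0,1]$ be a real-valued function and let $t\in[0,2\pi)$ be a fixed real number. Let $L_{t}(q)$ be the self-adjoint operator in $L^{2}[0,1]$ generated by the expression $-y''+q(x)y$ and the quasi-periodic boundary conditions $y(1)=e^{it}y(0)$, $y'(1)=e^{it}y'(0)$, and let $S(L_t(q))$ denote its spectrum. Suppose that the first (smallest) eigenvalue of $L_{t}(q)$ is not less than $\min\{t^{2},(2\pi-t)^{2}\}$, and that $S(L_{t}(q))$ contains the set $\{(2n\pi-t)^{2}: n\in\mathbb{N}\}$. Then $q=0$ almost everywhere on $[0,1]$.
   Context: $\mathbb{N}=\{1,2,3,\dots\}$. For real-valued $q\in L^1[0,1]$ and $t\in[0,2\pi)$, the operator $L_t(q)$ acts in the complex Hilbert space $L^2[0,1]$ by $L_t(q)y=-y''+qy$ on the domain of those $y\in L^2[0,1]$ such that $y$ and $y'$ are absolutely continuous on $[0,1]$, $-y''+qy\in L^2[0,1]$, and $y(1)=e^{it}y(0)$, $y'(1)=e^{it}y'(0)$. It is self-adjoint and bounded below with purely discrete spectrum, so it has a smallest eigenvalue, called the first eigenvalue. The cases $t=0$ and $t=\pi$ are the periodic and antiperiodic problems. *)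

theory Defs
  imports "HOL-Analysis.Analysis"
begin

definition abs_cont_on_interval :: "real \<Rightarrow> real \<Rightarrow> (real \<Rightarrow> 'a::real_normed_vector) \<Rightarrow> bool" where
  "abs_cont_on_interval a b f \<longleftrightarrow>
     (\<forall>\<epsilon>>0. \<exists>\<delta>>0. \<forall>(n::nat) u v.
        (\<forall>i<n. a \<le> u i \<and> u i \<le> v i \<and> v i \<le> b) \<longrightarrow>
        disjoint_family_on (\<lambda>i. {u i<..<v i}) {..<n} \<longrightarrow>
        (\<Sum>i<n. v i - u i) < \<delta> \<longrightarrow>
        (\<Sum>i<n. norm (f (v i) - f (u i))) < \<epsilon>)"

text \<open>Elements of \<open>L\<^sup>2[0,1]\<close> are represented by functions on the real line; values outside
  \<open>[0,1]\<close> are irrelevant, and two representatives denote the same element iff they agree almost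
  everywhere on \<open>[0,1]\<close>. Equality in \<open>L\<^sup>2[0,1]\<close> is therefore always written with \<open>AE\<close>.\<close>

abbreviation leb01 :: "real measure" where
  "leb01 \<equiv> lebesgue_on {0..1}"

definition L2 :: "(real \<Rightarrow> complex) set" where
  "L2 = {f. f \<in> borel_measurable leb01 \<and> integrable leb01 (\<lambda>x. (cmod (f x))\<^sup>2)}"

definition L2_norm :: "(real \<Rightarrow> complex) \<Rightarrow> real" where
  "L2_norm f = sqrt (\<integral>x. (cmod (f x))\<^sup>2 \<partial>leb01)"

text \<open>Spectral notions for a linear operator \<open>T\<close> in \<open>L\<^sup>2[0,1]\<close> with domain \<open>D\<close>. A point \<open>z\<close> is in
  the resolvent set iff \<open>T - z\<close> maps \<open>D\<close> bijectively onto \<open>L\<^sup>2[0,1]\<close> with bounded inverse;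
  by linearity, injectivity means that \<open>z\<close> is not an eigenvalue.\<close>

definition eigenvalues ::
  "(real \<Rightarrow> complex) set \<Rightarrow> ((real \<Rightarrow> complex) \<Rightarrow> real \<Rightarrow> complex) \<Rightarrow> complex set" where
  "eigenvalues D T =
     {z. \<exists>y\<in>D. \<not> (AE x in leb01. y x = 0) \<and> (AE x in leb01. T y x = z * y x)}"

definition resolvent_set ::
  "(real \<Rightarrow> complex) set \<Rightarrow> ((real \<Rightarrow> complex) \<Rightarrow> real \<Rightarrow> complex) \<Rightarrow> complex set" where
  "resolvent_set D T =
     {z. z \<notin> eigenvalues D T \<and>
         (\<forall>g\<in>L2. \<exists>y\<in>D. AE x in leb01. T y x - z * y x = g x) \<and>
         (\<exists>C. \<forall>y\<in>D. L2_norm y \<le> C * L2_norm (\<lambda>x. T y x - z * y x))}"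

definition spectrum ::
  "(real \<Rightarrow> complex) set \<Rightarrow> ((real \<Rightarrow> complex) \<Rightarrow> real \<Rightarrow> complex) \<Rightarrow> complex set" where
  "spectrum D T = - resolvent_set D T"

text \<open>The derivative on \<open>[0,1]\<close>, one-sided at the endpoints; meaningful only at points of
  differentiability.\<close>

definition deriv01 :: "(real \<Rightarrow> complex) \<Rightarrow> real \<Rightarrow> complex" where
  "deriv01 y x = vector_derivative y (at x within {0..1})"

definition L_op :: "(real \<Rightarrow> real) \<Rightarrow> (real \<Rightarrow> complex) \<Rightarrow> real \<Rightarrow> complex" where
  "L_op q y x = - deriv01 (deriv01 y) x + complex_of_real (q x) * y x"

text \<open>An element of the domain is represented by its continuous representative, for which \<open>y'\<close>
  exists everywhere on \<open>[0,1]\<close>. The almost everywhere differentiability of \<open>y'\<close> is automatic for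
  an absolutely continuous function; it is listed to make explicit that \<open>y''\<close> in \<open>L_op\<close> is a
  genuine derivative almost everywhere.\<close>

definition L_dom :: "real \<Rightarrow> (real \<Rightarrow> real) \<Rightarrow> (real \<Rightarrow> complex) set" where
  "L_dom t q =
     {y \<in> L2.
        abs_cont_on_interval 0 1 y \<and>
        (\<forall>x\<in>{0..1}. y differentiable (at x within {0..1})) \<and>
        abs_cont_on_interval 0 1 (deriv01 y) \<and>
        (AE x in leb01. deriv01 y differentiable (at x within {0..1})) \<and>
        L_op q y \<in> L2 \<and>
        y 1 = exp (\<i> * complex_of_real t) * y 0 \<and>
        deriv01 y 1 = exp (\<i> * complex_of_real t) * deriv01 y 0}"

definition L_spectrum :: "real \<Rightarrow> (real \<Rightarrow> real) \<Rightarrow> complex set" where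
  "L_spectrum t q = spectrum (L_dom t q) (L_op q)"

text \<open>For real \<open>q \<in> L\<^sup>1[0,1]\<close> the operator is self-adjoint and bounded below with discrete spectrum,
  so all eigenvalues are real and the least one exists.\<close>

definition first_eigenvalue :: "real \<Rightarrow> (real \<Rightarrow> real) \<Rightarrow> real" where
  "first_eigenvalue t q = (LEAST \<mu>. complex_of_real \<mu> \<in> eigenvalues (L_dom t q) (L_op q))"

end

theory Submission
  imports Defs
begin

text \<open>
Write \<open>Q\<close> for the mean of \<open>q\<close> and \<open>m\<close> for \<open>min (t\<^sup>2) ((2 * pi - t)\<^sup>2)\<close>. The proof plays two facts against each
other: the eigenvalues \<open>(2 * n * pi - t)\<^sup>2\<close> for large \<open>n\<close> force \<open>Q = 0\<close>, and once \<open>Q = 0\<close> the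
exponential that realises \<open>m\<close> for the zero potential realises it for \<open>q\<close> too, so the lower bound on the
first eigenvalue makes it a minimiser of the quadratic form. A minimiser admits no first-order
variation, and that leaves no room for a nonzero \<open>q\<close>.

\<^emph>\<open>The mean vanishes\<close> (\<open>mean_zero_of_spectrum\<close>). Let \<open>y\<close> be an eigenfunction for \<open>\<mu>\<^sup>2\<close>, where
\<open>\<mu> = 2 * n * pi - t\<close>. By variation of constants \<open>y = a * cis (\<mu> * x) - b * cis (- \<mu> * x)\<close> up to an error of order \<open>1 / \<mu>\<close>.
Because \<open>cis (- \<mu> * x)\<close> satisfies the same boundary conditions as \<open>y\<close> and solves the same equation with
\<open>q = 0\<close>, the function \<open>q * y\<close> is orthogonal to it. By the Riemann--Lebesgue lemma the orthogonality
relation reads \<open>b * Q = o(1)\<close>. For the other amplitude there are two cases: either \<open>cis (\<mu> * x)\<close> satisfies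
the boundary conditions as well and \<open>a * Q = o(1)\<close> for the same reason, or it violates them by a fixed
amount and then \<open>a\<close> itself is of order \<open>1 / \<mu>\<close>. Normalising \<open>|a| + |b| = 1\<close> gives \<open>Q = 0\<close>. Working with
one eigenfunction at a time treats the periodic, antiperiodic and generic cases alike.

\<^emph>\<open>The first eigenvalue is the infimum of the form\<close> (\<open>first_eigenvalue_le_energy\<close>). On \<open>C\<^sup>1\<close> functions
\<open>y\<close> with \<open>y 1 = exp (\<i> * t) * y 0\<close> consider the integral of \<open>|y'|\<^sup>2 + q * |y|\<^sup>2\<close>. Let \<open>m\<^sub>0\<close> be the largest
constant by which it dominates the squared \<open>L\<^sup>2\<close> norm. If \<open>m\<^sub>0\<close> were not an eigenvalue, then \<open>L - m\<^sub>0\<close>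
would have a bounded inverse, and perturbing \<open>y\<close> in the direction of \<open>(L - m\<^sub>0)\<^sup>-\<^sup>1 y\<close> would improve the constant
(\<open>energy_gap_below_resolvent_point\<close>). The argument rests on the fact that a point which is not an
eigenvalue lies in the resolvent set (\<open>non_eigenvalue_in_resolvent_set\<close>), which also turns the
hypothesis on the spectrum into one on eigenvalues. That fact holds because the boundary value problem is a linear
system of two equations for the initial values \<open>y 0\<close> and \<open>y' 0\<close>.

\<^emph>\<open>Conclusion.\<close> Take \<open>\<tau>\<close> to be \<open>t\<close> or \<open>t - 2 * pi\<close>, whichever has \<open>\<tau>\<^sup>2 = m\<close>, and test the form
with \<open>cis (\<tau> * x) * (1 + e * h x)\<close> for real \<open>h\<close> vanishing at both ends. The terms of order zero cancel, so the
integral of \<open>q * h\<close> is zero. With \<open>P\<close> the primitive of \<open>q\<close> and \<open>h\<close> the primitive of \<open>P\<close> minus its mean,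
integration by parts turns this into the vanishing of the variance of \<open>P\<close>. Hence \<open>P\<close> is constant and
\<open>q = 0\<close> almost everywhere.

Since \<open>q\<close> is only integrable, differential equations are read as integral equations throughout; the first
part supplies the calculus of absolutely continuous functions that this requires.
\<close>

section \<open>Primitives of integrable functions\<close>

text \<open>
A measurable function is an almost everywhere limit of continuous functions. To turn this into
convergence in the mean, both sides are clipped radially at a level \<open>n\<close>: the clipped function is close to
\<open>f\<close> by dominated convergence with majorant \<open>norm f\<close>, and clipping keeps continuity while providing a
constant majorant for the approximants.
\<close>

lemma abs_integrable_continuous_approx:
  fixes f :: "real \<Rightarrow> 'a::euclidean_space"
  assumes f: "f absolutely_integrable_on {a..b}" and e: "0 < e"
  obtains g where "continuous_on UNIV g" "integral {a..b} (\<lambda>x. norm (f x - g x)) < e"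
proof -
  let ?M = "lebesgue_on {a..b}"
  have fm: "f \<in> borel_measurable ?M" and fi: "integrable ?M f"
    using f by (simp_all add: absolutely_integrable_measurable absolutely_integrable_imp_integrable)
  obtain N g where N: "negligible N" and g: "\<And>n::nat. continuous_on UNIV (g n)"
    and lim: "\<And>x. x \<notin> N \<Longrightarrow> (\<lambda>n. g n x) \<longlonglongrightarrow> (if x \<in> {a..b} then f x else 0)"
    using fm measurable_on_iff_borel_measurable[of "{a..b}" f] unfolding measurable_on_def by auto
  define clip where "clip = (\<lambda>(n::nat) (y::'a). (real (Suc n) / max (real (Suc n)) (norm y)) *\<^sub>R y)"
  have clip_cont: "continuous_on UNIV (clip n)" for n
    unfolding clip_def by (intro continuous_intros) (auto simp: max_def)
  have clip_le: "norm (clip n y) \<le> real (Suc n)" for n y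
  proof (cases "norm y \<le> real (Suc n)")
    case True
    then show ?thesis by (simp add: clip_def max_def)
  next
    case False
    then have "norm y > 0" using norm_ge_zero[of y] by (auto simp del: norm_ge_zero)
    then show ?thesis using False by (simp add: clip_def max_def del: of_nat_Suc)
  qed
  have clip_id: "clip n y = y" if "norm y \<le> real (Suc n)" for n y
    using that by (auto simp: clip_def max_def)
  have clip_dist: "norm (y - clip n y) \<le> norm y" for n y
  proof -
    \<comment> \<open>clipping multiplies by a factor between zero and one\<close>
    let ?c = "real (Suc n) / max (real (Suc n)) (norm y)"
    have "0 \<le> ?c" "?c \<le> 1" by (auto simp: divide_le_eq_1 max_def)
    moreover have "y - clip n y = (1 - ?c) *\<^sub>R y" by (simp add: clip_def scaleR_left_diff_distrib)
    ultimately show ?thesis by (simp add: mult_left_le_one_le)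
  qed
  have clip_meas: "(\<lambda>x. clip n (h x)) \<in> borel_measurable ?M" if "h \<in> borel_measurable ?M" for h n
    using borel_measurable_continuous_onI[OF clip_cont[of n]] that by (rule measurable_compose_rev)
  have "(\<lambda>n. \<integral>x. norm (f x - clip n (f x)) \<partial>?M) \<longlonglongrightarrow> (\<integral>x. 0 \<partial>?M)"
  proof (rule integral_dominated_convergence[where w="\<lambda>x. norm (f x)"])
    show "AE x in ?M. (\<lambda>n. norm (f x - clip n (f x))) \<longlonglongrightarrow> 0"
    proof (rule AE_I2)
      fix x
      obtain m where m: "norm (f x) \<le> real m" using real_arch_simple by blast
      have "\<forall>\<^sub>F n in sequentially. norm (f x - clip n (f x)) = 0"
        unfolding eventually_sequentially
        by (rule exI[of _ m]) (use m in \<open>auto intro!: clip_id[symmetric]\<close>)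
      then show "(\<lambda>n. norm (f x - clip n (f x))) \<longlonglongrightarrow> 0"
        by (rule tendsto_eventually)
    qed
  qed (use fm clip_meas[OF fm] fi clip_dist in auto)
  from order_tendstoD(2)[OF this, of "e/2"] e
  obtain n where n: "(\<integral>x. norm (f x - clip n (f x)) \<partial>?M) < e/2"
    by (auto simp: eventually_sequentially)
  have bd: "norm (clip n y - clip n z) \<le> real (Suc n) + real (Suc n)" for y z
    by (rule order_trans[OF norm_triangle_ineq4 add_mono[OF clip_le clip_le]])
  have gm: "g k \<in> borel_measurable ?M" for k
    by (rule continuous_imp_measurable_on_sets_lebesgue) (auto intro: continuous_on_subset[OF g])
  have "(\<lambda>k. \<integral>x. norm (clip n (f x) - clip n (g k x)) \<partial>?M) \<longlonglongrightarrow> (\<integral>x. 0 \<partial>?M)"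
  proof (rule integral_dominated_convergence[where w="\<lambda>x. real (Suc n) + real (Suc n)"])
    have "AE x in lebesgue. x \<notin> N" using N by (simp add: AE_not_in negligible_iff_null_sets)
    then have "AE x in ?M. x \<notin> N" by (subst AE_restrict_space_iff) auto
    then show "AE x in ?M. (\<lambda>k. norm (clip n (f x) - clip n (g k x))) \<longlonglongrightarrow> 0"
      using AE_space[of ?M]
    proof eventually_elim
      case (elim x)
      then have "(\<lambda>k. g k x) \<longlonglongrightarrow> f x" using lim[of x] by simp
      then have "(\<lambda>k. clip n (g k x)) \<longlonglongrightarrow> clip n (f x)"
        using continuous_on_tendsto_compose[OF clip_cont] by auto
      then have "(\<lambda>k. norm (clip n (f x) - clip n (g k x))) \<longlonglongrightarrow> norm (clip n (f x) - clip n (f x))"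
        by (intro tendsto_intros)
      then show ?case by simp
    qed
    show "AE x in ?M. norm (norm (clip n (f x) - clip n (g k x))) \<le> real (Suc n) + real (Suc n)" for k
      by (rule AE_I2) (use bd in simp)
  qed (use clip_meas fm gm in auto)
  from order_tendstoD(2)[OF this, of "e/2"] e
  obtain k where k: "(\<integral>x. norm (clip n (f x) - clip n (g k x)) \<partial>?M) < e/2"
    by (auto simp: eventually_sequentially)
  show thesis
  proof (rule that)
    show c: "continuous_on UNIV (\<lambda>x. clip n (g k x))"
      using continuous_on_compose2[OF clip_cont g] by auto
    have i1: "integrable ?M (\<lambda>x. f x - clip n (f x))"
      by (rule Bochner_Integration.integrable_bound[OF fi]) (use fm clip_meas[OF fm] clip_dist in auto)
    have i2: "integrable ?M (\<lambda>x. clip n (f x) - clip n (g k x))"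
      by (rule Bochner_Integration.integrable_bound[of _ "\<lambda>x. real (Suc n) + real (Suc n)"])
        (use fm gm clip_meas bd in auto)
    have i3: "integrable ?M (\<lambda>x. f x - clip n (g k x))"
      using Bochner_Integration.integrable_add[OF i1 i2] by simp
    have "integral {a..b} (\<lambda>x. norm (f x - clip n (g k x))) = (\<integral>x. norm (f x - clip n (g k x)) \<partial>?M)"
      using i3 by (simp add: lebesgue_integral_eq_integral)
    also have "\<dots> \<le> (\<integral>x. norm (f x - clip n (f x)) + norm (clip n (f x) - clip n (g k x)) \<partial>?M)"
    proof (rule integral_mono)
      show "norm (f x - clip n (g k x)) \<le> norm (f x - clip n (f x)) + norm (clip n (f x) - clip n (g k x))" for x
        using norm_triangle_ineq[of "f x - clip n (f x)" "clip n (f x) - clip n (g k x)"] by simp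
    qed (use i1 i2 i3 in auto)
    also have "\<dots> < e" using i1 i2 n k by simp
    finally show "integral {a..b} (\<lambda>x. norm (f x - clip n (g k x))) < e" .
  qed
qed


text \<open>
An absolutely continuous function on \<open>[0,1]\<close> together with a chosen integrable derivative. Tracking the
pair avoids choosing values of the derivative on null sets.
\<close>

definition is_primitive :: "(real \<Rightarrow> 'a::euclidean_space) \<Rightarrow> (real \<Rightarrow> 'a) \<Rightarrow> bool" where
  "is_primitive F f \<longleftrightarrow>
     f absolutely_integrable_on {0..1} \<and> (\<forall>x\<in>{0..1}. F x = F 0 + integral {0..x} f)"

lemma is_primitive_integrable: "is_primitive F f \<Longrightarrow> f absolutely_integrable_on {0..1}"
  unfolding is_primitive_def by blast

lemma is_primitiveD: "is_primitive F f \<Longrightarrow> x \<in> {0..1} \<Longrightarrow> F x = F 0 + integral {0..x} f"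
  unfolding is_primitive_def by blast

lemma abs_integrable_subinterval:
  fixes f :: "real \<Rightarrow> 'a::euclidean_space"
  assumes "f absolutely_integrable_on {0..1}" "0 \<le> u" "v \<le> 1"
  shows "f absolutely_integrable_on {u..v}"
  using absolutely_integrable_on_subinterval[OF assms(1)] assms(2,3) by auto

lemma is_primitive_diff:
  assumes "is_primitive F f" "0 \<le> u" "u \<le> v" "v \<le> 1"
  shows "F v - F u = integral {u..v} f"
proof -
  have "f integrable_on {0..v}"
    using abs_integrable_subinterval[OF is_primitive_integrable[OF assms(1)], of 0 v] assms(4)
    by (simp add: absolutely_integrable_on_def)
  then have "integral {0..u} f + integral {u..v} f = integral {0..v} f"
    using assms by (intro Henstock_Kurzweil_Integration.integral_combine) auto
  moreover have "F u = F 0 + integral {0..u} f" "F v = F 0 + integral {0..v} f"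
    by (rule is_primitiveD[OF assms(1)], use assms in auto)+
  ultimately show ?thesis by (simp add: algebra_simps)
qed

text \<open>
The indicators of disjoint intervals add up to at most one.
\<close>

lemma sum_integrals_le_integral:
  fixes h :: "real \<Rightarrow> real"
  assumes h: "h integrable_on {a..b}" "\<And>x. x \<in> {a..b} \<Longrightarrow> 0 \<le> h x"
    and uv: "\<And>i. i \<in> I \<Longrightarrow> a \<le> u i \<and> u i \<le> v i \<and> v i \<le> b" and "finite I"
    and disj: "disjoint_family_on (\<lambda>i. {u i<..<v i}) I"
  shows "(\<Sum>i\<in>I. integral {u i..v i} h) \<le> integral {a..b} h"
proof -
  let ?h = "\<lambda>i x. if x \<in> {u i<..<v i} then h x else 0"
  have *: "(?h i has_integral integral {u i..v i} h) {a..b}" if i: "i \<in> I" for i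
  proof -
    have "h integrable_on {u i..v i}"
      using integrable_on_subinterval[OF h(1), of "u i" "v i"] uv[OF i] by auto
    \<comment> \<open>closed intervals may share endpoints; open ones are disjoint\<close>
    then have "(h has_integral integral {u i..v i} h) {u i<..<v i}"
      using has_integral_Icc_iff_Ioo by blast
    moreover have "{u i<..<v i} \<subseteq> {a..b}" using uv[OF i] by auto
    ultimately show ?thesis
      using has_integral_restrict[of "{u i<..<v i}" "{a..b}" h] by blast
  qed
  have "((\<lambda>x. \<Sum>i\<in>I. ?h i x) has_integral (\<Sum>i\<in>I. integral {u i..v i} h)) {a..b}"
    using * \<open>finite I\<close> by (intro has_integral_sum) auto
  moreover have "(h has_integral integral {a..b} h) {a..b}" using h(1) by blast
  moreover have "(\<Sum>i\<in>I. ?h i x) \<le> h x" if x: "x \<in> {a..b}" for x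
  proof (cases "\<exists>j\<in>I. x \<in> {u j<..<v j}")
    case True
    then obtain j where j: "j \<in> I" "x \<in> {u j<..<v j}" by blast
    have "?h i x = (if i = j then h x else 0)" if "i \<in> I" for i
    proof (cases "i = j")
      case False
      then have "{u i<..<v i} \<inter> {u j<..<v j} = {}"
        using disj j that unfolding disjoint_family_on_def by blast
      then have "x \<notin> {u i<..<v i}" using j by blast
      then show ?thesis using False by (simp del: greaterThanLessThan_iff)
    qed (use j in auto)
    then have "(\<Sum>i\<in>I. ?h i x) = (\<Sum>i\<in>I. if i = j then h x else 0)"
      by (intro sum.cong) auto
    then show ?thesis using j \<open>finite I\<close> by simp
  next
    case False
    then have "(\<Sum>i\<in>I. ?h i x) = 0" by (intro sum.neutral) auto
    then show ?thesis using h(2) x by simp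
  qed
  ultimately show ?thesis by (rule has_integral_le)
qed

text \<open>
Split \<open>f\<close> as a continuous, hence bounded, function plus a remainder of small integral. The bounded
part contributes at most a constant times the total length of the intervals, and the remainder is small
on any disjoint family.
\<close>

lemma is_primitive_abs_cont:
  assumes "is_primitive F f"
  shows "abs_cont_on_interval 0 1 F"
  unfolding abs_cont_on_interval_def
proof (intro allI impI)
  fix e :: real assume e: "0 < e"
  have fi: "f absolutely_integrable_on {0..1}" using assms by (rule is_primitive_integrable)
  obtain g where g: "continuous_on UNIV g" and ge: "integral {0..1} (\<lambda>x. norm (f x - g x)) < e/2"
    using abs_integrable_continuous_approx[OF fi, of "e/2"] e by auto
  have g01: "continuous_on {0..1} g" using g continuous_on_subset by blast
  obtain B where B: "B > 0" "\<And>x. x \<in> {0..1} \<Longrightarrow> norm (g x) \<le> B"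
    using compact_imp_bounded[OF compact_continuous_image[OF g01]] by (auto simp: bounded_pos)
  have gi: "g absolutely_integrable_on {0..1}"
    using g01 by (rule absolutely_integrable_continuous_real)
  have fgi: "(\<lambda>x. f x - g x) absolutely_integrable_on {0..1}"
    using set_integral_diff(1)[OF fi gi] .
  show "\<exists>d>0. \<forall>(n::nat) u v. (\<forall>i<n. 0 \<le> u i \<and> u i \<le> v i \<and> v i \<le> 1) \<longrightarrow>
          disjoint_family_on (\<lambda>i. {u i<..<v i}) {..<n} \<longrightarrow>
          (\<Sum>i<n. v i - u i) < d \<longrightarrow> (\<Sum>i<n. norm (F (v i) - F (u i))) < e"
  proof (intro exI[of _ "e/(2*B)"] conjI allI impI)
    show "0 < e/(2*B)" using e B by simp
    fix n :: nat and u v :: "nat \<Rightarrow> real"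
    assume uv: "\<forall>i<n. 0 \<le> u i \<and> u i \<le> v i \<and> v i \<le> 1"
      and disj: "disjoint_family_on (\<lambda>i. {u i<..<v i}) {..<n}"
      and small: "(\<Sum>i<n. v i - u i) < e/(2*B)"
    have step: "norm (F (v i) - F (u i)) \<le> integral {u i..v i} (\<lambda>x. norm (f x - g x)) + B * (v i - u i)"
      if "i < n" for i
    proof -
      have i: "0 \<le> u i" "u i \<le> v i" "v i \<le> 1" using uv that by auto
      have fgi': "(\<lambda>x. f x - g x) absolutely_integrable_on {u i..v i}"
        and gi': "g absolutely_integrable_on {u i..v i}"
        using abs_integrable_subinterval[OF fgi] abs_integrable_subinterval[OF gi] i by auto
      have "F (v i) - F (u i) = integral {u i..v i} f" using is_primitive_diff[OF assms] i by simp
      also have "\<dots> = integral {u i..v i} (\<lambda>x. (f x - g x) + g x)" by simp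
      also have "\<dots> = integral {u i..v i} (\<lambda>x. f x - g x) + integral {u i..v i} g"
        using fgi' gi' by (intro integral_add) (auto simp: absolutely_integrable_on_def)
      finally have "norm (F (v i) - F (u i)) \<le> norm (integral {u i..v i} (\<lambda>x. f x - g x)) + norm (integral {u i..v i} g)"
        by (metis norm_triangle_ineq)
      moreover have "norm (integral {u i..v i} (\<lambda>x. f x - g x)) \<le> integral {u i..v i} (\<lambda>x. norm (f x - g x))"
        using fgi' by (intro integral_norm_bound_integral) (auto simp: absolutely_integrable_on_def)
      moreover have "norm (integral {u i..v i} g) \<le> B * (v i - u i)"
        using i B(2) by (intro integral_bound continuous_on_subset[OF g01]) auto
      ultimately show ?thesis by linarith
    qed
    have "(\<Sum>i<n. norm (F (v i) - F (u i))) \<le>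
        (\<Sum>i<n. integral {u i..v i} (\<lambda>x. norm (f x - g x)) + B * (v i - u i))"
      by (intro sum_mono) (use step in auto)
    also have "\<dots> = (\<Sum>i<n. integral {u i..v i} (\<lambda>x. norm (f x - g x))) + B * (\<Sum>i<n. v i - u i)"
      by (simp add: sum.distrib sum_distrib_left)
    also have "(\<Sum>i<n. integral {u i..v i} (\<lambda>x. norm (f x - g x))) \<le> integral {0..1} (\<lambda>x. norm (f x - g x))"
      using fgi uv disj by (intro sum_integrals_le_integral) (auto simp: absolutely_integrable_on_def)
    also have "B * (\<Sum>i<n. v i - u i) < e/2"
      using small B by (simp add: field_simps)
    finally show "(\<Sum>i<n. norm (F (v i) - F (u i))) < e" using ge by simp
  qed
qed

text \<open>
Lebesgue differentiation. Right-hand difference quotients of an indefinite integral converge almost everywhere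
(\<open>integrable_ccontinuous_explicit\<close>); left-hand quotients are right-hand ones of the reflected function.
\<close>

lemma is_primitive_deriv_ae:
  fixes F f :: "real \<Rightarrow> 'a::euclidean_space"
  assumes "is_primitive F f"
  obtains N where "negligible N" "\<And>x. x \<in> {0..1} - N \<Longrightarrow> (F has_vector_derivative f x) (at x within {0..1})"
proof -
  \<comment> \<open>extension by zero gives integrability over every interval of the line\<close>
  define f0 where "f0 = (\<lambda>x. if x \<in> {0..1} then f x else 0)"
  have fi: "f absolutely_integrable_on {0..1}" using assms by (rule is_primitive_integrable)
  have "f0 integrable_on UNIV"
    using fi unfolding f0_def absolutely_integrable_on_def
    using Henstock_Kurzweil_Integration.integrable_restrict_UNIV by blast
  then have f0i: "f0 integrable_on cbox a b" for a b
    using integrable_on_subcbox by blast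
  have f0r: "(\<lambda>x. f0 (- x)) integrable_on cbox a b" for a b :: real
    using f0i[of "-b" "-a"] Henstock_Kurzweil_Integration.integrable_reflect_real[where f=f0 and a="-b" and b="-a"] by simp
  obtain N1 where N1: "negligible N1" and d1: "\<And>x e. \<lbrakk>x \<notin> N1; 0 < e\<rbrakk> \<Longrightarrow>
      \<exists>d>0. \<forall>h. 0 < h \<and> h < d \<longrightarrow> norm (integral (cbox x (x + h *\<^sub>R One)) f0 /\<^sub>R h ^ DIM(real) - f0 x) < e"
    using integrable_ccontinuous_explicit[of f0] f0i by blast
  obtain N2 where N2: "negligible N2" and d2: "\<And>x e. \<lbrakk>x \<notin> N2; 0 < e\<rbrakk> \<Longrightarrow>
      \<exists>d>0. \<forall>h. 0 < h \<and> h < d \<longrightarrow> norm (integral (cbox x (x + h *\<^sub>R One)) (\<lambda>x. f0 (- x)) /\<^sub>R h ^ DIM(real) - f0 (- x)) < e"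
    using integrable_ccontinuous_explicit[of "\<lambda>x. f0 (- x)"] f0r by blast
  show thesis
  proof (rule that)
    show "negligible (N1 \<union> uminus ` N2)"
      using N1 negligible_differentiable_image_negligible[OF _ N2, of uminus]
      by (auto intro!: negligible_Un simp: differentiable_on_def)
    fix x assume x: "x \<in> {0..1} - (N1 \<union> uminus ` N2)"
    then have x1: "x \<notin> N1" and x2: "- x \<notin> N2" by (auto intro: image_eqI[of _ _ "-x"])
    have Fd: "F v - F u = integral {u..v} f0" if "0 \<le> u" "u \<le> v" "v \<le> 1" for u v
    proof -
      have "integral {u..v} f0 = integral {u..v} f"
        using that by (intro integral_cong) (auto simp: f0_def)
      then show ?thesis using is_primitive_diff[OF assms that] by simp
    qed
    have "\<exists>d>0. \<forall>y\<in>{0..1}. norm (y - x) < d \<longrightarrow> norm (F y - F x - (y - x) *\<^sub>R f x) \<le> e * norm (y - x)"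
      if e: "0 < e" for e
    proof -
      obtain r1 where r1: "r1 > 0" and R1: "\<And>h. 0 < h \<Longrightarrow> h < r1 \<Longrightarrow> norm (integral {x..x + h} f0 /\<^sub>R h - f0 x) < e"
        using d1[OF x1 e] by auto
      obtain r2 where r2: "r2 > 0" and R2: "\<And>h. 0 < h \<Longrightarrow> h < r2 \<Longrightarrow> norm (integral {-x..-x + h} (\<lambda>x. f0 (- x)) /\<^sub>R h - f0 x) < e"
        using d2[OF x2 e] by auto
      have key: "norm (w - h *\<^sub>R z) \<le> e * h" if "norm (w /\<^sub>R h - z) < e" "0 < h" for w z :: 'a and h
      proof -
        have "w - h *\<^sub>R z = h *\<^sub>R (w /\<^sub>R h - z)" using that by (simp add: algebra_simps)
        then have "norm (w - h *\<^sub>R z) = h * norm (w /\<^sub>R h - z)" using that by simp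
        also have "\<dots> \<le> e * h" using that by (simp add: mult.commute)
        finally show ?thesis .
      qed
      show ?thesis
      proof (intro exI[of _ "min r1 r2"] conjI ballI impI)
        show "0 < min r1 r2" using r1 r2 by simp
        fix y assume y: "y \<in> {0..1}" "norm (y - x) < min r1 r2"
        have fx: "f0 x = f x" using x by (simp add: f0_def)
        consider "y = x" | "y > x" | "y < x" by linarith
        then show "norm (F y - F x - (y - x) *\<^sub>R f x) \<le> e * norm (y - x)"
        proof cases
          case 1 then show ?thesis by simp
        next
          case 2
          then have "F y - F x = integral {x..x + (y - x)} f0" using Fd[of x y] x y by simp
          then show ?thesis using key[OF R1[of "y - x"]] 2 y fx by simp
        next
          case 3
          then have "F x - F y = integral {y..x} f0" using Fd[of y x] x y by simp
          also have "\<dots> = integral {-x..-x + (x - y)} (\<lambda>x. f0 (- x))"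
            using Henstock_Kurzweil_Integration.integral_reflect_real[where f=f0 and a=y and b=x] by simp
          finally have "norm ((F x - F y) - (x - y) *\<^sub>R f x) \<le> e * (x - y)"
            using key[OF R2[of "x - y"]] 3 y fx by simp
          moreover have "F y - F x - (y - x) *\<^sub>R f x = - ((F x - F y) - (x - y) *\<^sub>R f x)"
            by (simp add: algebra_simps)
          ultimately show ?thesis using 3 by (metis abs_minus_commute abs_of_pos diff_gt_0_iff_gt norm_minus_cancel real_norm_def)
        qed
      qed
    qed
    then show "(F has_vector_derivative f x) (at x within {0..1})"
      unfolding has_vector_derivative_def has_derivative_within_alt
      by (auto intro: bounded_linear_scaleR_left)
  qed
qed

text \<open>
Tagged divisions are sets, not sequences, so absolute continuity is needed for arbitrary finite index sets.
\<close>

lemma abs_cont_finite_family: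
  assumes "abs_cont_on_interval a b F" "0 < e"
  shows "\<exists>d>0. \<forall>(I::'i set) u v. finite I \<longrightarrow> (\<forall>i\<in>I. a \<le> u i \<and> u i \<le> v i \<and> v i \<le> b) \<longrightarrow>
       disjoint_family_on (\<lambda>i. {u i<..<v i}) I \<longrightarrow> (\<Sum>i\<in>I. v i - u i) < d \<longrightarrow>
       (\<Sum>i\<in>I. norm (F (v i) - F (u i))) < e"
proof -
  obtain d where d: "0 < d" and D: "\<And>(n::nat) u v. (\<forall>i<n. a \<le> u i \<and> u i \<le> v i \<and> v i \<le> b) \<Longrightarrow>
        disjoint_family_on (\<lambda>i. {u i<..<v i}) {..<n} \<Longrightarrow>
        (\<Sum>i<n. v i - u i) < d \<Longrightarrow> (\<Sum>i<n. norm (F (v i) - F (u i))) < e"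
    using assms unfolding abs_cont_on_interval_def by meson
  show ?thesis
  proof (intro exI[of _ d] conjI allI impI d)
    fix I :: "'i set" and u v :: "'i \<Rightarrow> real"
    assume I: "finite I" and uv: "\<forall>i\<in>I. a \<le> u i \<and> u i \<le> v i \<and> v i \<le> b"
      and disj: "disjoint_family_on (\<lambda>i. {u i<..<v i}) I" and small: "(\<Sum>i\<in>I. v i - u i) < d"
    obtain h where h: "bij_betw h {..<card I} I"
      using ex_bij_betw_nat_finite[OF I] by (auto simp: atLeast0LessThan)
    have "(\<Sum>i<card I. v (h i) - u (h i)) < d"
      using small sum.reindex_bij_betw[OF h, of "\<lambda>i. v i - u i"] by simp
    moreover have "\<forall>i<card I. a \<le> u (h i) \<and> u (h i) \<le> v (h i) \<and> v (h i) \<le> b"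
      using uv bij_betwE[OF h] by auto
    moreover have "disjoint_family_on (\<lambda>i. {u (h i)<..<v (h i)}) {..<card I}"
      unfolding disjoint_family_on_def
    proof (intro ballI impI)
      fix m n assume mn: "m \<in> {..<card I}" "n \<in> {..<card I}" "m \<noteq> n"
      then have "h m \<in> I" "h n \<in> I" "h m \<noteq> h n"
        using h by (auto simp: bij_betw_def inj_on_def)
      then show "{u (h m)<..<v (h m)} \<inter> {u (h n)<..<v (h n)} = {}"
        using disj unfolding disjoint_family_on_def by blast
    qed
    ultimately have "(\<Sum>i<card I. norm (F (v (h i)) - F (u (h i)))) < e"
      using D[where u="\<lambda>i. u (h i)" and v="\<lambda>i. v (h i)"] by blast
    then show "(\<Sum>i\<in>I. norm (F (v i) - F (u i))) < e"
      using sum.reindex_bij_betw[OF h, of "\<lambda>i. norm (F (v i) - F (u i))"] by simp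
  qed
qed

lemma negligible_outer_open:
  assumes "negligible (N::real set)" "0 < d"
  obtains T where "open T" "N \<subseteq> T" "T \<in> lmeasurable" "measure lebesgue T < d"
proof -
  have N: "N \<in> sets lebesgue" "emeasure lebesgue N = 0"
    using assms(1) by (auto simp: negligible_iff_null_sets null_sets_def)
  obtain T where T: "open T" "N \<subseteq> T" "T - N \<in> lmeasurable" "emeasure lebesgue (T - N) < ennreal d"
    using sets_lebesgue_outer_open[OF N(1) assms(2)] by blast
  have Ts: "T \<in> sets lebesgue" using T(1) by simp
  have "emeasure lebesgue T = emeasure lebesgue (T - N)"
    using T(2) N Ts by (metis assms(1) emeasure_Diff_null_set negligible_iff_null_sets)
  then have lt: "emeasure lebesgue T < ennreal d" using T(4) by simp
  then have "T \<in> lmeasurable"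
    using Ts by (metis ennreal_less_top fmeasurableI infinity_ennreal_def order_less_trans)
  moreover have "measure lebesgue T < d"
    using lt assms(2) \<open>T \<in> lmeasurable\<close>
    by (metis emeasure_eq_measure2 ennreal_less_iff measure_nonneg)
  ultimately show thesis using that T by blast
qed

text \<open>
The fundamental theorem of calculus for absolutely continuous functions, proved directly for the gauge
integral. At points of differentiability the gauge is the one of the classical proof. The exceptional null
set is covered by an open set of small measure in which the gauge confines the intervals tagged there;
absolute continuity makes their total increment small, and the integrand may be taken to be zero at
their tags.
\<close>

theorem abs_cont_has_integral_deriv:
  fixes F :: "real \<Rightarrow> 'a::banach"
  assumes ac: "abs_cont_on_interval a b F" and ab: "a \<le> b" and N: "negligible N"
    and deriv: "\<And>x. x \<in> {a..b} - N \<Longrightarrow> (F has_vector_derivative f x) (at x within {a..b})"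
  shows "(f has_integral F b - F a) {a..b}"
proof -
  define f0 where "f0 = (\<lambda>x. if x \<in> N then 0 else f x)"
  have "(f0 has_integral F b - F a) {a..b}"
    unfolding has_integral_real
  proof (intro allI impI)
    fix e :: real assume e: "0 < e"
    define c where "c = e / (2 * (b - a + 1))"
    have c: "0 < c" using e ab by (simp add: c_def)
    have "c * (b - a) < c * (b - a + 1)" using c by simp
    also have "\<dots> = e / 2" using ab by (simp add: c_def divide_simps)
    finally have cb: "c * (b - a) < e / 2" .
    obtain \<delta> where \<delta>: "0 < \<delta>" and small: "\<forall>(I::(real \<times> real set) set) u v. finite I \<longrightarrow>
        (\<forall>i\<in>I. a \<le> u i \<and> u i \<le> v i \<and> v i \<le> b) \<longrightarrow>
        disjoint_family_on (\<lambda>i. {u i<..<v i}) I \<longrightarrow> (\<Sum>i\<in>I. v i - u i) < \<delta> \<longrightarrow>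
        (\<Sum>i\<in>I. norm (F (v i) - F (u i))) < e / 2"
      using abs_cont_finite_family[OF ac, of "e/2"] e by auto
    obtain T where T: "open T" "N \<subseteq> T" "T \<in> lmeasurable" "measure lebesgue T < \<delta>"
      using negligible_outer_open[OF N \<delta>] by blast
    have "\<exists>r>0. \<forall>y\<in>{a..b}. norm (y - x) < r \<longrightarrow> norm (F y - F x - (y - x) *\<^sub>R f x) \<le> c * norm (y - x)"
      if "x \<in> {a..b} - N" for x
      using deriv[OF that] c unfolding has_vector_derivative_def has_derivative_within_alt by blast
    then obtain r where r: "\<And>x. x \<in> {a..b} - N \<Longrightarrow> r x > 0"
      and R: "\<And>x y. x \<in> {a..b} - N \<Longrightarrow> y \<in> {a..b} \<Longrightarrow> norm (y - x) < r x \<Longrightarrow>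
           norm (F y - F x - (y - x) *\<^sub>R f x) \<le> c * norm (y - x)"
      by metis
    \<comment> \<open>intervals tagged in \<open>N\<close> are confined to \<open>T\<close>\<close>
    define \<gamma> where "\<gamma> = (\<lambda>x. if x \<in> N then T else if x \<in> {a..b} then ball x (r x) else ball x 1)"
    show "\<exists>\<gamma>. gauge \<gamma> \<and> (\<forall>p. p tagged_division_of {a..b} \<and> \<gamma> fine p \<longrightarrow>
        norm ((\<Sum>(x,k)\<in>p. measure lborel k *\<^sub>R f0 x) - (F b - F a)) < e)"
    proof (intro exI[of _ \<gamma>] conjI allI impI)
      show "gauge \<gamma>" using T r by (auto simp: \<gamma>_def gauge_def)
      fix p assume p: "p tagged_division_of {a..b} \<and> \<gamma> fine p"
      then have fin: "finite p" and td: "p tagged_division_of {a..b}" and fine: "\<gamma> fine p" by auto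
      define u where "u = (\<lambda>i::real \<times> real set. Inf (snd i))"
      define v where "v = (\<lambda>i::real \<times> real set. Sup (snd i))"
      have K: "snd i = {u i..v i} \<and> a \<le> u i \<and> u i \<le> fst i \<and> fst i \<le> v i \<and> v i \<le> b"
        if "i \<in> p" for i
      proof -
        obtain x k where i: "i = (x,k)" by force
        have xk: "x \<in> k" "k \<subseteq> {a..b}" using tagged_division_ofD(2,3)[OF td] that i by auto
        have "\<exists>l m. k = {l..m}" using tagged_division_ofD(4)[OF td, of x k] that i by auto
        then obtain l m where k: "k = {l..m}" by blast
        then show ?thesis using xk i by (auto simp: u_def v_def)
      qed
      have tel: "(\<Sum>i\<in>p. F (v i) - F (u i)) = F b - F a"
        using additive_tagged_division_1[OF ab td, of F] by (simp add: u_def v_def split_def)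
      have cont: "measure lborel (snd i) = v i - u i" if "i \<in> p" for i
        using K[OF that] by simp
      have total: "(\<Sum>i\<in>p. v i - u i) = b - a"
        using additive_tagged_division_1[OF ab td, of "\<lambda>x. x"] by (simp add: u_def v_def split_def)
      let ?B = "{i\<in>p. fst i \<in> N}" and ?G = "{i\<in>p. fst i \<notin> N}"
      have pBG: "p = ?B \<union> ?G" by blast
      let ?d = "\<lambda>i. measure lborel (snd i) *\<^sub>R f0 (fst i) - (F (v i) - F (u i))"
      have "(\<Sum>(x,k)\<in>p. measure lborel k *\<^sub>R f0 x) - (F b - F a) = (\<Sum>i\<in>p. ?d i)"
        unfolding tel[symmetric] by (simp add: sum_subtractf split_def)
      also have "norm \<dots> \<le> (\<Sum>i\<in>p. norm (?d i))" by (rule norm_sum)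
      also have "\<dots> = (\<Sum>i\<in>?B. norm (?d i)) + (\<Sum>i\<in>?G. norm (?d i))"
        by (subst pBG, rule sum.union_disjoint) (use fin in auto)
      also have "(\<Sum>i\<in>?B. norm (?d i)) = (\<Sum>i\<in>?B. norm (F (v i) - F (u i)))"
        by (intro sum.cong) (auto simp: f0_def norm_minus_commute)
      also have "\<dots> < e / 2"
      proof (rule small[rule_format])
        show "finite ?B" using fin by simp
        show "a \<le> u i \<and> u i \<le> v i \<and> v i \<le> b" if "i \<in> ?B" for i
          using K that by fastforce
        show disj: "disjoint_family_on (\<lambda>i. {u i<..<v i}) ?B"
          unfolding disjoint_family_on_def
        proof (intro ballI impI)
          fix i j assume ij: "i \<in> ?B" "j \<in> ?B" "i \<noteq> j"
          then have "interior (snd i) \<inter> interior (snd j) = {}"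
            using tagged_division_ofD(5)[OF td, of "fst i" "snd i" "fst j" "snd j"] by (auto simp: prod_eq_iff)
          then show "{u i<..<v i} \<inter> {u j<..<v j} = {}"
            using K[of i] K[of j] ij by simp
        qed
        have sub: "{u i<..<v i} \<subseteq> T" if "i \<in> ?B" for i
        proof -
          have "snd i \<subseteq> \<gamma> (fst i)" using fine that unfolding fine_def by (cases i) auto
          then have "{u i..v i} \<subseteq> T" using that K[of i] by (auto simp: \<gamma>_def)
          then show ?thesis by (meson greaterThanLessThan_subseteq_atLeastAtMost_iff order_refl subset_trans)
        qed
        have "(\<Sum>i\<in>?B. v i - u i) = (\<Sum>i\<in>?B. measure lebesgue {u i<..<v i})"
          using K by (intro sum.cong refl) force
        also have "\<dots> = measure lebesgue (\<Union>i\<in>?B. {u i<..<v i})"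
          using disj fin by (intro measure_UNION'[symmetric])
            (auto simp: disjoint_family_on_def pairwise_def disjnt_def)
        also have "\<dots> \<le> measure lebesgue T"
        proof (rule measure_mono_fmeasurable)
          have "open (\<Union>i\<in>?B. {u i<..<v i})" by auto
          then show "(\<Union>i\<in>?B. {u i<..<v i}) \<in> sets lebesgue" by simp
        qed (use sub T(3) in blast)+
        also have "\<dots> < \<delta>" by (rule T(4))
        finally show "(\<Sum>i\<in>?B. v i - u i) < \<delta>" .
      qed
      also have "(\<Sum>i\<in>?G. norm (?d i)) \<le> (\<Sum>i\<in>?G. c * (v i - u i))"
      proof (intro sum_mono)
        fix i assume i: "i \<in> ?G"
        define x where "x = fst i"
        have k: "snd i = {u i..v i}" "a \<le> u i" "u i \<le> x" "x \<le> v i" "v i \<le> b"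
          using K[of i] i by (auto simp: x_def)
        have x: "x \<in> {a..b} - N" using k i by (auto simp: x_def)
        have "snd i \<subseteq> \<gamma> x" using fine i unfolding fine_def x_def by (cases i) auto
        then have sub: "{u i..v i} \<subseteq> ball x (r x)" using x k(1) by (auto simp: \<gamma>_def)
        have "u i \<in> ball x (r x)" "v i \<in> ball x (r x)" by (rule subsetD[OF sub], use k in simp)+
        then have close: "norm (u i - x) < r x" "norm (v i - x) < r x"
          by (auto simp: dist_norm norm_minus_commute)
        have 1: "norm (F (v i) - F x - (v i - x) *\<^sub>R f x) \<le> c * (v i - x)"
          using R[OF x _ close(2)] k by simp
        have 2: "norm (F (u i) - F x - (u i - x) *\<^sub>R f x) \<le> c * (x - u i)"
          using R[OF x _ close(1)] k by simp
        have "?d i = (v i - u i) *\<^sub>R f x - (F (v i) - F (u i))"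
          using cont[of i] i x by (simp add: f0_def flip: x_def)
        also have "\<dots> = (F (u i) - F x - (u i - x) *\<^sub>R f x) - (F (v i) - F x - (v i - x) *\<^sub>R f x)"
          by (simp add: algebra_simps)
        finally have eq: "?d i = \<dots>" .
        have "norm (?d i) \<le> c * (x - u i) + c * (v i - x)"
          unfolding eq by (rule order_trans[OF norm_triangle_ineq4 add_mono[OF 2 1]])
        then show "norm (?d i) \<le> c * (v i - u i)" by (simp add: algebra_simps)
      qed
      also have "\<dots> \<le> (\<Sum>i\<in>p. c * (v i - u i))"
      proof (rule sum_mono2[OF fin])
        show "0 \<le> c * (v i - u i)" if "i \<in> p - ?G" for i
          using K[of i] that c by simp
      qed blast
      also have "\<dots> = c * (b - a)" by (simp add: total flip: sum_distrib_left)
      finally show "norm ((\<Sum>(x,k)\<in>p. measure lborel k *\<^sub>R f0 x) - (F b - F a)) < e" using cb by simp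
    qed
  qed
  then show ?thesis
    by (rule has_integral_spike[OF N, rotated]) (auto simp: f0_def)
qed

lemma abs_cont_subinterval:
  assumes "abs_cont_on_interval a b F" "a \<le> c" "d \<le> b"
  shows "abs_cont_on_interval c d F"
  unfolding abs_cont_on_interval_def
proof (intro allI impI)
  fix e :: real assume "0 < e"
  then obtain \<delta> where \<delta>: "0 < \<delta>" and D: "\<And>(n::nat) u v. (\<forall>i<n. a \<le> u i \<and> u i \<le> v i \<and> v i \<le> b) \<Longrightarrow>
        disjoint_family_on (\<lambda>i. {u i<..<v i}) {..<n} \<Longrightarrow>
        (\<Sum>i<n. v i - u i) < \<delta> \<Longrightarrow> (\<Sum>i<n. norm (F (v i) - F (u i))) < e"
    using assms(1) unfolding abs_cont_on_interval_def by meson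
  show "\<exists>\<delta>>0. \<forall>(n::nat) u v. (\<forall>i<n. c \<le> u i \<and> u i \<le> v i \<and> v i \<le> d) \<longrightarrow>
        disjoint_family_on (\<lambda>i. {u i<..<v i}) {..<n} \<longrightarrow>
        (\<Sum>i<n. v i - u i) < \<delta> \<longrightarrow> (\<Sum>i<n. norm (F (v i) - F (u i))) < e"
    using \<delta> D assms(2,3) by (intro exI[of _ \<delta>]) (meson order_trans)
qed

lemma is_primitiveI:
  fixes F :: "real \<Rightarrow> 'a::euclidean_space"
  assumes "abs_cont_on_interval 0 1 F" "f absolutely_integrable_on {0..1}" "negligible N"
    and d: "\<And>x. x \<in> {0..1} - N \<Longrightarrow> (F has_vector_derivative f x) (at x within {0..1})"
  shows "is_primitive F f"
proof -
  have "(f has_integral F x - F 0) {0..x}" if x: "x \<in> {0..1}" for x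
  proof (rule abs_cont_has_integral_deriv[OF _ _ assms(3)])
    show "abs_cont_on_interval 0 x F" using abs_cont_subinterval[OF assms(1)] x by auto
    show "(F has_vector_derivative f y) (at y within {0..x})" if "y \<in> {0..x} - N" for y
      by (rule has_vector_derivative_within_subset[OF d]) (use that x in auto)
  qed (use x in auto)
  then have "integral {0..x} f = F x - F 0" if "x \<in> {0..1}" for x
    using that by (simp add: integral_unique)
  then have "\<forall>x\<in>{0..1}. F x = F 0 + integral {0..x} f" by simp
  then show ?thesis using assms(2) unfolding is_primitive_def by blast
qed

lemma is_primitive_continuous:
  fixes F :: "real \<Rightarrow> 'a::euclidean_space"
  assumes "is_primitive F f"
  shows "continuous_on {0..1} F"
proof -
  have "f integrable_on {0..1}" using is_primitive_integrable[OF assms] by (simp add: absolutely_integrable_on_def)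
  then have "continuous_on {0..1} (\<lambda>x. F 0 + integral {0..x} f)"
    by (intro continuous_intros indefinite_integral_continuous_1)
  then show ?thesis
    by (rule continuous_on_eq) (rule is_primitiveD[OF assms, symmetric])
qed

lemma continuous_on_01_bound:
  fixes F :: "real \<Rightarrow> 'a::real_normed_vector"
  assumes "continuous_on {0..1} F"
  obtains B where "0 < B" "\<And>x. x \<in> {0..1} \<Longrightarrow> norm (F x) \<le> B"
proof -
  have "bounded (F ` {0..1})"
    by (rule compact_imp_bounded[OF compact_continuous_image[OF assms compact_Icc]])
  then obtain B where "0 < B" "\<forall>x\<in>{0..1}. norm (F x) \<le> B" by (auto simp: bounded_pos)
  then show thesis using that[of B] by blast
qed

lemma abs_integrable_bilinear_continuous:
  fixes B :: "'a::euclidean_space \<Rightarrow> 'b::euclidean_space \<Rightarrow> 'c::euclidean_space"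
  assumes B: "bounded_bilinear B" and F: "continuous_on {0..1} F" and g: "g absolutely_integrable_on {0..1}"
  shows "(\<lambda>x. B (F x) (g x)) absolutely_integrable_on {0..1::real}"
proof (rule absolutely_integrable_bounded_measurable_product[where h=B and f=F, OF _ _ _ _ g])
  show "bilinear B" using B by (simp add: bilinear_conv_bounded_bilinear)
  show "F \<in> borel_measurable (lebesgue_on {0..1})"
    using F by (rule continuous_imp_measurable_on_sets_lebesgue) simp
  show "bounded (F ` {0..1})"
    by (rule compact_imp_bounded[OF compact_continuous_image[OF F compact_Icc]])
  show "{0..1::real} \<in> sets lebesgue" by simp
qed

lemma abs_cont_bilinear:
  fixes F :: "real \<Rightarrow> 'a::real_normed_vector" and G :: "real \<Rightarrow> 'b::real_normed_vector"
    and B :: "'a \<Rightarrow> 'b \<Rightarrow> 'c::real_normed_vector"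
  assumes B: "bounded_bilinear B"
    and F: "abs_cont_on_interval 0 1 F" "continuous_on {0..1} F"
    and G: "abs_cont_on_interval 0 1 G" "continuous_on {0..1} G"
  shows "abs_cont_on_interval 0 1 (\<lambda>x. B (F x) (G x))"
proof -
  interpret bounded_bilinear B by (rule B)
  obtain k where k: "0 < k" "\<And>a b. norm (B a b) \<le> norm a * norm b * k" using pos_bounded by blast
  obtain C where C: "0 < C" "\<And>x. x \<in> {0..1} \<Longrightarrow> norm (F x) \<le> C" using continuous_on_01_bound[OF F(2)] by blast
  obtain D where D: "0 < D" "\<And>x. x \<in> {0..1} \<Longrightarrow> norm (G x) \<le> D" using continuous_on_01_bound[OF G(2)] by blast
  show ?thesis
    unfolding abs_cont_on_interval_def
  proof (intro allI impI)
    fix e :: real assume e: "0 < e"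
    obtain d1 where d1: "0 < d1" and D1: "\<And>(n::nat) u v. (\<forall>i<n. 0 \<le> u i \<and> u i \<le> v i \<and> v i \<le> 1) \<Longrightarrow>
        disjoint_family_on (\<lambda>i. {u i<..<v i}) {..<n} \<Longrightarrow>
        (\<Sum>i<n. v i - u i) < d1 \<Longrightarrow> (\<Sum>i<n. norm (F (v i) - F (u i))) < e / (2 * k * D)"
      using F(1)[unfolded abs_cont_on_interval_def, rule_format, of "e / (2*k*D)"] e k D by auto
    obtain d2 where d2: "0 < d2" and D2: "\<And>(n::nat) u v. (\<forall>i<n. 0 \<le> u i \<and> u i \<le> v i \<and> v i \<le> 1) \<Longrightarrow>
        disjoint_family_on (\<lambda>i. {u i<..<v i}) {..<n} \<Longrightarrow>
        (\<Sum>i<n. v i - u i) < d2 \<Longrightarrow> (\<Sum>i<n. norm (G (v i) - G (u i))) < e / (2 * k * C)"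
      using G(1)[unfolded abs_cont_on_interval_def, rule_format, of "e / (2*k*C)"] e k C by auto
    show "\<exists>\<delta>>0. \<forall>(n::nat) u v. (\<forall>i<n. 0 \<le> u i \<and> u i \<le> v i \<and> v i \<le> 1) \<longrightarrow>
        disjoint_family_on (\<lambda>i. {u i<..<v i}) {..<n} \<longrightarrow>
        (\<Sum>i<n. v i - u i) < \<delta> \<longrightarrow> (\<Sum>i<n. norm (B (F (v i)) (G (v i)) - B (F (u i)) (G (u i)))) < e"
    proof (intro exI[of _ "min d1 d2"] conjI allI impI)
      show "0 < min d1 d2" using d1 d2 by simp
      fix n :: nat and u v :: "nat \<Rightarrow> real"
      assume uv: "\<forall>i<n. 0 \<le> u i \<and> u i \<le> v i \<and> v i \<le> 1"
        and disj: "disjoint_family_on (\<lambda>i. {u i<..<v i}) {..<n}" and small: "(\<Sum>i<n. v i - u i) < min d1 d2"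
      have "norm (B (F (v i)) (G (v i)) - B (F (u i)) (G (u i))) \<le>
          k * D * norm (F (v i) - F (u i)) + k * C * norm (G (v i) - G (u i))" if "i < n" for i
      proof -
        have i: "u i \<in> {0..1}" "v i \<in> {0..1}" using uv that by force+
        have "B (F (v i)) (G (v i)) - B (F (u i)) (G (u i)) = B (F (v i) - F (u i)) (G (v i)) + B (F (u i)) (G (v i) - G (u i))"
          by (simp add: diff_left diff_right)
        also have "norm \<dots> \<le> norm (B (F (v i) - F (u i)) (G (v i))) + norm (B (F (u i)) (G (v i) - G (u i)))"
          by (rule norm_triangle_ineq)
        also have "norm (B (F (v i) - F (u i)) (G (v i))) \<le> norm (F (v i) - F (u i)) * norm (G (v i)) * k" by (rule k)
        also have "\<dots> \<le> norm (F (v i) - F (u i)) * D * k" using D i k by (intro mult_right_mono mult_left_mono) auto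
        also have "norm (B (F (u i)) (G (v i) - G (u i))) \<le> norm (F (u i)) * norm (G (v i) - G (u i)) * k" by (rule k)
        also have "\<dots> \<le> C * norm (G (v i) - G (u i)) * k" using C i k by (intro mult_right_mono) auto
        finally show ?thesis by (simp add: algebra_simps)
      qed
      then have "(\<Sum>i<n. norm (B (F (v i)) (G (v i)) - B (F (u i)) (G (u i)))) \<le>
         (\<Sum>i<n. k * D * norm (F (v i) - F (u i)) + k * C * norm (G (v i) - G (u i)))"
        by (intro sum_mono) auto
      also have "\<dots> = k * D * (\<Sum>i<n. norm (F (v i) - F (u i))) + k * C * (\<Sum>i<n. norm (G (v i) - G (u i)))"
        by (simp add: sum.distrib sum_distrib_left)
      also have "\<dots> < k * D * (e / (2*k*D)) + k * C * (e / (2*k*C))"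
      proof (rule add_strict_mono)
        show "k * D * (\<Sum>i<n. norm (F (v i) - F (u i))) < k * D * (e / (2*k*D))"
          by (rule mult_strict_left_mono[OF D1[OF uv disj]]) (use small k D in simp_all)
        show "k * C * (\<Sum>i<n. norm (G (v i) - G (u i))) < k * C * (e / (2*k*C))"
          by (rule mult_strict_left_mono[OF D2[OF uv disj]]) (use small k C in simp_all)
      qed
      also have "k * D * (e / (2*k*D)) = e / 2" using k D by simp
      also have "k * C * (e / (2*k*C)) = e / 2" using k C by simp
      also have "e / 2 + e / 2 = e" by simp
      finally show "(\<Sum>i<n. norm (B (F (v i)) (G (v i)) - B (F (u i)) (G (u i)))) < e" .
    qed
  qed
qed

text \<open>
Integration by parts for complex products, real products and inner products at once. Both factors are
differentiable almost everywhere and their product is absolutely continuous, so the fundamental theorem above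
applies.
\<close>

lemma is_primitive_bilinear:
  fixes B :: "'a::euclidean_space \<Rightarrow> 'b::euclidean_space \<Rightarrow> 'c::euclidean_space"
  assumes B: "bounded_bilinear B" and F: "is_primitive F f" and G: "is_primitive G g"
  shows "is_primitive (\<lambda>x. B (F x) (G x)) (\<lambda>x. B (F x) (g x) + B (f x) (G x))"
proof -
  have cF: "continuous_on {0..1} F" and cG: "continuous_on {0..1} G"
    using F G is_primitive_continuous by auto
  obtain M where M: "negligible M" "\<And>x. x \<in> {0..1} - M \<Longrightarrow> (F has_vector_derivative f x) (at x within {0..1})"
    using is_primitive_deriv_ae[OF F] by blast
  obtain N where N: "negligible N" "\<And>x. x \<in> {0..1} - N \<Longrightarrow> (G has_vector_derivative g x) (at x within {0..1})"
    using is_primitive_deriv_ae[OF G] by blast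
  have B': "bounded_bilinear (\<lambda>x y. B y x)" using B by (rule bounded_bilinear.flip)
  show ?thesis
  proof (rule is_primitiveI)
    show "abs_cont_on_interval 0 1 (\<lambda>x. B (F x) (G x))"
      by (rule abs_cont_bilinear[OF B is_primitive_abs_cont[OF F] cF is_primitive_abs_cont[OF G] cG])
    have "(\<lambda>x. B (F x) (g x)) absolutely_integrable_on {0..1}"
      using abs_integrable_bilinear_continuous[OF B cF] is_primitive_integrable[OF G] by blast
    moreover have "(\<lambda>x. B (f x) (G x)) absolutely_integrable_on {0..1}"
      using abs_integrable_bilinear_continuous[OF B' cG] is_primitive_integrable[OF F] by blast
    ultimately show "(\<lambda>x. B (F x) (g x) + B (f x) (G x)) absolutely_integrable_on {0..1}"
      by (rule set_integral_add(1))
    show "negligible (M \<union> N)" using M(1) N(1) by (rule negligible_Un)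
    show "((\<lambda>x. B (F x) (G x)) has_vector_derivative B (F x) (g x) + B (f x) (G x)) (at x within {0..1})"
      if "x \<in> {0..1} - (M \<union> N)" for x
      by (rule bounded_bilinear.has_vector_derivative[OF B]; rule M(2) N(2)) (use that in auto)
  qed
qed

lemma is_primitive_C1:
  fixes F :: "real \<Rightarrow> 'a::euclidean_space"
  assumes "continuous_on {0..1} f" "\<And>x. x \<in> {0..1} \<Longrightarrow> (F has_vector_derivative f x) (at x within {0..1})"
  shows "is_primitive F f"
proof -
  have "(f has_integral F x - F 0) {0..x}" if "x \<in> {0..1}" for x
    by (rule fundamental_theorem_of_calculus)
      (use that in \<open>auto intro: has_vector_derivative_within_subset[OF assms(2)]\<close>)
  then have "integral {0..x} f = F x - F 0" if "x \<in> {0..1}" for x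
    using that by (simp add: integral_unique)
  then have "\<forall>x\<in>{0..1}. F x = F 0 + integral {0..x} f" by simp
  then show ?thesis using absolutely_integrable_continuous_real[OF assms(1)] unfolding is_primitive_def by blast
qed

lemma is_primitive_has_deriv:
  fixes F :: "real \<Rightarrow> 'a::euclidean_space"
  assumes "is_primitive F f" "continuous_on {0..1} f" "x \<in> {0..1}"
  shows "(F has_vector_derivative f x) (at x within {0..1})"
proof -
  have "((\<lambda>x. F 0 + integral {0..x} f) has_vector_derivative 0 + f x) (at x within {0..1})"
    using integral_has_vector_derivative[OF assms(2,3)] by (intro derivative_intros)
  then have "((\<lambda>x. F 0 + integral {0..x} f) has_vector_derivative f x) (at x within {0..1})" by simp
  then show ?thesis
    by (rule has_vector_derivative_transform[OF assms(3), rotated])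
      (rule is_primitiveD[OF assms(1)])
qed

section \<open>Oscillatory integrals\<close>

lemma is_primitive_mult:
  fixes F G :: "real \<Rightarrow> complex"
  assumes "is_primitive F f" "is_primitive G g"
  shows "is_primitive (\<lambda>x. F x * G x) (\<lambda>x. F x * g x + f x * G x)"
  by (rule is_primitive_bilinear[OF bounded_bilinear_mult assms])

lemma abs_integrable_times_continuous:
  fixes f h :: "real \<Rightarrow> complex"
  assumes "f absolutely_integrable_on {0..1}" "continuous_on {0..1} h"
  shows "(\<lambda>s. f s * h s) absolutely_integrable_on {0..1}"
  using abs_integrable_bilinear_continuous[OF bounded_bilinear_mult assms(2,1)] by (simp add: mult.commute)

lemma norm_integral_mult_le:
  fixes f h :: "real \<Rightarrow> complex"
  assumes f: "f absolutely_integrable_on {0..1}" and h: "continuous_on {0..1} h" and x: "x \<in> {0..1}"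
    and D: "\<And>s. s \<in> {0..x} \<Longrightarrow> norm (h s) \<le> D"
  shows "norm (integral {0..x} (\<lambda>s. f s * h s)) \<le> D * integral {0..1} (\<lambda>s. norm (f s))"
proof -
  have "norm (h 0) \<le> D" using D[of 0] x by simp
  then have D0: "0 \<le> D" using norm_ge_zero order_trans by blast
  have fx: "f absolutely_integrable_on {0..x}" and fhx: "(\<lambda>s. f s * h s) absolutely_integrable_on {0..x}"
    using abs_integrable_subinterval[of _ 0 x] f abs_integrable_times_continuous[OF f h] x by auto
  have nf: "(\<lambda>s. norm (f s)) integrable_on {0..x}" "(\<lambda>s. norm (f s)) integrable_on {0..1}"
    using f fx by (auto simp: absolutely_integrable_on_def)
  have "norm (integral {0..x} (\<lambda>s. f s * h s)) \<le> integral {0..x} (\<lambda>s. D * norm (f s))"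
  proof (rule integral_norm_bound_integral)
    show "(\<lambda>s. f s * h s) integrable_on {0..x}" using fhx by (simp add: absolutely_integrable_on_def)
    show "(\<lambda>s. D * norm (f s)) integrable_on {0..x}" using integrable_cmul[OF nf(1), of D] by simp
    show "norm (f s * h s) \<le> D * norm (f s)" if "s \<in> {0..x}" for s
      using mult_right_mono[OF D[OF that], of "norm (f s)"] by (simp add: norm_mult mult.commute)
  qed
  also have "\<dots> = D * integral {0..x} (\<lambda>s. norm (f s))" by simp
  also have "\<dots> \<le> D * integral {0..1} (\<lambda>s. norm (f s))"
    using nf x D0 by (intro mult_left_mono integral_subset_le) auto
  finally show ?thesis .
qed

text \<open>
Integration gains a factor \<open>1 / N\<close> in the norm weighted by \<open>exp (- N * x)\<close>. This is what makes the initial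
value problem a contraction on the whole interval.
\<close>

lemma norm_integral_exp_le:
  fixes h :: "real \<Rightarrow> complex"
  assumes h: "continuous_on {0..s} h" and N: "0 < N" and s: "0 \<le> s" and D0: "0 \<le> D"
    and D: "\<And>r. r \<in> {0..s} \<Longrightarrow> norm (h r) \<le> D * exp (N * r)"
  shows "norm (integral {0..s} h) \<le> D * exp (N * s) / N"
proof -
  have ei: "((\<lambda>r. D * exp (N * r)) has_integral (D * exp (N * s) / N - D * exp (N * 0) / N)) {0..s}"
    by (rule fundamental_theorem_of_calculus[OF s])
      (use N in \<open>auto intro!: derivative_eq_intros simp: has_real_derivative_iff_has_vector_derivative[symmetric]\<close>)
  have "norm (integral {0..s} h) \<le> integral {0..s} (\<lambda>r. D * exp (N * r))"
    by (rule integral_norm_bound_integral[OF integrable_continuous_real[OF h] _ D]) (use ei in blast)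
  also have "\<dots> = D * exp (N * s) / N - D * exp (N * 0) / N" by (rule integral_unique[OF ei])
  also have "\<dots> \<le> D * exp (N * s) / N" using N D0 by simp
  finally show ?thesis .
qed

lemma cis_has_vector_derivative:
  "((\<lambda>x. cis (k * x)) has_vector_derivative \<i> * complex_of_real k * cis (k * x)) (at x within S)"
proof -
  have "((\<lambda>z. exp (\<i> * complex_of_real k * z)) has_field_derivative
      \<i> * complex_of_real k * exp (\<i> * complex_of_real k * complex_of_real x)) (at (complex_of_real x))"
    by (auto intro!: derivative_eq_intros)
  from has_vector_derivative_real_field[OF this, of S] show ?thesis
    by (simp add: cis_conv_exp mult.assoc)
qed

text \<open>
Approximate \<open>f\<close> in the mean by a polynomial, for which integration by parts gains a factor \<open>1 / k\<close>.
\<close>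

lemma Riemann_Lebesgue:
  fixes f :: "real \<Rightarrow> complex"
  assumes f: "f absolutely_integrable_on {0..1}" and e: "0 < e"
  shows "\<exists>K. \<forall>k. K \<le> \<bar>k\<bar> \<longrightarrow> norm (integral {0..1} (\<lambda>x. f x * cis (k * x))) < e"
proof -
  obtain g where g: "continuous_on UNIV g" and ge: "integral {0..1} (\<lambda>x. norm (f x - g x)) < e/4"
    using abs_integrable_continuous_approx[OF f, of "e/4"] e by auto
  have g01: "continuous_on {0..1} g" using g continuous_on_subset by blast
  obtain p where p: "polynomial_function p" and pg: "\<And>x. x \<in> {0..1} \<Longrightarrow> norm (g x - p x) < e/4"
    using Stone_Weierstrass_polynomial_function[OF compact_Icc g01, of "e/4"] e by auto
  obtain p' where p': "polynomial_function p'" and dp: "\<And>x. (p has_vector_derivative p' x) (at x)"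
    using has_vector_derivative_polynomial_function[OF p] by blast
  have cp: "continuous_on {0..1} p" and cp': "continuous_on {0..1} p'"
    using p p' continuous_on_polymonial_function by auto
  obtain B where B: "0 < B" "\<And>x. x \<in> {0..1} \<Longrightarrow> norm (p x) \<le> B" using continuous_on_01_bound[OF cp] by blast
  have pp: "is_primitive p p'"
    using cp' by (rule is_primitive_C1) (rule has_vector_derivative_at_within[OF dp])
  define B' where "B' = integral {0..1} (\<lambda>x. norm (p' x))"
  have B'0: "0 \<le> B'" unfolding B'_def by (rule integral_nonneg) (use cp' in \<open>auto intro!: integrable_continuous_real continuous_intros\<close>)
  have gi: "g absolutely_integrable_on {0..1}" and pi: "p absolutely_integrable_on {0..1}"
    using absolutely_integrable_continuous_real g01 cp by auto
  have fg: "(\<lambda>x. f x - g x) absolutely_integrable_on {0..1}"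
    using set_integral_diff(1)[OF f gi] .
  have gp: "(\<lambda>x. g x - p x) absolutely_integrable_on {0..1}"
    using set_integral_diff(1)[OF gi pi] .
  have cc: "continuous_on {0..1} (\<lambda>x. cis (k * x))" for k by (intro continuous_intros)
  show ?thesis
  proof (intro exI[of _ "(4 * (2 * B + B') + 1) / e"] allI impI)
    fix k :: real assume k: "(4 * (2 * B + B') + 1) / e \<le> \<bar>k\<bar>"
    have "0 < (4 * (2 * B + B') + 1) / e" using B B'0 e by simp
    then have k0: "0 < \<bar>k\<bar>" using k by linarith
    let ?E = "\<lambda>x. cis (k * x) / (\<i> * k)"
    have E: "is_primitive ?E (\<lambda>x. cis (k * x))"
    proof (rule is_primitive_C1[OF cc])
      fix x :: real
      have "((\<lambda>x. 1 / (\<i> * complex_of_real k) * cis (k * x)) has_vector_derivative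
          1 / (\<i> * complex_of_real k) * (\<i> * complex_of_real k * cis (k * x))) (at x within {0..1})"
        by (intro has_vector_derivative_mult_right cis_has_vector_derivative)
      then show "(?E has_vector_derivative cis (k * x)) (at x within {0..1})" using k0 by simp
    qed
    have nE: "norm (?E x) = 1 / \<bar>k\<bar>" for x by (simp add: norm_divide norm_mult)
    have "p 1 * ?E 1 - p 0 * ?E 0 = integral {0..1} (\<lambda>x. p x * cis (k * x) + p' x * ?E x)"
      using is_primitive_diff[OF is_primitive_mult[OF pp E], of 0 1] by simp
    also have "\<dots> = integral {0..1} (\<lambda>x. p x * cis (k * x)) + integral {0..1} (\<lambda>x. p' x * ?E x)"
      by (rule integral_add) (use cp cp' k0 in \<open>auto intro!: integrable_continuous_real continuous_intros\<close>)
    finally have "integral {0..1} (\<lambda>x. p x * cis (k * x)) = p 1 * ?E 1 - p 0 * ?E 0 - integral {0..1} (\<lambda>x. p' x * ?E x)"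
      by (simp add: algebra_simps)
    then have "norm (integral {0..1} (\<lambda>x. p x * cis (k * x))) \<le> norm (p 1 * ?E 1) + norm (p 0 * ?E 0) + norm (integral {0..1} (\<lambda>x. p' x * ?E x))"
      by (simp only:) (rule order_trans[OF norm_triangle_ineq4 add_right_mono[OF norm_triangle_ineq4]])
    also have "norm (p 1 * ?E 1) \<le> B / \<bar>k\<bar>" using B(2)[of 1] k0 unfolding norm_mult nE by (simp add: divide_right_mono)
    also have "norm (p 0 * ?E 0) \<le> B / \<bar>k\<bar>" using B(2)[of 0] k0 unfolding norm_mult nE by (simp add: divide_right_mono)
    also have "norm (integral {0..1} (\<lambda>x. p' x * ?E x)) \<le> 1 / \<bar>k\<bar> * B'"
      unfolding B'_def
      by (rule norm_integral_mult_le[OF is_primitive_integrable[OF pp] is_primitive_continuous[OF E]])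
        (simp_all add: nE)
    finally have np: "norm (integral {0..1} (\<lambda>x. p x * cis (k * x))) \<le> (2 * B + B') / \<bar>k\<bar>"
      using k0 by (simp add: add_divide_distrib)
    also have "\<dots> < e / 4" using k k0 e by (simp add: field_simps)
    finally have n3: "norm (integral {0..1} (\<lambda>x. p x * cis (k * x))) < e / 4" .
    have n1: "norm (integral {0..1} (\<lambda>x. (f x - g x) * cis (k * x))) \<le> 1 * integral {0..1} (\<lambda>x. norm (f x - g x))"
      by (rule norm_integral_mult_le[OF fg cc]) auto
    have n2: "norm (integral {0..1} (\<lambda>x. (g x - p x) * cis (k * x))) \<le> e/4 * (1 - 0)"
      by (rule integral_bound) (use g01 cp pg in \<open>auto intro!: continuous_intros less_imp_le simp: norm_mult\<close>)
    have "integral {0..1} (\<lambda>x. f x * cis (k * x)) = integral {0..1} (\<lambda>x. ((f x - g x) * cis (k * x) + (g x - p x) * cis (k * x)) + p x * cis (k * x))"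
      by (simp add: algebra_simps)
    also have "\<dots> = integral {0..1} (\<lambda>x. (f x - g x) * cis (k * x) + (g x - p x) * cis (k * x)) + integral {0..1} (\<lambda>x. p x * cis (k * x))"
      using abs_integrable_times_continuous[OF fg cc] abs_integrable_times_continuous[OF gp cc] abs_integrable_times_continuous[OF pi cc]
      by (intro integral_add integrable_add) (simp_all add: absolutely_integrable_on_def)
    also have "integral {0..1} (\<lambda>x. (f x - g x) * cis (k * x) + (g x - p x) * cis (k * x)) =
        integral {0..1} (\<lambda>x. (f x - g x) * cis (k * x)) + integral {0..1} (\<lambda>x. (g x - p x) * cis (k * x))"
      using abs_integrable_times_continuous[OF fg cc] abs_integrable_times_continuous[OF gp cc]
      by (intro integral_add) (simp_all add: absolutely_integrable_on_def)
    finally have "norm (integral {0..1} (\<lambda>x. f x * cis (k * x))) \<le> norm (integral {0..1} (\<lambda>x. (f x - g x) * cis (k * x))) +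
        norm (integral {0..1} (\<lambda>x. (g x - p x) * cis (k * x))) + norm (integral {0..1} (\<lambda>x. p x * cis (k * x)))"
      by (metis (no_types, lifting) add_right_mono norm_triangle_ineq order_trans)
    also have "\<dots> < e / 4 + e / 4 + e / 4"
      by (intro add_strict_mono add_less_le_mono n3) (use n1 n2 ge in simp_all)
    also have "\<dots> < e" using e by simp
    finally show "norm (integral {0..1} (\<lambda>x. f x * cis (k * x))) < e" .
  qed
qed

section \<open>Initial value problems with integrable coefficients\<close>

text \<open>
The system \<open>y' = w\<close>, \<open>w' = p * y - g\<close> is solved by a fixed point argument for \<open>w\<close> alone, since \<open>w\<close>
determines \<open>y\<close> by integration. With the substitution \<open>w x = exp (N * x) * u x\<close>, passing from \<open>w\<close> to
\<open>y\<close> costs a factor \<open>1 / N\<close>, and integrating against \<open>p\<close> costs at most the \<open>L\<^sup>1\<close> norm \<open>P\<close> of \<open>p\<close>. Choosing \<open>N\<close>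
larger than \<open>2 * P\<close> therefore yields contraction factor \<open>1/2\<close>. The space of bounded continuous functions on
the line serves as the Banach space; the clamp \<open>c\<close> extends functions on \<open>[0,1]\<close> constantly.
\<close>

lemma ivp_exists:
  fixes p g :: "real \<Rightarrow> complex"
  assumes p: "p absolutely_integrable_on {0..1}" and g: "g absolutely_integrable_on {0..1}"
  obtains y w where "is_primitive y w" "is_primitive w (\<lambda>x. p x * y x - g x)" "y 0 = \<alpha>" "w 0 = \<beta>"
proof -
  define P where "P = integral {0..1} (\<lambda>s. norm (p s))"
  define N where "N = 2 * P + 1"
  have P0: "0 \<le> P" unfolding P_def by (rule integral_nonneg) (use p in \<open>auto simp: absolutely_integrable_on_def\<close>)
  have N: "0 < N" "P / N \<le> 1/2" using P0 by (auto simp: N_def field_simps)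
  define c where "c = (\<lambda>x::real. max 0 (min 1 x))"
  have c01: "c x \<in> {0..1}" for x by (auto simp: c_def)
  have cc: "continuous_on UNIV c" unfolding c_def by (intro continuous_intros)
  define Y where "Y = (\<lambda>(u :: real \<Rightarrow>\<^sub>C complex) s. \<alpha> + integral {0..s} (\<lambda>r. exp (N * r) *\<^sub>R apply_bcontfun u r))"
  define W where "W = (\<lambda>u x. \<beta> + integral {0..x} (\<lambda>s. p s * Y u s - g s))"
  define T where "T = (\<lambda>u x. exp (- N * c x) *\<^sub>R W u (c x))"
  have eu: "continuous_on S (\<lambda>r. exp (N * r) *\<^sub>R apply_bcontfun u r)" for u :: "real \<Rightarrow>\<^sub>C complex" and S
  proof (rule continuous_on_scaleR)
    show "continuous_on S (\<lambda>r. exp (N * r))" by (intro continuous_intros)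
  qed simp
  have cY: "continuous_on {0..1} (Y u)" for u
    unfolding Y_def by (intro continuous_intros indefinite_integral_continuous_1 integrable_continuous_real eu)
  have pYg: "(\<lambda>s. p s * Y u s - g s) absolutely_integrable_on {0..1}" for u
    using set_integral_diff(1)[OF abs_integrable_times_continuous[OF p cY] g] .
  have cW: "continuous_on {0..1} (W u)" for u
    unfolding W_def using pYg
    by (intro continuous_intros indefinite_integral_continuous_1) (simp add: absolutely_integrable_on_def)
  have Tb: "T u \<in> bcontfun" for u
  proof -
    obtain B where B: "0 < B" "\<And>x. x \<in> {0..1} \<Longrightarrow> norm (W u x) \<le> B" using continuous_on_01_bound[OF cW] by blast
    show ?thesis
    proof (rule bcontfun_normI)
      show "continuous_on UNIV (T u)"
        unfolding T_def
        by (intro continuous_intros cc continuous_on_compose2[OF cW cc]) (use c01 in auto)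
      show "norm (T u x) \<le> B" for x
      proof -
        have "exp (- N * c x) \<le> 1" using N c01[of x] by simp
        moreover have "norm (W u (c x)) \<le> B" using B(2) c01 by blast
        ultimately have "exp (- N * c x) * norm (W u (c x)) \<le> 1 * B" by (intro mult_mono) auto
        then show ?thesis by (simp add: T_def)
      qed
    qed
  qed
  have lip: "dist (Bcontfun (T u)) (Bcontfun (T v)) \<le> 1/2 * dist u v" for u v
  proof (rule dist_bound)
    fix x
    define \<delta> where "\<delta> = dist u v"
    have d0: "0 \<le> \<delta>" by (simp add: \<delta>_def)
    have uv: "norm (apply_bcontfun u r - apply_bcontfun v r) \<le> \<delta>" for r
      using dist_bounded[of u r v] by (simp add: \<delta>_def dist_norm)
    have Yd: "norm (Y u s - Y v s) \<le> \<delta> * exp (N * s) / N" if s: "s \<in> {0..1}" for s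
    proof -
      have "Y u s - Y v s = integral {0..s} (\<lambda>r. exp (N * r) *\<^sub>R apply_bcontfun u r - exp (N * r) *\<^sub>R apply_bcontfun v r)"
        unfolding Y_def by (simp add: integral_diff[OF integrable_continuous_real[OF eu] integrable_continuous_real[OF eu]])
      also have "norm \<dots> \<le> \<delta> * exp (N * s) / N"
        by (rule norm_integral_exp_le[OF continuous_on_diff[OF eu eu] N(1) _ d0])
          (use uv s in \<open>simp_all add: mult.commute flip: scaleR_diff_right\<close>)
      finally show ?thesis .
    qed
    have x: "c x \<in> {0..1}" by (rule c01)
    have i: "(\<lambda>s. p s * Y u s - g s) integrable_on {0..c x}" for u
      using abs_integrable_subinterval[OF pYg, of 0 "c x"] x by (simp add: absolutely_integrable_on_def)
    have "W u (c x) - W v (c x) = integral {0..c x} (\<lambda>s. (p s * Y u s - g s) - (p s * Y v s - g s))"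
      unfolding W_def using integral_diff[OF i[of u] i[of v]] by simp
    also have "\<dots> = integral {0..c x} (\<lambda>s. p s * (Y u s - Y v s))" by (simp add: algebra_simps)
    also have "norm \<dots> \<le> \<delta> * exp (N * c x) / N * P"
      unfolding P_def
    proof (rule norm_integral_mult_le[OF p continuous_on_diff[OF cY cY] x])
      fix s assume s: "s \<in> {0..c x}"
      then have "norm (Y u s - Y v s) \<le> \<delta> * exp (N * s) / N" using Yd x by auto
      also have "\<dots> \<le> \<delta> * exp (N * c x) / N"
        using s N d0 by (intro divide_right_mono mult_left_mono) auto
      finally show "norm (Y u s - Y v s) \<le> \<delta> * exp (N * c x) / N" .
    qed
    finally have Wd: "norm (W u (c x) - W v (c x)) \<le> \<delta> * exp (N * c x) / N * P" .
    have "dist (T u x) (T v x) = exp (- N * c x) * norm (W u (c x) - W v (c x))"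
      by (simp add: T_def dist_norm flip: scaleR_diff_right)
    also have "\<dots> \<le> exp (- N * c x) * (\<delta> * exp (N * c x) / N * P)" by (intro mult_left_mono Wd) simp
    also have "\<dots> = \<delta> * (P / N)" by (simp add: exp_minus field_simps)
    also have "\<dots> \<le> \<delta> * (1/2)" using N d0 by (intro mult_left_mono) auto
    finally show "dist (apply_bcontfun (Bcontfun (T u)) x) (apply_bcontfun (Bcontfun (T v)) x) \<le> 1/2 * dist u v"
      using Tb by (simp add: Bcontfun_inverse \<delta>_def)
  qed
  obtain u where u: "Bcontfun (T u) = u"
    using banach_fix_type[of "1/2" "\<lambda>u. Bcontfun (T u)"] lip by auto
  have ux: "exp (N * x) *\<^sub>R apply_bcontfun u x = W u x" if "x \<in> {0..1}" for x
  proof -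
    have "apply_bcontfun u x = T u x" using u Tb by (metis Bcontfun_inverse)
    moreover have "c x = x" using that by (simp add: c_def)
    ultimately show ?thesis by (simp add: T_def exp_minus)
  qed
  have Y0: "Y u 0 = \<alpha>" and W0: "W u 0 = \<beta>" by (simp_all add: Y_def W_def)
  show thesis
  proof (rule that[of "Y u" "W u", OF _ _ Y0 W0])
    have "Y u x = Y u 0 + integral {0..x} (W u)" if "x \<in> {0..1}" for x
    proof -
      have "integral {0..x} (\<lambda>r. exp (N * r) *\<^sub>R apply_bcontfun u r) = integral {0..x} (W u)"
        using that by (intro integral_cong ux) auto
      then show ?thesis by (simp add: Y0) (simp add: Y_def)
    qed
    then show "is_primitive (Y u) (W u)"
      unfolding is_primitive_def using absolutely_integrable_continuous_real[OF cW] by blast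
    have "W u x = W u 0 + integral {0..x} (\<lambda>s. p s * Y u s - g s)" for x
      by (simp add: W0) (simp add: W_def)
    then show "is_primitive (W u) (\<lambda>x. p x * Y u x - g x)"
      unfolding is_primitive_def using pYg by blast
  qed
qed

text \<open>
The same weighted estimate as for existence, applied at the point \<open>z\<close> where \<open>exp (- N * x) * norm (w x)\<close> is
maximal: half of \<open>norm (w z)\<close> can be absorbed on the left. Comparing two solutions, the bound also contains
uniqueness.
\<close>

lemma ivp_bound:
  fixes p :: "real \<Rightarrow> complex"
  assumes p: "p absolutely_integrable_on {0..1}"
  obtains C where "0 < C" "\<And>y w g x. \<lbrakk>g absolutely_integrable_on {0..1}; is_primitive y w;
      is_primitive w (\<lambda>x. p x * y x - g x); x \<in> {0..1}\<rbrakk> \<Longrightarrow>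
      norm (y x) \<le> C * (norm (y 0) + norm (w 0) + integral {0..1} (\<lambda>x. norm (g x))) \<and>
      norm (w x) \<le> C * (norm (y 0) + norm (w 0) + integral {0..1} (\<lambda>x. norm (g x)))"
proof -
  define P where "P = integral {0..1} (\<lambda>s. norm (p s))"
  define N where "N = 2 * P + 1"
  have P0: "0 \<le> P" unfolding P_def by (rule integral_nonneg) (use p in \<open>auto simp: absolutely_integrable_on_def\<close>)
  have N: "0 < N" "P / N \<le> 1/2" using P0 by (auto simp: N_def field_simps)
  \<comment> \<open>\<open>2 * (1 + P) * exp N\<close> bounds \<open>w\<close>, and one more is needed for the initial value of \<open>y\<close>\<close>
  define C where "C = 1 + 2 * (1 + P) * exp N"
  have C0: "0 < C" using P0 by (simp add: C_def add_pos_nonneg)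
  show thesis
  proof (rule that[OF C0])
    fix y w g x
    assume g: "g absolutely_integrable_on {0..1}" and yw: "is_primitive y w"
      and wp: "is_primitive w (\<lambda>x. p x * y x - g x)" and x: "x \<in> {0..1::real}"
    define G where "G = integral {0..1} (\<lambda>x. norm (g x))"
    have G0: "0 \<le> G" unfolding G_def by (rule integral_nonneg) (use g in \<open>auto simp: absolutely_integrable_on_def\<close>)
    define A where "A = norm (y 0) + norm (w 0) + G"
    have cw: "continuous_on {0..1} w" and cy: "continuous_on {0..1} y"
      using is_primitive_continuous yw wp by auto
    have "continuous_on {0..1} (\<lambda>x. exp (- N * x) * norm (w x))" by (intro continuous_intros cw)
    then obtain z where z: "z \<in> {0..1}" and zmax: "\<And>r. r \<in> {0..1} \<Longrightarrow> exp (- N * r) * norm (w r) \<le> exp (- N * z) * norm (w z)"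
      using continuous_attains_sup[of "{0..1::real}" "\<lambda>x. exp (- N * x) * norm (w x)"] by auto
    define D where "D = exp (- N * z) * norm (w z)"
    have D0: "0 \<le> D" by (simp add: D_def)
    have wD: "norm (w r) \<le> D * exp (N * r)" if "r \<in> {0..1}" for r
      using zmax[OF that] by (simp add: D_def exp_minus field_simps)
    have wz: "norm (w z) = D * exp (N * z)" by (simp add: D_def exp_minus)
    have yD: "norm (y s - y 0) \<le> D * exp (N * s) / N" if s: "s \<in> {0..1}" for s
    proof -
      have "y s - y 0 = integral {0..s} w" using is_primitive_diff[OF yw, of 0 s] s by simp
      also have "norm \<dots> \<le> D * exp (N * s) / N"
        by (rule norm_integral_exp_le[OF _ N(1) _ D0]) (use s wD in \<open>auto intro: continuous_on_subset[OF cw]\<close>)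
      finally show ?thesis .
    qed
    have cyy: "continuous_on {0..1} (\<lambda>s. y s - y 0)" by (intro continuous_intros cy)
    have sub: "h integrable_on {0..z}" if "h absolutely_integrable_on {0..1}" for h :: "real \<Rightarrow> complex"
      using abs_integrable_subinterval[OF that, of 0 z] z by (simp add: absolutely_integrable_on_def)
    have cc1: "continuous_on {0..1} (\<lambda>_::real. y 0)" "continuous_on {0..1} (\<lambda>_::real. 1::complex)" by (rule continuous_on_const)+
    have "w z - w 0 = integral {0..z} (\<lambda>s. p s * y s - g s)"
      using is_primitive_diff[OF wp, of 0 z] z by simp
    also have "\<dots> = integral {0..z} (\<lambda>s. (p s * (y s - y 0) + p s * y 0) - g s * 1)" by (simp add: algebra_simps)
    also have "\<dots> = integral {0..z} (\<lambda>s. p s * (y s - y 0) + p s * y 0) - integral {0..z} (\<lambda>s. g s * 1)"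
      by (intro integral_diff integrable_add sub abs_integrable_times_continuous p g cyy cc1)
    also have "integral {0..z} (\<lambda>s. p s * (y s - y 0) + p s * y 0) = integral {0..z} (\<lambda>s. p s * (y s - y 0)) + integral {0..z} (\<lambda>s. p s * y 0)"
      by (intro integral_add sub abs_integrable_times_continuous p cyy cc1)
    finally have weq: "w z = w 0 + integral {0..z} (\<lambda>s. p s * (y s - y 0)) + integral {0..z} (\<lambda>s. p s * y 0) - integral {0..z} (\<lambda>s. g s * 1)"
      by (simp add: algebra_simps)
    have "norm (integral {0..z} (\<lambda>s. p s * (y s - y 0))) \<le> D * exp (N * z) / N * P"
      unfolding P_def
    proof (rule norm_integral_mult_le[OF p cyy z])
      fix s assume s: "s \<in> {0..z}"
      then have "norm (y s - y 0) \<le> D * exp (N * s) / N" using yD z by auto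
      also have "\<dots> \<le> D * exp (N * z) / N" using s N D0 by (intro divide_right_mono mult_left_mono) auto
      finally show "norm (y s - y 0) \<le> D * exp (N * z) / N" .
    qed
    also have "\<dots> = norm (w z) * (P / N)" by (simp add: wz)
    also have "\<dots> \<le> norm (w z) * (1/2)" using N by (intro mult_left_mono) auto
    finally have n1: "norm (integral {0..z} (\<lambda>s. p s * (y s - y 0))) \<le> norm (w z) * (1/2)" .
    have n2: "norm (integral {0..z} (\<lambda>s. p s * y 0)) \<le> norm (y 0) * P"
      unfolding P_def by (rule norm_integral_mult_le[OF p cc1(1) z]) simp
    have n3: "norm (integral {0..z} (\<lambda>s. g s * 1)) \<le> 1 * G"
      unfolding G_def by (rule norm_integral_mult_le[OF g cc1(2) z]) simp
    have norm4: "norm (a + b + c - d) \<le> norm a + norm b + norm c + norm d" for a b c d :: complex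
      using norm_triangle_ineq4[of "a + b + c" d] norm_triangle_ineq[of "a + b" c] norm_triangle_ineq[of a b]
      by linarith
    have "norm (w z) \<le> norm (w 0) + norm (integral {0..z} (\<lambda>s. p s * (y s - y 0))) + norm (integral {0..z} (\<lambda>s. p s * y 0)) + norm (integral {0..z} (\<lambda>s. g s * 1))"
      unfolding weq by (rule norm4)
    also have "\<dots> \<le> norm (w 0) + norm (w z) * (1/2) + norm (y 0) * P + G" using n1 n2 n3 by linarith
    finally have "norm (w z) \<le> 2 * (norm (w 0) + norm (y 0) * P + G)" by simp
    also have "\<dots> \<le> 2 * ((1 + P) * A)"
      using P0 G0 by (simp add: A_def algebra_simps)
    finally have wzA: "norm (w z) \<le> 2 * ((1 + P) * A)" .
    have A0: "0 \<le> A" using G0 by (simp add: A_def)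
    have "exp (- N * z) \<le> 1" using N z by simp
    then have "D \<le> 1 * norm (w z)" unfolding D_def by (intro mult_right_mono) auto
    then have DA: "D \<le> 2 * ((1 + P) * A)" using wzA by simp
    have wA: "norm (w r) \<le> 2 * (1 + P) * exp N * A" if r: "r \<in> {0..1}" for r
    proof -
      have "norm (w r) \<le> D * exp (N * r)" by (rule wD[OF r])
      also have "\<dots> \<le> (2 * ((1 + P) * A)) * exp N" using DA r N D0 P0 A0 by (intro mult_mono) auto
      finally show ?thesis by (simp add: algebra_simps)
    qed
    have "norm (y x - y 0) \<le> 2 * (1 + P) * exp N * A"
    proof -
      have "y x - y 0 = integral {0..x} w" using is_primitive_diff[OF yw, of 0 x] x by simp
      also have "norm \<dots> \<le> 2 * (1 + P) * exp N * A * (x - 0)"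
        using x wA by (intro integral_bound continuous_on_subset[OF cw]) auto
      also have "\<dots> \<le> 2 * (1 + P) * exp N * A * 1"
        using x P0 A0 by (intro mult_left_mono) auto
      finally show ?thesis by simp
    qed
    moreover have "norm (y x) \<le> norm (y 0) + norm (y x - y 0)" by (metis norm_triangle_sub)
    moreover have "norm (y 0) \<le> A" using G0 by (simp add: A_def)
    ultimately have "norm (y x) \<le> C * A" by (simp add: C_def algebra_simps)
    moreover have "norm (w x) \<le> C * A" using wA[OF x] A0 by (simp add: C_def algebra_simps)
    ultimately show "norm (y x) \<le> C * (norm (y 0) + norm (w 0) + integral {0..1} (\<lambda>x. norm (g x))) \<and>
      norm (w x) \<le> C * (norm (y 0) + norm (w 0) + integral {0..1} (\<lambda>x. norm (g x)))"
      by (simp add: A_def G_def)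
  qed
qed

section \<open>The operator domain and the resolvent\<close>

lemma leb01_integrable_iff:
  fixes f :: "real \<Rightarrow> 'a::euclidean_space"
  shows "integrable leb01 f \<longleftrightarrow> f absolutely_integrable_on {0..1}"
  by (simp add: set_integrable_def integrable_restrict_space)

lemma leb01_AE_iff: "(AE x in leb01. P x) \<longleftrightarrow> (\<exists>N. negligible N \<and> (\<forall>x\<in>{0..1} - N. P x))"
proof -
  have "(AE x in leb01. P x) \<longleftrightarrow> (AE x in lebesgue. x \<in> {0..1} \<longrightarrow> P x)"
    by (rule AE_restrict_space_iff) simp
  also have "\<dots> \<longleftrightarrow> (\<exists>N. negligible N \<and> {x. \<not> (x \<in> {0..1} \<longrightarrow> P x)} \<subseteq> N)"
    by (simp add: eventually_ae_filter_negligible)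
  also have "\<dots> \<longleftrightarrow> (\<exists>N. negligible N \<and> (\<forall>x\<in>{0..1} - N. P x))"
    by (intro ex_cong1 conj_cong refl) blast
  finally show ?thesis .
qed

lemma continuous_AE_zero:
  fixes y :: "real \<Rightarrow> complex"
  assumes c: "continuous_on {0..1} y" and ae: "AE x in leb01. y x = 0" and x: "x \<in> {0..1}"
  shows "y x = 0"
proof -
  obtain N where N: "negligible N" "\<And>x. x \<in> {0..1} - N \<Longrightarrow> y x = 0" using ae unfolding leb01_AE_iff by blast
  have "integral {0..1} (\<lambda>x. norm (y x)) = integral {0..1::real} (\<lambda>x. 0::real)"
    by (rule integral_spike[OF N(1)]) (use N(2) in auto)
  then have "((\<lambda>x. norm (y x)) has_integral 0) {0..1}"
    using integrable_continuous_real[of 0 1 "\<lambda>x. norm (y x)"] c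
    by (metis continuous_on_norm has_integral_integral integral_0)
  then have "norm (y x) = 0"
    using has_integral_0_cbox_imp_0[of 0 1 "\<lambda>x. norm (y x)" x] c x by (simp add: continuous_on_norm)
  then show ?thesis by simp
qed

lemma continuous_in_L2:
  assumes "continuous_on {0..1} y"
  shows "y \<in> L2"
proof -
  have "y \<in> borel_measurable leb01"
    using assms by (rule continuous_imp_measurable_on_sets_lebesgue) simp
  moreover have "integrable leb01 (\<lambda>x. (cmod (y x))\<^sup>2)"
    unfolding leb01_integrable_iff
    by (rule absolutely_integrable_continuous_real) (intro continuous_intros assms)
  ultimately show ?thesis by (simp add: L2_def)
qed

lemma L2_square_integrable: "g \<in> L2 \<Longrightarrow> (\<lambda>x. (cmod (g x))\<^sup>2) integrable_on {0..1}"
  using set_lebesgue_integral_eq_integral(1) unfolding L2_def leb01_integrable_iff by blast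

lemma L2_norm_eq: "g \<in> L2 \<Longrightarrow> L2_norm g = sqrt (integral {0..1} (\<lambda>x. (cmod (g x))\<^sup>2))"
  unfolding L2_norm_def L2_def by (simp add: lebesgue_integral_eq_integral)

lemma L2_add:
  assumes f: "f \<in> L2" and g: "g \<in> L2"
  shows "(\<lambda>x. f x + g x) \<in> L2"
proof -
  have m: "f \<in> borel_measurable leb01" "g \<in> borel_measurable leb01"
    and i: "integrable leb01 (\<lambda>x. (cmod (f x))\<^sup>2)" "integrable leb01 (\<lambda>x. (cmod (g x))\<^sup>2)"
    using f g by (auto simp: L2_def)
  have "integrable leb01 (\<lambda>x. (cmod (f x + g x))\<^sup>2)"
  proof (rule Bochner_Integration.integrable_bound[where f="\<lambda>x. 2 * (cmod (f x))\<^sup>2 + 2 * (cmod (g x))\<^sup>2"])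
    show "integrable leb01 (\<lambda>x. 2 * (cmod (f x))\<^sup>2 + 2 * (cmod (g x))\<^sup>2)" using i by auto
    show "AE x in leb01. norm ((cmod (f x + g x))\<^sup>2) \<le> norm (2 * (cmod (f x))\<^sup>2 + 2 * (cmod (g x))\<^sup>2)"
    proof (rule AE_I2)
      fix x
      have "(cmod (f x + g x))\<^sup>2 \<le> (cmod (f x) + cmod (g x))\<^sup>2"
        by (intro power_mono norm_triangle_ineq norm_ge_zero)
      also have "\<dots> \<le> 2 * (cmod (f x))\<^sup>2 + 2 * (cmod (g x))\<^sup>2"
        using zero_le_power2[of "cmod (f x) - cmod (g x)"] by (simp add: power2_eq_square algebra_simps)
      finally show "norm ((cmod (f x + g x))\<^sup>2) \<le> norm (2 * (cmod (f x))\<^sup>2 + 2 * (cmod (g x))\<^sup>2)" by simp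
    qed
  qed (use m in auto)
  then show ?thesis using m by (simp add: L2_def)
qed

lemma L2_abs_integrable:
  assumes g: "g \<in> L2"
  shows "g absolutely_integrable_on {0..1}"
proof -
  have "integrable leb01 g"
  proof (rule Bochner_Integration.integrable_bound[where f="\<lambda>x. 1 + (cmod (g x))\<^sup>2"])
    have "integrable leb01 (\<lambda>x. 1::real)" unfolding leb01_integrable_iff by simp
    then show "integrable leb01 (\<lambda>x. 1 + (cmod (g x))\<^sup>2)" using g by (auto simp: L2_def)
    show "AE x in leb01. norm (g x) \<le> norm (1 + (cmod (g x))\<^sup>2)"
    proof (rule AE_I2)
      fix x
      have "2 * cmod (g x) \<le> 1 + (cmod (g x))\<^sup>2"
        using zero_le_power2[of "cmod (g x) - 1"] by (simp add: power2_eq_square algebra_simps)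
      then have "cmod (g x) \<le> 1 + (cmod (g x))\<^sup>2" using norm_ge_zero[of "g x"] by linarith
      then show "norm (g x) \<le> norm (1 + (cmod (g x))\<^sup>2)" by simp
    qed
  qed (use g in \<open>simp add: L2_def\<close>)
  then show ?thesis by (simp add: leb01_integrable_iff)
qed

text \<open>
The case of the Cauchy--Schwarz inequality with one factor constant, from the non-negativity of
\<open>(norm (g x) - G)\<^sup>2\<close> where \<open>G\<close> is the mean of \<open>norm (g x)\<close>.
\<close>

lemma integral_norm_le_L2_norm:
  assumes g: "g \<in> L2"
  shows "integral {0..1} (\<lambda>x. norm (g x)) \<le> L2_norm g"
proof -
  define G where "G = integral {0..1} (\<lambda>x. norm (g x))"
  have i1: "(\<lambda>x. norm (g x)) integrable_on {0..1}"
    using L2_abs_integrable[OF g] by (simp add: absolutely_integrable_on_def)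
  have i2: "(\<lambda>x. (cmod (g x))\<^sup>2) integrable_on {0..1}" by (rule L2_square_integrable[OF g])
  have h: "((\<lambda>x. 2 * G * cmod (g x) - G\<^sup>2) has_integral (2 * G * G - G\<^sup>2 * (1 - 0))) {0..1}"
    unfolding G_def
    by (intro has_integral_diff has_integral_mult_right integrable_integral i1)
      (use has_integral_const_real[of _ 0 "1::real"] in \<open>simp add: mult.commute\<close>)
  have "2 * G * G - G\<^sup>2 * (1 - 0) \<le> integral {0..1} (\<lambda>x. (cmod (g x))\<^sup>2)"
  proof (rule has_integral_le[OF h integrable_integral[OF i2]])
    show "2 * G * cmod (g x) - G\<^sup>2 \<le> (cmod (g x))\<^sup>2" for x
      using zero_le_power2[of "cmod (g x) - G"] by (simp add: power2_eq_square algebra_simps)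
  qed
  then have "G\<^sup>2 \<le> integral {0..1} (\<lambda>x. (cmod (g x))\<^sup>2)" by (simp add: power2_eq_square)
  then show ?thesis unfolding L2_norm_eq[OF g] G_def by (rule real_le_rsqrt)
qed

lemma abs_cont_continuous:
  fixes F :: "real \<Rightarrow> 'a::real_normed_vector"
  assumes "abs_cont_on_interval a b F"
  shows "continuous_on {a..b} F"
  unfolding continuous_on_iff
proof (intro ballI allI impI)
  fix x e :: real assume x: "x \<in> {a..b}" and e: "0 < e"
  obtain d where d: "0 < d" and D: "\<And>(n::nat) u v. (\<forall>i<n. a \<le> u i \<and> u i \<le> v i \<and> v i \<le> b) \<Longrightarrow>
        disjoint_family_on (\<lambda>i. {u i<..<v i}) {..<n} \<Longrightarrow>
        (\<Sum>i<n. v i - u i) < d \<Longrightarrow> (\<Sum>i<n. norm (F (v i) - F (u i))) < e"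
    using assms e unfolding abs_cont_on_interval_def by meson
  show "\<exists>d>0. \<forall>x'\<in>{a..b}. dist x' x < d \<longrightarrow> dist (F x') (F x) < e"
  proof (intro exI[of _ d] conjI ballI impI d)
    fix y assume y: "y \<in> {a..b}" "dist y x < d"
    have "norm (F (max x y) - F (min x y)) < e"
      using D[of 1 "\<lambda>_. min x y" "\<lambda>_. max x y"] x y
      by (auto simp: disjoint_family_on_def dist_real_def max_def min_def split: if_splits)
    then show "dist (F y) (F x) < e"
      by (auto simp: dist_norm max_def min_def norm_minus_commute split: if_splits)
  qed
qed

lemma is_primitive_add:
  fixes F G :: "real \<Rightarrow> complex"
  assumes "is_primitive F f" "is_primitive G g"
  shows "is_primitive (\<lambda>x. F x + G x) (\<lambda>x. f x + g x)"
proof -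
  have i: "f integrable_on {0..x}" "g integrable_on {0..x}" if "x \<in> {0..1}" for x
    using abs_integrable_subinterval[OF is_primitive_integrable[OF assms(1)], of 0 x]
      abs_integrable_subinterval[OF is_primitive_integrable[OF assms(2)], of 0 x] that
    by (simp_all add: absolutely_integrable_on_def)
  have "F x + G x = F 0 + G 0 + integral {0..x} (\<lambda>x. f x + g x)" if x: "x \<in> {0..1}" for x
    unfolding integral_add[OF i[OF x]] is_primitiveD[OF assms(1) x] is_primitiveD[OF assms(2) x] by simp
  then show ?thesis
    unfolding is_primitive_def
    using set_integral_add(1)[OF is_primitive_integrable[OF assms(1)] is_primitive_integrable[OF assms(2)]] by blast
qed

lemma is_primitive_cmult:
  fixes F :: "real \<Rightarrow> complex"
  assumes "is_primitive F f"
  shows "is_primitive (\<lambda>x. c * F x) (\<lambda>x. c * f x)"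
proof -
  have "is_primitive (\<lambda>_. c) (\<lambda>_. 0)" by (simp add: is_primitive_def)
  from is_primitive_mult[OF this assms] show ?thesis by simp
qed

lemma abs_integrable_of_real:
  assumes "q absolutely_integrable_on {0..1::real}"
  shows "(\<lambda>x. complex_of_real (q x)) absolutely_integrable_on {0..1}"
  using absolutely_integrable_linear[OF assms bounded_linear_of_real] by (simp add: o_def)

text \<open>
Together with its converse \<open>L_domI\<close> below, this turns statements about the operator, with its almost
everywhere derivatives, into integral equations.
\<close>

lemma L_dom_primitives:
  assumes q: "q absolutely_integrable_on {0..1}" and y: "y \<in> L_dom t q"
  shows "is_primitive y (deriv01 y)" "is_primitive (deriv01 y) (\<lambda>x. q x * y x - L_op q y x)"
proof -
  have ac: "abs_cont_on_interval 0 1 (deriv01 y)" using y by (simp add: L_dom_def)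
  have cw: "continuous_on {0..1} (deriv01 y)" by (rule abs_cont_continuous[OF ac])
  have "(y has_vector_derivative deriv01 y x) (at x within {0..1})" if "x \<in> {0..1}" for x
    using y that unfolding L_dom_def deriv01_def by (simp add: vector_derivative_works)
  with cw show *: "is_primitive y (deriv01 y)" by (rule is_primitive_C1)
  obtain N where N: "negligible N" "\<And>x. x \<in> {0..1} - N \<Longrightarrow> deriv01 y differentiable (at x within {0..1})"
    using y unfolding L_dom_def leb01_AE_iff by blast
  have "L_op q y absolutely_integrable_on {0..1}"
    using y by (intro L2_abs_integrable) (simp add: L_dom_def)
  then have "(\<lambda>x. q x * y x - L_op q y x) absolutely_integrable_on {0..1}"
    by (intro set_integral_diff(1) abs_integrable_times_continuous abs_integrable_of_real q is_primitive_continuous[OF *])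
  with ac show "is_primitive (deriv01 y) (\<lambda>x. q x * y x - L_op q y x)"
  proof (rule is_primitiveI[OF _ _ N(1)])
    fix x assume "x \<in> {0..1} - N"
    then have "(deriv01 y has_vector_derivative deriv01 (deriv01 y) x) (at x within {0..1})"
      using N(2) unfolding deriv01_def[of "deriv01 y"] by (simp add: vector_derivative_works)
    then show "(deriv01 y has_vector_derivative q x * y x - L_op q y x) (at x within {0..1})"
      by (simp add: L_op_def)
  qed
qed

lemma deriv01_eqI:
  "(y has_vector_derivative w) (at x within {0..1}) \<Longrightarrow> x \<in> {0..1} \<Longrightarrow> deriv01 y x = w"
  unfolding deriv01_def by (rule vector_derivative_within_cbox[of 0 1, simplified]) auto

lemma L_domI:
  assumes y: "is_primitive y w" and w: "is_primitive w (\<lambda>x. q x * y x - h x)" and h: "h \<in> L2"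
    and bc: "y 1 = exp (\<i> * complex_of_real t) * y 0" "w 1 = exp (\<i> * complex_of_real t) * w 0"
  shows "y \<in> L_dom t q" "AE x in leb01. L_op q y x = h x"
proof -
  have cw: "continuous_on {0..1} w" by (rule is_primitive_continuous[OF w])
  have dy: "(y has_vector_derivative w x) (at x within {0..1})" if "x \<in> {0..1}" for x
    by (rule is_primitive_has_deriv[OF y cw that])
  have yw: "deriv01 y x = w x" if "x \<in> {0..1}" for x by (rule deriv01_eqI[OF dy[OF that] that])
  obtain N where N: "negligible N"
    and dw: "\<And>x. x \<in> {0..1} - N \<Longrightarrow> (w has_vector_derivative q x * y x - h x) (at x within {0..1})"
    using is_primitive_deriv_ae[OF w] by blast
  have ddy: "(deriv01 y has_vector_derivative q x * y x - h x) (at x within {0..1})" if "x \<in> {0..1} - N" for x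
    by (rule has_vector_derivative_transform[OF _ yw dw[OF that]]) (use that in auto)
  have Lop: "L_op q y x = h x" if "x \<in> {0..1} - N" for x
    using deriv01_eqI[OF ddy[OF that]] that by (simp add: L_op_def)
  then show ae: "AE x in leb01. L_op q y x = h x" unfolding leb01_AE_iff using N by blast
  have hL: "h \<in> borel_measurable leb01" "integrable leb01 (\<lambda>x. (cmod (h x))\<^sup>2)" using h by (auto simp: L2_def)
  have m: "L_op q y \<in> borel_measurable leb01"
  proof -
    have "h measurable_on {0..1}" using hL(1) by (simp add: measurable_on_iff_borel_measurable)
    then have "L_op q y measurable_on {0..1}" by (rule measurable_on_spike[OF _ N(1)]) (use Lop in auto)
    then show ?thesis by (simp add: measurable_on_iff_borel_measurable)
  qed
  have "integrable leb01 (\<lambda>x. (cmod (L_op q y x))\<^sup>2)"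
    by (rule iffD1[OF integrable_cong_AE hL(2)]) (use hL m ae in auto)
  then have "L_op q y \<in> L2" using m by (simp add: L2_def)
  moreover have "abs_cont_on_interval 0 1 (deriv01 y)"
  proof -
    have "is_primitive (deriv01 y) (\<lambda>x. q x * y x - h x)"
      unfolding is_primitive_def
    proof (intro conjI ballI)
      show "(\<lambda>x. q x * y x - h x) absolutely_integrable_on {0..1}" by (rule is_primitive_integrable[OF w])
      show "deriv01 y x = deriv01 y 0 + integral {0..x} (\<lambda>x. q x * y x - h x)" if "x \<in> {0..1}" for x
        using is_primitiveD[OF w that] yw[OF that] yw[of 0] by simp
    qed
    then show ?thesis by (rule is_primitive_abs_cont)
  qed
  moreover have "AE x in leb01. deriv01 y differentiable (at x within {0..1})"
    unfolding leb01_AE_iff using N ddy differentiableI_vector by blast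
  moreover have "\<forall>x\<in>{0..1}. y differentiable (at x within {0..1})"
    using dy differentiableI_vector by blast
  ultimately show "y \<in> L_dom t q"
    unfolding L_dom_def
    using is_primitive_abs_cont[OF y] continuous_in_L2[OF is_primitive_continuous[OF y]] bc yw[of 0] yw[of 1] by simp
qed

lemma kernel_vector_of_singular:
  fixes a b c d :: complex
  assumes "a * d - b * c = 0"
  obtains u v where "u \<noteq> 0 \<or> v \<noteq> 0" "a * u + b * v = 0" "c * u + d * v = 0"
proof (cases "a = 0 \<and> b = 0")
  case True
  show thesis
  proof (cases "c = 0 \<and> d = 0")
    case True
    show thesis by (rule that[of 1 0]) (use True \<open>a = 0 \<and> b = 0\<close> in auto)
  next
    case False
    show thesis by (rule that[of d "- c"]) (use False \<open>a = 0 \<and> b = 0\<close> in auto)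
  qed
next
  case False
  show thesis by (rule that[of b "- a"]) (use False assms in \<open>auto simp: algebra_simps\<close>)
qed

lemma cramer_2:
  fixes a b c d u v r s :: complex
  assumes det: "a * d - b * c \<noteq> 0" and "a * u + b * v = r" "c * u + d * v = s"
  shows "u = (d * r - b * s) / (a * d - b * c)" "v = (a * s - c * r) / (a * d - b * c)"
proof -
  have "d * r - b * s = u * (a * d - b * c)" "a * s - c * r = v * (a * d - b * c)"
    using assms(2,3) by (auto simp: algebra_simps)
  then show "u = (d * r - b * s) / (a * d - b * c)" "v = (a * s - c * r) / (a * d - b * c)"
    using det by simp_all
qed

text \<open>
Let \<open>c\<close> and \<open>s\<close> be the fundamental solutions of \<open>- y'' + q * y = z * y\<close>. A solution of the inhomogeneous
equation is a particular one plus \<open>u * c + v * s\<close>, and the boundary conditions are two linear equations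
for \<open>u\<close> and \<open>v\<close> with determinant \<open>\<Delta>\<close>. A kernel vector of this system gives an eigenfunction, so \<open>\<Delta>\<close> is not
zero and the system can be solved. For the bound, Cramer's rule controls the initial values of any \<open>y\<close> in the
domain by the end values of the particular solution, and those are controlled by \<open>ivp_bound\<close>.
\<close>

theorem non_eigenvalue_in_resolvent_set:
  assumes q: "q absolutely_integrable_on {0..1}" and z: "z \<notin> eigenvalues (L_dom t q) (L_op q)"
  shows "z \<in> resolvent_set (L_dom t q) (L_op q)"
proof -
  define \<omega> where "\<omega> = exp (\<i> * complex_of_real t)"
  define p where "p = (\<lambda>x. complex_of_real (q x) - z)"
  have p: "p absolutely_integrable_on {0..1}"
    unfolding p_def by (intro set_integral_diff(1) abs_integrable_of_real q) simp
  have zero: "(\<lambda>_. 0::complex) absolutely_integrable_on {0..1::real}" by simp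
  obtain c c' where c: "is_primitive c c'" "is_primitive c' (\<lambda>x. p x * c x - 0)" "c 0 = 1" "c' 0 = 0"
    using ivp_exists[OF p zero] by blast
  obtain s s' where s: "is_primitive s s'" "is_primitive s' (\<lambda>x. p x * s x - 0)" "s 0 = 0" "s' 0 = 1"
    using ivp_exists[OF p zero] by blast
  obtain C where C: "0 < C" and bound: "\<And>y w g x. \<lbrakk>g absolutely_integrable_on {0..1}; is_primitive y w;
      is_primitive w (\<lambda>x. p x * y x - g x); x \<in> {0..1}\<rbrakk> \<Longrightarrow>
      norm (y x) \<le> C * (norm (y 0) + norm (w 0) + integral {0..1} (\<lambda>x. norm (g x))) \<and>
      norm (w x) \<le> C * (norm (y 0) + norm (w 0) + integral {0..1} (\<lambda>x. norm (g x)))"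
    using ivp_bound[OF p] by blast
  have comb: "is_primitive (\<lambda>x. y x + (u * c x + v * s x)) (\<lambda>x. w x + (u * c' x + v * s' x))"
      "is_primitive (\<lambda>x. w x + (u * c' x + v * s' x)) (\<lambda>x. p x * (y x + (u * c x + v * s x)) - g x)"
    if "is_primitive y w" "is_primitive w (\<lambda>x. p x * y x - g x)" for y w g u v
  proof -
    show "is_primitive (\<lambda>x. y x + (u * c x + v * s x)) (\<lambda>x. w x + (u * c' x + v * s' x))"
      by (intro is_primitive_add is_primitive_cmult that c s)
    have "is_primitive (\<lambda>x. w x + (u * c' x + v * s' x)) (\<lambda>x. (p x * y x - g x) + (u * (p x * c x - 0) + v * (p x * s x - 0)))"
      by (intro is_primitive_add is_primitive_cmult that c s)
    then show "is_primitive (\<lambda>x. w x + (u * c' x + v * s' x)) (\<lambda>x. p x * (y x + (u * c x + v * s x)) - g x)"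
      by (simp add: algebra_simps)
  qed
  have trivial: "is_primitive (\<lambda>_. 0) (\<lambda>_. 0::complex)" by (simp add: is_primitive_def)
  have pq: "is_primitive w (\<lambda>x. p x * y x - g x) \<longleftrightarrow> is_primitive w (\<lambda>x. q x * y x - (g x + z * y x))"
    for y w g :: "real \<Rightarrow> complex"
  proof -
    have "(\<lambda>x. p x * y x - g x) = (\<lambda>x. q x * y x - (g x + z * y x))"
      by (rule ext) (simp add: p_def algebra_simps)
    then show ?thesis by simp
  qed
  \<comment> \<open>\<open>A\<close>, \<open>s 1\<close>, \<open>c' 1\<close>, \<open>D\<close> are the entries of the monodromy matrix minus \<open>\<omega>\<close>\<close>
  define A where "A = c 1 - \<omega>"
  define D where "D = s' 1 - \<omega>"
  define \<Delta> where "\<Delta> = A * D - s 1 * c' 1"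
  have \<Delta>: "\<Delta> \<noteq> 0"
  proof
    assume "\<Delta> = 0"
    then obtain u v where uv: "u \<noteq> 0 \<or> v \<noteq> 0" "A * u + s 1 * v = 0" "c' 1 * u + D * v = 0"
      using kernel_vector_of_singular[of A D "s 1" "c' 1"] unfolding \<Delta>_def by blast
    define y where "y = (\<lambda>x. 0 + (u * c x + v * s x))"
    define w where "w = (\<lambda>x. 0 + (u * c' x + v * s' x))"
    have "is_primitive (\<lambda>_. 0::complex) (\<lambda>x. p x * 0 - 0)" using trivial by simp
    note yw = comb[OF trivial this, of u v]
    have yw1: "is_primitive y w" unfolding y_def w_def by (rule yw(1))
    have yw2: "is_primitive w (\<lambda>x. p x * y x - 0)" unfolding y_def w_def by (rule yw(2))
    have y0: "y 0 = u" "w 0 = v" using c s by (simp_all add: y_def w_def)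
    have cy: "continuous_on {0..1} y" by (rule is_primitive_continuous[OF yw1])
    have w': "is_primitive w (\<lambda>x. q x * y x - (0 + z * y x))" using yw2 by (rule iffD1[OF pq])
    have h: "(\<lambda>x. 0 + z * y x) \<in> L2" by (intro continuous_in_L2 continuous_intros cy)
    have "y 1 - \<omega> * y 0 = A * u + s 1 * v" unfolding y0 by (simp add: y_def A_def algebra_simps)
    then have bc1: "y 1 = exp (\<i> * complex_of_real t) * y 0" using uv by (simp add: \<omega>_def)
    have "w 1 - \<omega> * w 0 = c' 1 * u + D * v" unfolding y0 by (simp add: w_def D_def algebra_simps)
    then have bc2: "w 1 = exp (\<i> * complex_of_real t) * w 0" using uv by (simp add: \<omega>_def)
    note dom = L_domI[OF yw1 w' h bc1 bc2]
    have "AE x in leb01. L_op q y x = z * y x" using dom(2) by simp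
    then have "AE x in leb01. y x = 0" using z dom(1) unfolding eigenvalues_def by blast
    then have yz: "y x = 0" if "x \<in> {0..1}" for x using continuous_AE_zero[OF cy] that by blast
    have cw: "continuous_on {0..1} w" by (rule is_primitive_continuous[OF yw2])
    have "(y has_vector_derivative w 0) (at 0 within {0..1})" by (rule is_primitive_has_deriv[OF yw1 cw]) simp
    then have "w 0 = deriv01 y 0" using deriv01_eqI by simp
    also have "\<dots> = 0"
    proof (rule deriv01_eqI)
      show "(y has_vector_derivative 0) (at 0 within {0..1})"
        by (rule has_vector_derivative_transform[OF _ yz has_vector_derivative_const]) auto
    qed simp
    finally have "v = 0" using y0 by simp
    moreover have "u = 0" using yz[of 0] y0 by simp
    ultimately show False using uv(1) by simp
  qed
  have surj: "\<exists>y\<in>L_dom t q. AE x in leb01. L_op q y x - z * y x = g x" if g: "g \<in> L2" for g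
  proof -
    obtain yp wp where yp: "is_primitive yp wp" "is_primitive wp (\<lambda>x. p x * yp x - g x)" "yp 0 = 0" "wp 0 = 0"
      using ivp_exists[OF p L2_abs_integrable[OF g]] by blast
    define u where "u = (D * (- yp 1) - s 1 * (- wp 1)) / \<Delta>"
    define v where "v = (A * (- wp 1) - c' 1 * (- yp 1)) / \<Delta>"
    have uv: "A * u + s 1 * v = - yp 1" "c' 1 * u + D * v = - wp 1"
    proof -
      have "(A * u + s 1 * v) * \<Delta> = - yp 1 * \<Delta>" "(c' 1 * u + D * v) * \<Delta> = - wp 1 * \<Delta>"
        using \<Delta> by (simp_all add: u_def v_def distrib_right) (simp_all add: \<Delta>_def algebra_simps)
      then show "A * u + s 1 * v = - yp 1" "c' 1 * u + D * v = - wp 1"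
        unfolding mult_right_cancel[OF \<Delta>] .
    qed
    define y where "y = (\<lambda>x. yp x + (u * c x + v * s x))"
    define w where "w = (\<lambda>x. wp x + (u * c' x + v * s' x))"
    have yw1: "is_primitive y w" unfolding y_def w_def by (rule comb(1)[OF yp(1,2)])
    have yw2: "is_primitive w (\<lambda>x. p x * y x - g x)" unfolding y_def w_def by (rule comb(2)[OF yp(1,2)])
    have y0: "y 0 = u" "w 0 = v" using c s yp by (simp_all add: y_def w_def)
    have cy: "continuous_on {0..1} y" by (rule is_primitive_continuous[OF yw1])
    have w': "is_primitive w (\<lambda>x. q x * y x - (g x + z * y x))" using yw2 by (rule iffD1[OF pq])
    have h: "(\<lambda>x. g x + z * y x) \<in> L2" by (intro L2_add g continuous_in_L2 continuous_intros cy)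
    have "y 1 - \<omega> * y 0 = yp 1 + (A * u + s 1 * v)" unfolding y0 by (simp add: y_def A_def algebra_simps)
    then have bc1: "y 1 = exp (\<i> * complex_of_real t) * y 0" using uv by (simp add: \<omega>_def)
    have "w 1 - \<omega> * w 0 = wp 1 + (c' 1 * u + D * v)" unfolding y0 by (simp add: w_def D_def algebra_simps)
    then have bc2: "w 1 = exp (\<i> * complex_of_real t) * w 0" using uv by (simp add: \<omega>_def)
    note L_domI[OF yw1 w' h bc1 bc2]
    then show ?thesis by (intro bexI[of _ y]) auto
  qed
  define K where "K = C * (((norm D + norm (s 1)) * C + (norm A + norm (c' 1)) * C) / norm \<Delta> + 1)"
  have inv: "L2_norm y \<le> K * L2_norm (\<lambda>x. L_op q y x - z * y x)" if y: "y \<in> L_dom t q" for y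
  proof -
    define g where "g = (\<lambda>x. L_op q y x - z * y x)"
    define w where "w = deriv01 y"
    have yw: "is_primitive y w" unfolding w_def by (rule L_dom_primitives[OF q y])
    have cy: "continuous_on {0..1} y" by (rule is_primitive_continuous[OF yw])
    have "(\<lambda>x. L_op q y x + (- z) * y x) \<in> L2"
    proof (rule L2_add)
      show "L_op q y \<in> L2" using y by (simp add: L_dom_def)
      show "(\<lambda>x. - z * y x) \<in> L2" by (intro continuous_in_L2 continuous_intros cy)
    qed
    then have g: "g \<in> L2" by (simp add: g_def)
    have w: "is_primitive w (\<lambda>x. p x * y x - g x)"
      by (rule iffD2[OF pq]) (use L_dom_primitives(2)[OF q y] in \<open>simp add: g_def w_def\<close>)
    define G where "G = integral {0..1} (\<lambda>x. norm (g x))"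
    have gi: "g absolutely_integrable_on {0..1}" by (rule L2_abs_integrable[OF g])
    have G0: "0 \<le> G" unfolding G_def by (rule integral_nonneg) (use gi in \<open>auto simp: absolutely_integrable_on_def\<close>)
    note d = comb[OF yw w, of "- y 0" "- w 0"]
    have bd: "norm (y 1 + (- y 0 * c 1 + - w 0 * s 1)) \<le> C * G \<and> norm (w 1 + (- y 0 * c' 1 + - w 0 * s' 1)) \<le> C * G"
      using bound[OF gi d, of 1] c s by (simp add: G_def)
    have bc: "y 1 = \<omega> * y 0" "w 1 = \<omega> * w 0" using y by (auto simp: L_dom_def \<omega>_def w_def)
    define r1 where "r1 = A * y 0 + s 1 * w 0"
    define r2 where "r2 = c' 1 * y 0 + D * w 0"
    have "y 1 + (- y 0 * c 1 + - w 0 * s 1) = - r1" "w 1 + (- y 0 * c' 1 + - w 0 * s' 1) = - r2"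
      unfolding bc by (simp_all add: r1_def r2_def A_def D_def algebra_simps)
    then have r: "norm r1 \<le> C * G" "norm r2 \<le> C * G" using bd by simp_all
    note cr = cramer_2[OF \<Delta>[unfolded \<Delta>_def] r1_def[symmetric] r2_def[symmetric], folded \<Delta>_def]
    have "norm (y 0) \<le> (norm D * norm r1 + norm (s 1) * norm r2) / norm \<Delta>"
      unfolding cr(1) norm_divide
      by (intro divide_right_mono order_trans[OF norm_triangle_ineq4]) (simp_all add: norm_mult)
    also have "\<dots> \<le> (norm D * (C * G) + norm (s 1) * (C * G)) / norm \<Delta>"
      using r by (intro divide_right_mono add_mono mult_left_mono) auto
    finally have n1: "norm (y 0) \<le> (norm D * (C * G) + norm (s 1) * (C * G)) / norm \<Delta>" .
    have "norm (w 0) \<le> (norm A * norm r2 + norm (c' 1) * norm r1) / norm \<Delta>"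
      unfolding cr(2) norm_divide
      by (intro divide_right_mono order_trans[OF norm_triangle_ineq4]) (simp_all add: norm_mult)
    also have "\<dots> \<le> (norm A * (C * G) + norm (c' 1) * (C * G)) / norm \<Delta>"
      using r by (intro divide_right_mono add_mono mult_left_mono) auto
    finally have n2: "norm (w 0) \<le> (norm A * (C * G) + norm (c' 1) * (C * G)) / norm \<Delta>" .
    have sup: "norm (y x) \<le> K * G" if x: "x \<in> {0..1}" for x
    proof -
      have "norm (y x) \<le> C * (norm (y 0) + norm (w 0) + G)" using bound[OF gi yw w x] by (simp add: G_def)
      also have "\<dots> \<le> C * ((norm D * (C * G) + norm (s 1) * (C * G)) / norm \<Delta> + (norm A * (C * G) + norm (c' 1) * (C * G)) / norm \<Delta> + G)"
        using n1 n2 C by (intro mult_left_mono add_mono) auto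
      also have "\<dots> = K * G" by (simp add: K_def algebra_simps add_divide_distrib)
      finally show ?thesis .
    qed
    have KG: "0 \<le> K * G" by (rule order_trans[OF norm_ge_zero sup[of 0]]) simp
    have "integral {0..1} (\<lambda>x. (cmod (y x))\<^sup>2) \<le> integral {0..1::real} (\<lambda>x. (K * G)\<^sup>2)"
    proof (rule integral_le)
      show "(\<lambda>x. (cmod (y x))\<^sup>2) integrable_on {0..1}" by (rule L2_square_integrable[OF continuous_in_L2[OF cy]])
      show "(cmod (y x))\<^sup>2 \<le> (K * G)\<^sup>2" if "x \<in> {0..1}" for x
        by (rule power_mono[OF sup[OF that] norm_ge_zero])
      show "(\<lambda>x. (K * G)\<^sup>2) integrable_on {0..1::real}" by (rule integrable_const_ivl)
    qed
    then have "sqrt (integral {0..1} (\<lambda>x. (cmod (y x))\<^sup>2)) \<le> K * G"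
      by (intro real_le_lsqrt KG) simp
    then have "L2_norm y \<le> K * G" unfolding L2_norm_eq[OF continuous_in_L2[OF cy]] .
    also have "\<dots> \<le> K * L2_norm g"
      unfolding G_def
    proof (rule mult_left_mono[OF integral_norm_le_L2_norm[OF g]])
      show "0 \<le> K" unfolding K_def using C by (intro mult_nonneg_nonneg add_nonneg_nonneg divide_nonneg_nonneg) auto
    qed
    finally show ?thesis by (simp add: g_def)
  qed
  show ?thesis unfolding resolvent_set_def using z surj inv by blast
qed

corollary L_spectrum_subset_eigenvalues:
  "q absolutely_integrable_on {0..1} \<Longrightarrow> L_spectrum t q \<subseteq> eigenvalues (L_dom t q) (L_op q)"
  unfolding L_spectrum_def spectrum_def using non_eigenvalue_in_resolvent_set by blast

section \<open>The quadratic form and the first eigenvalue\<close>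

text \<open>
The form is considered on continuously differentiable functions only. This class contains the operator
domain and the trial functions used below, and avoids Sobolev spaces; the derivative \<open>w\<close> is carried along
explicitly. Only the boundary condition on \<open>y\<close> is imposed, since the one on \<open>y'\<close> is natural for the form.
\<close>

definition in_form_domain :: "real \<Rightarrow> (real \<Rightarrow> complex) \<Rightarrow> (real \<Rightarrow> complex) \<Rightarrow> bool" where
  "in_form_domain t y w \<longleftrightarrow>
     is_primitive y w \<and> continuous_on {0..1} w \<and> y 1 = exp (\<i> * complex_of_real t) * y 0"

definition energy :: "(real \<Rightarrow> real) \<Rightarrow> (real \<Rightarrow> complex) \<Rightarrow> (real \<Rightarrow> complex) \<Rightarrow> real" where
  "energy q y w = integral {0..1} (\<lambda>x. (cmod (w x))\<^sup>2 + q x * (cmod (y x))\<^sup>2)"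

definition mass :: "(real \<Rightarrow> complex) \<Rightarrow> real" where
  "mass y = integral {0..1} (\<lambda>x. (cmod (y x))\<^sup>2)"

lemma mass_nonneg: "continuous_on {0..1} y \<Longrightarrow> 0 \<le> mass y"
  unfolding mass_def by (rule integral_nonneg) (intro integrable_continuous_real continuous_intros, assumption, simp)

lemma in_form_domain_continuous:
  assumes "in_form_domain t y w"
  shows "continuous_on {0..1} y" "continuous_on {0..1} w"
  using assms is_primitive_continuous unfolding in_form_domain_def by auto

lemma integrable_mult_continuous_real:
  assumes "q absolutely_integrable_on {0..1::real}" "continuous_on {0..1} (h :: real \<Rightarrow> real)"
  shows "(\<lambda>x. q x * h x) integrable_on {0..1}"
  using abs_integrable_bilinear_continuous[OF bounded_bilinear_mult assms(2,1)]
  by (simp add: absolutely_integrable_on_def mult.commute)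

lemma L_dom_in_form_domain:
  assumes "q absolutely_integrable_on {0..1}" "z \<in> L_dom t q"
  shows "in_form_domain t z (deriv01 z)"
  unfolding in_form_domain_def
  using L_dom_primitives[OF assms] is_primitive_continuous assms(2) by (auto simp: L_dom_def)

lemma cmod_add_mult_real:
  "(cmod (a + complex_of_real s * b))\<^sup>2 = (cmod a)\<^sup>2 + 2 * s * (a \<bullet> b) + s\<^sup>2 * (cmod b)\<^sup>2"
  unfolding cmod_power2 by (simp add: inner_complex_def power2_eq_square algebra_simps)

lemma in_form_domain_add_mult:
  assumes "in_form_domain t y w" "in_form_domain t z v"
  shows "in_form_domain t (\<lambda>x. y x + c * z x) (\<lambda>x. w x + c * v x)"
  using assms unfolding in_form_domain_def
  by (auto intro!: is_primitive_add is_primitive_cmult continuous_intros simp: algebra_simps)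

lemma mass_add_mult:
  assumes "continuous_on {0..1} y" "continuous_on {0..1} z"
  shows "mass (\<lambda>x. y x + complex_of_real s * z x)
       = mass y + 2 * s * integral {0..1} (\<lambda>x. y x \<bullet> z x) + s\<^sup>2 * mass z"
proof -
  have "((\<lambda>x. (cmod (y x))\<^sup>2 + 2 * s * (y x \<bullet> z x) + s\<^sup>2 * (cmod (z x))\<^sup>2) has_integral
      mass y + 2 * s * integral {0..1} (\<lambda>x. y x \<bullet> z x) + s\<^sup>2 * mass z) {0..1}"
    unfolding mass_def
    by (intro has_integral_add has_integral_mult_right integrable_integral integrable_continuous_real
        continuous_intros assms)
  then show ?thesis
    unfolding mass_def[of "\<lambda>x. y x + complex_of_real s * z x"] cmod_add_mult_real by (rule integral_unique)
qed

lemma energy_add_mult: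
  assumes q: "q absolutely_integrable_on {0..1}"
    and c: "continuous_on {0..1} y" "continuous_on {0..1} z" "continuous_on {0..1} w" "continuous_on {0..1} v"
  shows "energy q (\<lambda>x. y x + complex_of_real s * z x) (\<lambda>x. w x + complex_of_real s * v x)
       = energy q y w + 2 * s * integral {0..1} (\<lambda>x. w x \<bullet> v x + q x * (y x \<bullet> z x)) + s\<^sup>2 * energy q z v"
proof -
  have "((\<lambda>x. ((cmod (w x))\<^sup>2 + q x * (cmod (y x))\<^sup>2) + 2 * s * (w x \<bullet> v x + q x * (y x \<bullet> z x))
        + s\<^sup>2 * ((cmod (v x))\<^sup>2 + q x * (cmod (z x))\<^sup>2)) has_integral
      energy q y w + 2 * s * integral {0..1} (\<lambda>x. w x \<bullet> v x + q x * (y x \<bullet> z x)) + s\<^sup>2 * energy q z v) {0..1}"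
    unfolding energy_def
    by (intro has_integral_add has_integral_mult_right integrable_integral integrable_add
        integrable_mult_continuous_real[OF q] integrable_continuous_real continuous_intros c)
  then have "((\<lambda>x. (cmod (w x + complex_of_real s * v x))\<^sup>2 + q x * (cmod (y x + complex_of_real s * z x))\<^sup>2) has_integral
      energy q y w + 2 * s * integral {0..1} (\<lambda>x. w x \<bullet> v x + q x * (y x \<bullet> z x)) + s\<^sup>2 * energy q z v) {0..1}"
    unfolding cmod_add_mult_real by (simp add: algebra_simps)
  then show ?thesis
    unfolding energy_def[of q "\<lambda>x. y x + complex_of_real s * z x"] by (rule integral_unique)
qed

lemma inner_unimodular: "cmod u = 1 \<Longrightarrow> (u * a) \<bullet> (u * b) = a \<bullet> b"
proof -
  assume "cmod u = 1"
  then have "(Re u)\<^sup>2 + (Im u)\<^sup>2 = 1" by (metis cmod_power2 one_power2)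
  then have "((Re u)\<^sup>2 + (Im u)\<^sup>2) * (a \<bullet> b) = a \<bullet> b" by simp
  then show ?thesis by (simp add: inner_complex_def power2_eq_square algebra_simps)
qed

text \<open>
Integrate the derivative of the inner product of \<open>y\<close> with \<open>z'\<close>. The boundary terms cancel because both
factors are multiplied by the same unimodular number between the endpoints. The real inner product on the complex
plane is enough, as the form is used only through real linear combinations.
\<close>

lemma green_identity:
  assumes q: "q absolutely_integrable_on {0..1}" and z: "z \<in> L_dom t q" and y: "in_form_domain t y w"
  shows "integral {0..1} (\<lambda>x. w x \<bullet> deriv01 z x + q x * (y x \<bullet> z x)) = integral {0..1} (\<lambda>x. y x \<bullet> L_op q z x)"
proof -
  have cy: "continuous_on {0..1} y" "continuous_on {0..1} w" by (rule in_form_domain_continuous[OF y])+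
  have cz: "continuous_on {0..1} z" "continuous_on {0..1} (deriv01 z)"
    by (rule in_form_domain_continuous[OF L_dom_in_form_domain[OF q z]])+
  have yp: "is_primitive y w" using y by (simp add: in_form_domain_def)
  have i1: "(\<lambda>x. w x \<bullet> deriv01 z x + q x * (y x \<bullet> z x)) integrable_on {0..1}"
    by (intro integrable_add integrable_mult_continuous_real[OF q] integrable_continuous_real continuous_intros cy cz)
  have "L_op q z absolutely_integrable_on {0..1}"
    using z by (intro L2_abs_integrable) (simp add: L_dom_def)
  then have i2: "(\<lambda>x. y x \<bullet> L_op q z x) integrable_on {0..1}"
    using abs_integrable_bilinear_continuous[OF bounded_bilinear_inner cy(1)] by (simp add: absolutely_integrable_on_def)
  have "y 1 \<bullet> deriv01 z 1 - y 0 \<bullet> deriv01 z 0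
      = integral {0..1} (\<lambda>x. y x \<bullet> (q x * z x - L_op q z x) + w x \<bullet> deriv01 z x)"
    using is_primitive_diff[OF is_primitive_bilinear[OF bounded_bilinear_inner yp L_dom_primitives(2)[OF q z]], of 0 1] by simp
  also have "(\<lambda>x. y x \<bullet> (q x * z x - L_op q z x) + w x \<bullet> deriv01 z x)
      = (\<lambda>x. (w x \<bullet> deriv01 z x + q x * (y x \<bullet> z x)) - y x \<bullet> L_op q z x)"
    by (rule ext) (simp add: inner_complex_def algebra_simps)
  also have "integral {0..1} \<dots> = integral {0..1} (\<lambda>x. w x \<bullet> deriv01 z x + q x * (y x \<bullet> z x)) - integral {0..1} (\<lambda>x. y x \<bullet> L_op q z x)"
    by (rule integral_diff[OF i1 i2])
  also have "y 1 \<bullet> deriv01 z 1 = y 0 \<bullet> deriv01 z 0"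
  proof -
    have "y 1 = exp (\<i> * complex_of_real t) * y 0" using y by (simp add: in_form_domain_def)
    moreover have "deriv01 z 1 = exp (\<i> * complex_of_real t) * deriv01 z 0" using z by (simp add: L_dom_def)
    ultimately show ?thesis by (simp add: inner_unimodular norm_exp_i_times)
  qed
  finally show ?thesis by simp
qed

text \<open>
A potential that is merely integrable is dominated by the kinetic term because the supremum of \<open>|y|\<^sup>2\<close> is at
most its minimum, which the mass bounds, plus its oscillation, the integral of \<open>2 * |y| * |y'|\<close>. Young's inequality
gives the kinetic term the coefficient \<open>1 / (Q + 1)\<close>, where \<open>Q\<close> is the \<open>L\<^sup>1\<close> norm of \<open>q\<close>, so it stays below one
after multiplication by \<open>Q\<close>.
\<close>

lemma energy_bounded_below:
  assumes q: "q absolutely_integrable_on {0..1}"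
  shows "\<exists>c. \<forall>y w. in_form_domain t y w \<longrightarrow> c * mass y \<le> energy q y w"
proof -
  define Q where "Q = integral {0..1} (\<lambda>x. \<bar>q x\<bar>)"
  have qi: "q integrable_on {0..1}" and qa: "(\<lambda>x. \<bar>q x\<bar>) integrable_on {0..1}"
    using q by (auto simp: absolutely_integrable_on_def)
  have Q0: "0 \<le> Q" unfolding Q_def by (rule integral_nonneg[OF qa]) simp
  show ?thesis
  proof (intro exI[of _ "- (Q * (Q + 2))"] allI impI)
    fix y w assume y: "in_form_domain t y w"
    have c: "continuous_on {0..1} y" "continuous_on {0..1} w" by (rule in_form_domain_continuous[OF y])+
    define u where "u = (\<lambda>x. y x \<bullet> y x)"
    define u' where "u' = (\<lambda>x. y x \<bullet> w x + w x \<bullet> y x)"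
    have u: "is_primitive u u'"
      unfolding u_def u'_def
      by (rule is_primitive_bilinear[OF bounded_bilinear_inner]) (use y in \<open>auto simp: in_form_domain_def\<close>)
    have cu: "continuous_on {0..1} u" "continuous_on {0..1} u'"
      unfolding u_def u'_def by (intro continuous_intros c)+
    have uy: "u x = (cmod (y x))\<^sup>2" for x by (simp add: u_def power2_norm_eq_inner)
    define W where "W = integral {0..1} (\<lambda>x. (cmod (w x))\<^sup>2)"
    have wi: "(\<lambda>x. (cmod (w x))\<^sup>2) integrable_on {0..1}" by (intro integrable_continuous_real continuous_intros c)
    have yi: "(\<lambda>x. (cmod (y x))\<^sup>2) integrable_on {0..1}" by (intro integrable_continuous_real continuous_intros c)
    have W0: "0 \<le> W" unfolding W_def by (rule integral_nonneg[OF wi]) simp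
    have M0: "0 \<le> mass y" unfolding mass_def by (rule integral_nonneg[OF yi]) simp
    obtain x0 where x0: "x0 \<in> {0..1}" "\<And>x. x \<in> {0..1} \<Longrightarrow> u x0 \<le> u x"
      using continuous_attains_inf[OF compact_Icc _ cu(1)] by auto
    have "integral {0..1::real} (\<lambda>x. u x0) \<le> mass y"
      unfolding mass_def uy[symmetric]
      by (rule integral_le) (use x0 cu(1) in \<open>auto intro: integrable_continuous_real\<close>)
    then have ux0: "u x0 \<le> mass y" by simp
    define R where "R = W / (Q + 1) + (Q + 1) * mass y"
    have u'le: "\<bar>u' x\<bar> \<le> (cmod (w x))\<^sup>2 / (Q + 1) + (Q + 1) * (cmod (y x))\<^sup>2" for x
    proof -
      have "\<bar>u' x\<bar> \<le> 2 * (cmod (y x) * cmod (w x))"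
        using Cauchy_Schwarz_ineq2[of "y x" "w x"] by (simp add: u'_def inner_commute abs_mult)
      also have "\<dots> \<le> (cmod (w x))\<^sup>2 / (Q + 1) + (Q + 1) * (cmod (y x))\<^sup>2"
      proof -
        have "0 \<le> (cmod (w x) - (Q + 1) * cmod (y x))\<^sup>2 / (Q + 1)" using Q0 by simp
        also have "\<dots> = (cmod (w x))\<^sup>2 / (Q + 1) - 2 * (cmod (y x) * cmod (w x)) + (Q + 1) * (cmod (y x))\<^sup>2"
          using Q0 by (simp add: power2_eq_square divide_simps) (simp add: algebra_simps)
        finally show ?thesis by simp
      qed
      finally show ?thesis .
    qed
    have Ri: "((\<lambda>x. (cmod (w x))\<^sup>2 / (Q + 1) + (Q + 1) * (cmod (y x))\<^sup>2) has_integral R) {0..1}"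
      unfolding R_def W_def mass_def
      by (intro has_integral_add has_integral_divide has_integral_mult_right integrable_integral wi yi)
    have au: "(\<lambda>x. \<bar>u' x\<bar>) integrable_on {a..b}" if "0 \<le> a" "b \<le> 1" for a b
      by (intro integrable_continuous_real continuous_intros continuous_on_subset[OF cu(2)]) (use that in auto)
    have osc: "\<bar>u b - u a\<bar> \<le> R" if ab: "0 \<le> a" "a \<le> b" "b \<le> 1" for a b
    proof -
      have "u b - u a = integral {a..b} u'" by (rule is_primitive_diff[OF u ab])
      also have "\<bar>\<dots>\<bar> \<le> integral {a..b} (\<lambda>x. \<bar>u' x\<bar>)"
        using integral_norm_bound_integral[of u' "{a..b}" "\<lambda>x. \<bar>u' x\<bar>"] au[of a b] ab
          integrable_continuous_real[OF continuous_on_subset[OF cu(2)], of a b] by auto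
      also have "\<dots> \<le> integral {0..1} (\<lambda>x. \<bar>u' x\<bar>)"
        by (rule integral_subset_le) (use ab au in auto)
      also have "\<dots> \<le> R"
        by (rule has_integral_le[OF integrable_integral[OF au] Ri u'le]) auto
      finally show ?thesis .
    qed
    have usup: "u x \<le> mass y + R" if x: "x \<in> {0..1}" for x
    proof -
      have "\<bar>u x - u x0\<bar> \<le> R"
        using osc[of x0 x] osc[of x x0] x x0(1) by (cases "x \<le> x0") (auto simp: abs_minus_commute)
      then show ?thesis using ux0 by linarith
    qed
    have "integral {0..1} (\<lambda>x. (cmod (w x))\<^sup>2 + - (mass y + R) * \<bar>q x\<bar>) \<le> energy q y w"
      unfolding energy_def
    proof (rule integral_le)
      show "(\<lambda>x. (cmod (w x))\<^sup>2 + - (mass y + R) * \<bar>q x\<bar>) integrable_on {0..1}"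
        by (intro integrable_add wi integrable_on_mult_right qa)
      show "(\<lambda>x. (cmod (w x))\<^sup>2 + q x * (cmod (y x))\<^sup>2) integrable_on {0..1}"
        by (intro integrable_add wi integrable_mult_continuous_real[OF q] continuous_intros c)
      fix x :: real assume x: "x \<in> {0..1}"
      have "\<bar>q x\<bar> * (cmod (y x))\<^sup>2 \<le> \<bar>q x\<bar> * (mass y + R)"
        using usup[OF x] by (intro mult_left_mono) (auto simp: uy)
      moreover have "- (\<bar>q x\<bar> * (cmod (y x))\<^sup>2) \<le> q x * (cmod (y x))\<^sup>2"
        using mult_right_mono[of "- \<bar>q x\<bar>" "q x" "(cmod (y x))\<^sup>2"] by simp
      ultimately show "(cmod (w x))\<^sup>2 + - (mass y + R) * \<bar>q x\<bar> \<le> (cmod (w x))\<^sup>2 + q x * (cmod (y x))\<^sup>2"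
        by (simp add: algebra_simps)
    qed
    also have "integral {0..1} (\<lambda>x. (cmod (w x))\<^sup>2 + - (mass y + R) * \<bar>q x\<bar>) = W + - (mass y + R) * Q"
      unfolding W_def Q_def
      by (intro integral_unique has_integral_add has_integral_mult_right integrable_integral wi qa)
    finally have "W - (mass y + R) * Q \<le> energy q y w" by (simp add: algebra_simps)
    moreover have "W / (Q + 1) * Q \<le> W" using Q0 W0 by (simp add: divide_simps mult_left_mono)
    ultimately show "- (Q * (Q + 2)) * mass y \<le> energy q y w"
      by (simp add: R_def algebra_simps)
  qed
qed

lemma energy_of_eigenfunction:
  assumes q: "q absolutely_integrable_on {0..1}" and z: "z \<in> L_dom t q"
    and ev: "AE x in leb01. L_op q z x = complex_of_real \<mu> * z x"
  shows "energy q z (deriv01 z) = \<mu> * mass z"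
proof -
  obtain N where N: "negligible N" "\<And>x. x \<in> {0..1} - N \<Longrightarrow> L_op q z x = complex_of_real \<mu> * z x"
    using ev unfolding leb01_AE_iff by blast
  have "energy q z (deriv01 z) = integral {0..1} (\<lambda>x. deriv01 z x \<bullet> deriv01 z x + q x * (z x \<bullet> z x))"
    by (simp add: energy_def power2_norm_eq_inner)
  also have "\<dots> = integral {0..1} (\<lambda>x. z x \<bullet> L_op q z x)"
    by (rule green_identity[OF q z L_dom_in_form_domain[OF q z]])
  also have "\<dots> = integral {0..1} (\<lambda>x. \<mu> * (cmod (z x))\<^sup>2)"
  proof (rule integral_spike[OF N(1)])
    show "\<mu> * (cmod (z x))\<^sup>2 = z x \<bullet> L_op q z x" if "x \<in> {0..1} - N" for x
      unfolding N(2)[OF that] cmod_power2 by (simp add: inner_complex_def power2_eq_square algebra_simps)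
  qed
  finally show ?thesis by (simp add: mass_def)
qed

text \<open>
Let \<open>z\<close> solve \<open>L z - l * z = y\<close> and let \<open>b\<close> denote the energy minus \<open>l\<close> times the mass, which is
non-negative by hypothesis. Green's identity gives \<open>b (y + s * z) = b y + 2 * s * mass y + s\<^sup>2 * S\<close> for real \<open>s\<close>,
where \<open>S\<close>, the real inner product of \<open>y\<close> and \<open>z\<close>, is at most \<open>C * mass y\<close> by boundedness of the
resolvent. The choice \<open>s = - 1 / C\<close> yields \<open>mass y / C \<le> b y\<close>.
\<close>

lemma energy_gap_below_resolvent_point:
  assumes q: "q absolutely_integrable_on {0..1}"
    and below: "\<forall>y w. in_form_domain t y w \<longrightarrow> l * mass y \<le> energy q y w"
    and nev: "complex_of_real l \<notin> eigenvalues (L_dom t q) (L_op q)"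
  shows "\<exists>\<epsilon>>0. \<forall>y w. in_form_domain t y w \<longrightarrow> (l + \<epsilon>) * mass y \<le> energy q y w"
proof -
  have res: "complex_of_real l \<in> resolvent_set (L_dom t q) (L_op q)"
    by (rule non_eigenvalue_in_resolvent_set[OF q nev])
  then obtain C0 where C0: "\<And>z. z \<in> L_dom t q \<Longrightarrow> L2_norm z \<le> C0 * L2_norm (\<lambda>x. L_op q z x - complex_of_real l * z x)"
    unfolding resolvent_set_def by blast
  \<comment> \<open>a positive constant, so that dividing by it is possible\<close>
  define C where "C = \<bar>C0\<bar> + 1"
  have C: "0 < C" by (simp add: C_def)
  show ?thesis
  proof (intro exI[of _ "1 / C"] conjI allI impI)
    fix y w assume y: "in_form_domain t y w"
    have cy: "continuous_on {0..1} y" "continuous_on {0..1} w" by (rule in_form_domain_continuous[OF y])+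
    obtain z where z: "z \<in> L_dom t q" and zeq: "AE x in leb01. L_op q z x - complex_of_real l * z x = y x"
      using res continuous_in_L2[OF cy(1)] unfolding resolvent_set_def by blast
    obtain N where N: "negligible N" "\<And>x. x \<in> {0..1} - N \<Longrightarrow> L_op q z x - complex_of_real l * z x = y x"
      using zeq unfolding leb01_AE_iff by blast
    define v where "v = deriv01 z"
    have zf: "in_form_domain t z v" unfolding v_def by (rule L_dom_in_form_domain[OF q z])
    have cz: "continuous_on {0..1} z" "continuous_on {0..1} v" by (rule in_form_domain_continuous[OF zf])+
    define S where "S = integral {0..1} (\<lambda>x. y x \<bullet> z x)"
    have green: "integral {0..1} (\<lambda>x. f' x \<bullet> v x + q x * (f x \<bullet> z x)) = l * integral {0..1} (\<lambda>x. f x \<bullet> z x) + integral {0..1} (\<lambda>x. f x \<bullet> y x)"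
      if f: "in_form_domain t f f'" for f f'
    proof -
      have cf: "continuous_on {0..1} f" by (rule in_form_domain_continuous[OF f])
      have "integral {0..1} (\<lambda>x. f' x \<bullet> v x + q x * (f x \<bullet> z x)) = integral {0..1} (\<lambda>x. f x \<bullet> L_op q z x)"
        unfolding v_def by (rule green_identity[OF q z f])
      also have "\<dots> = integral {0..1} (\<lambda>x. l * (f x \<bullet> z x) + f x \<bullet> y x)"
      proof (rule integral_spike[OF N(1)])
        fix x assume "x \<in> {0..1} - N"
        from N(2)[OF this] have "L_op q z x = y x + complex_of_real l * z x" by (simp add: algebra_simps)
        then show "l * (f x \<bullet> z x) + f x \<bullet> y x = f x \<bullet> L_op q z x"
          by (simp add: inner_complex_def algebra_simps)
      qed
      also have "\<dots> = l * integral {0..1} (\<lambda>x. f x \<bullet> z x) + integral {0..1} (\<lambda>x. f x \<bullet> y x)"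
        by (intro integral_unique has_integral_add has_integral_mult_right integrable_integral
            integrable_continuous_real continuous_intros cf cz cy)
      finally show ?thesis .
    qed
    have yy: "integral {0..1} (\<lambda>x. y x \<bullet> y x) = mass y" by (simp add: mass_def power2_norm_eq_inner)
    have zz: "integral {0..1} (\<lambda>x. z x \<bullet> z x) = mass z" by (simp add: mass_def power2_norm_eq_inner)
    have zy: "integral {0..1} (\<lambda>x. z x \<bullet> y x) = S" by (simp add: S_def inner_commute)
    have Ez: "energy q z v = l * mass z + S"
      using green[OF zf] zz zy by (simp add: energy_def power2_norm_eq_inner)
    \<comment> \<open>minimises \<open>2 * s * mass y + s\<^sup>2 * (C * mass y)\<close>\<close>
    define s where "s = - (1 / C)"
    have "l * mass (\<lambda>x. y x + complex_of_real s * z x) \<le> energy q (\<lambda>x. y x + complex_of_real s * z x) (\<lambda>x. w x + complex_of_real s * v x)"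
      by (rule below[rule_format, OF in_form_domain_add_mult[OF y zf]])
    then have "l * (mass y + 2 * s * S + s\<^sup>2 * mass z) \<le> energy q y w + 2 * s * (l * S + mass y) + s\<^sup>2 * (l * mass z + S)"
      unfolding mass_add_mult[OF cy(1) cz(1)] energy_add_mult[OF q cy(1) cz(1) cy(2) cz(2)] green[OF y] Ez yy
      by (simp add: S_def)
    then have key: "l * mass y \<le> energy q y w + 2 * s * mass y + s\<^sup>2 * S"
      by (simp add: algebra_simps)
    have "L2_norm (\<lambda>x. L_op q z x - complex_of_real l * z x) = L2_norm y"
    proof -
      have "(\<lambda>x. L_op q z x + (- complex_of_real l) * z x) \<in> L2"
      proof (rule L2_add)
        show "L_op q z \<in> L2" using z by (simp add: L_dom_def)
        show "(\<lambda>x. (- complex_of_real l) * z x) \<in> L2" by (intro continuous_in_L2 continuous_intros cz)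
      qed
      then have g: "(\<lambda>x. L_op q z x - complex_of_real l * z x) \<in> L2" by simp
      have "integral {0..1} (\<lambda>x. (cmod (L_op q z x - complex_of_real l * z x))\<^sup>2) = integral {0..1} (\<lambda>x. (cmod (y x))\<^sup>2)"
        by (rule integral_spike[OF N(1)]) (subst N(2), assumption, rule refl)
      then show ?thesis unfolding L2_norm_eq[OF g] L2_norm_eq[OF continuous_in_L2[OF cy(1)]] by simp
    qed
    then have "L2_norm z \<le> C0 * L2_norm y" using C0[OF z] by simp
    also have "\<dots> \<le> C * L2_norm y"
      unfolding C_def by (intro mult_right_mono) (simp_all add: L2_norm_def)
    finally have "sqrt (mass z) \<le> C * sqrt (mass y)"
      unfolding L2_norm_eq[OF continuous_in_L2[OF cz(1)]] L2_norm_eq[OF continuous_in_L2[OF cy(1)]] mass_def .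
    then have "sqrt (mass z) \<le> sqrt (C\<^sup>2 * mass y)" using C by (simp add: real_sqrt_mult)
    then have mz: "mass z \<le> C\<^sup>2 * mass y" by (simp only: real_sqrt_le_iff)
    have "2 * C * S \<le> mass z + C\<^sup>2 * mass y"
    proof -
      have "0 \<le> mass (\<lambda>x. z x + complex_of_real (- C) * y x)"
        by (intro mass_nonneg continuous_intros cy cz)
      then show ?thesis unfolding mass_add_mult[OF cz(1) cy(1)] zy by simp
    qed
    also have "\<dots> \<le> C\<^sup>2 * mass y + C\<^sup>2 * mass y" using mz by (rule add_right_mono)
    also have "\<dots> = 2 * C * (C * mass y)" by (simp add: power2_eq_square)
    finally have SC: "S \<le> C * mass y" using C by (simp only: mult_le_cancel_left_pos mult_pos_pos zero_less_numeral)
    have "s\<^sup>2 * S \<le> s\<^sup>2 * (C * mass y)" by (rule mult_left_mono[OF SC]) simp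
    also have "\<dots> = mass y / C" using C by (simp add: s_def power2_eq_square)
    finally have "l * mass y \<le> energy q y w + 2 * s * mass y + mass y / C" using key by linarith
    then show "(l + 1 / C) * mass y \<le> energy q y w" by (simp add: s_def algebra_simps)
  qed (use C in simp)
qed

text \<open>
The best constant \<open>m\<close> in \<open>m * mass y \<le> energy q y w\<close> cannot be improved, so by the preceding lemma it is
an eigenvalue. No real eigenvalue is smaller, as an eigenfunction attains its eigenvalue as the ratio of energy to mass.
In particular a least eigenvalue exists, which gives the definition of the first eigenvalue its meaning.
\<close>

theorem first_eigenvalue_le_energy:
  assumes q: "q absolutely_integrable_on {0..1}" and y: "in_form_domain t y w"
  shows "first_eigenvalue t q * mass y \<le> energy q y w"
proof -
  define S where "S = {c. \<forall>y w. in_form_domain t y w \<longrightarrow> c * mass y \<le> energy q y w}"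
  obtain c0 where "\<forall>y w. in_form_domain t y w \<longrightarrow> c0 * mass y \<le> energy q y w"
    using energy_bounded_below[OF q] ..
  then have c0: "\<And>y w. in_form_domain t y w \<Longrightarrow> c0 * mass y \<le> energy q y w" by simp
  then have "c0 \<in> S" by (simp add: S_def)
  then have ne: "S \<noteq> {}" by blast
  let ?e = "\<lambda>x. cis (t * x)"
  have e: "in_form_domain t ?e (\<lambda>x. \<i> * complex_of_real t * cis (t * x))"
    unfolding in_form_domain_def
  proof (intro conjI)
    show c: "continuous_on {0..1} (\<lambda>x. \<i> * complex_of_real t * cis (t * x))" by (intro continuous_intros)
    show "is_primitive ?e (\<lambda>x. \<i> * complex_of_real t * cis (t * x))"
      by (rule is_primitive_C1[OF c cis_has_vector_derivative])
    show "?e 1 = exp (\<i> * complex_of_real t) * ?e 0" by (simp add: cis_conv_exp)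
  qed
  have me: "mass ?e = 1" by (simp add: mass_def)
  have bdd: "bdd_above S"
  proof (rule bdd_aboveI)
    fix c assume "c \<in> S"
    then have "c * mass ?e \<le> energy q ?e (\<lambda>x. \<i> * complex_of_real t * cis (t * x))" using e unfolding S_def by blast
    then show "c \<le> energy q ?e (\<lambda>x. \<i> * complex_of_real t * cis (t * x))" unfolding me by simp
  qed
  define m where "m = Sup S"
  have mass0: "0 \<le> mass y" if "in_form_domain t y w" for y w
    by (rule mass_nonneg[OF in_form_domain_continuous(1)[OF that]])
  have mS: "m * mass y \<le> energy q y w" if y: "in_form_domain t y w" for y w
  proof (cases "mass y = 0")
    case True
    then show ?thesis using c0[OF y] by simp
  next
    case False
    then have pos: "0 < mass y" using mass0[OF y] by simp
    have "m \<le> energy q y w / mass y"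
      unfolding m_def
    proof (rule cSup_least[OF ne])
      fix c assume "c \<in> S"
      then have "c * mass y \<le> energy q y w" using y unfolding S_def by blast
      then show "c \<le> energy q y w / mass y" using pos by (simp add: pos_le_divide_eq)
    qed
    then show ?thesis using pos by (simp add: pos_le_divide_eq)
  qed
  have ev: "complex_of_real m \<in> eigenvalues (L_dom t q) (L_op q)"
  proof (rule ccontr)
    assume "complex_of_real m \<notin> eigenvalues (L_dom t q) (L_op q)"
    moreover have "\<forall>y w. in_form_domain t y w \<longrightarrow> m * mass y \<le> energy q y w" using mS by simp
    ultimately have "\<exists>\<epsilon>>0. \<forall>y w. in_form_domain t y w \<longrightarrow> (m + \<epsilon>) * mass y \<le> energy q y w"
      using energy_gap_below_resolvent_point[OF q] by simp
    then
    obtain \<epsilon> where "0 < \<epsilon>" "\<forall>y w. in_form_domain t y w \<longrightarrow> (m + \<epsilon>) * mass y \<le> energy q y w"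
      by (elim exE conjE)
    then have "m + \<epsilon> \<in> S" by (simp add: S_def)
    then have "m + \<epsilon> \<le> m" unfolding m_def by (rule cSup_upper[OF _ bdd])
    then show False using \<open>0 < \<epsilon>\<close> by simp
  qed
  have least: "m \<le> \<mu>" if \<mu>: "complex_of_real \<mu> \<in> eigenvalues (L_dom t q) (L_op q)" for \<mu>
  proof -
    obtain z where z: "z \<in> L_dom t q" "\<not> (AE x in leb01. z x = 0)" "AE x in leb01. L_op q z x = complex_of_real \<mu> * z x"
      using \<mu> unfolding eigenvalues_def by blast
    have zf: "in_form_domain t z (deriv01 z)" by (rule L_dom_in_form_domain[OF q z(1)])
    have cz: "continuous_on {0..1} z" by (rule in_form_domain_continuous[OF zf])
    have "mass z \<noteq> 0"
    proof
      assume m0: "mass z = 0"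
      have "((\<lambda>x. (cmod (z x))\<^sup>2) has_integral 0) {0..1}"
        using m0 integrable_integral[OF L2_square_integrable[OF continuous_in_L2[OF cz]]] by (simp add: mass_def)
      then have "(cmod (z x))\<^sup>2 = 0" if "x \<in> {0..1}" for x
        using has_integral_0_cbox_imp_0[of 0 1 "\<lambda>x. (cmod (z x))\<^sup>2" x] that
        by (simp add: continuous_on_power continuous_on_norm cz)
      then have "\<And>x. x \<in> {0..1} \<Longrightarrow> z x = 0" by simp
      then have "AE x in leb01. z x = 0" by (intro AE_I2) simp
      then show False using z(2) by simp
    qed
    then have "0 < mass z" using mass0[OF zf] by simp
    moreover have "m * mass z \<le> \<mu> * mass z"
      using mS[OF zf] energy_of_eigenfunction[OF q z(1,3)] by simp
    ultimately show ?thesis by simp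
  qed
  have "first_eigenvalue t q = m"
    unfolding first_eigenvalue_def by (rule Least_equality) (fact ev, rule least)
  then show ?thesis using mS[OF y] by simp
qed

section \<open>The mean value of the potential\<close>

lemma is_primitive_cong_AE:
  fixes F :: "real \<Rightarrow> complex"
  assumes F: "is_primitive F f" and N: "negligible N" and eq: "\<And>x. x \<in> {0..1} - N \<Longrightarrow> g x = f x"
  shows "is_primitive F g"
  unfolding is_primitive_def
proof (intro conjI ballI)
  show "g absolutely_integrable_on {0..1}"
    by (rule absolutely_integrable_spike[OF is_primitive_integrable[OF F] N eq])
  show "F x = F 0 + integral {0..x} g" if "x \<in> {0..1}" for x
  proof -
    have "integral {0..x} f = integral {0..x} g"
      by (rule integral_spike[OF N]) (use eq that in auto)
    then show ?thesis by (rule subst) (rule is_primitiveD[OF F that])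
  qed
qed

definition fourier01 :: "(real \<Rightarrow> real) \<Rightarrow> real \<Rightarrow> complex" where
  "fourier01 q k = integral {0..1} (\<lambda>x. complex_of_real (q x) * cis (k * x))"

text \<open>
The functions \<open>(y' + \<i> * k * y) * cis (- k * x)\<close> for \<open>k = \<mu>\<close> and \<open>k = - \<mu>\<close> have derivative
\<open>q * y * cis (- k * x)\<close>, so they are constant up to the integrals \<open>I k\<close>. Solving for \<open>y\<close> exhibits it as a
combination of two exponentials with amplitudes \<open>a\<close> and \<open>b\<close> and an error \<open>r\<close> of order \<open>1 / \<mu>\<close>. The boundary
conditions determine \<open>I k 1\<close> exactly: it vanishes for \<open>k = - \<mu>\<close> by the phase condition, and for
\<open>k = \<mu>\<close> it is \<open>a\<close> times a factor that is either zero or of exact order \<open>\<mu>\<close>. Inserting the expansion of \<open>y\<close> into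
these two integrals bounds \<open>b * Q\<close> and \<open>a * Q\<close>. If \<open>exp (2 * \<i> * t) = 1\<close>, the quotient by
zero in the statement has the value zero, and the estimate remains correct as it stands.
\<close>

lemma eigenfunction_mean_estimate:
  assumes q: "q absolutely_integrable_on {0..1}" and y: "y \<in> L_dom t q"
    and nz: "\<not> (AE x in leb01. y x = 0)"
    and ev: "AE x in leb01. L_op q y x = complex_of_real (\<mu>\<^sup>2) * y x"
    and \<mu>: "0 < \<mu>" "2 * integral {0..1} (\<lambda>x. \<bar>q x\<bar>) \<le> \<mu>"
    and phase: "exp (\<i> * complex_of_real t) * cis \<mu> = 1"
  shows "\<bar>integral {0..1} q\<bar> \<le> norm (fourier01 q (2 * \<mu>)) + norm (fourier01 q (- (2 * \<mu>)))
    + (4 * (integral {0..1} (\<lambda>x. \<bar>q x\<bar>))\<^sup>2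
        + \<bar>integral {0..1} q\<bar> * integral {0..1} (\<lambda>x. \<bar>q x\<bar>) / norm ((exp (\<i> * complex_of_real t))\<^sup>2 - 1)) / \<mu>"
proof -
  define L where "L = integral {0..1} (\<lambda>x. \<bar>q x\<bar>)"
  define Q where "Q = integral {0..1} q"
  define \<omega> where "\<omega> = exp (\<i> * complex_of_real t)"
  define w where "w = deriv01 y"
  define qc where "qc = (\<lambda>x. complex_of_real (q x))"
  have qc: "qc absolutely_integrable_on {0..1}" unfolding qc_def by (rule abs_integrable_of_real[OF q])
  have Lq: "L = integral {0..1} (\<lambda>x. norm (qc x))" by (simp add: L_def qc_def)
  have L0: "0 \<le> L" unfolding L_def
    by (rule integral_nonneg) (use q in \<open>auto simp: absolutely_integrable_on_def\<close>)
  have \<omega>1: "norm \<omega> = 1" by (simp add: \<omega>_def norm_exp_i_times)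
  have Qc: "integral {0..1} qc = complex_of_real Q"
    unfolding qc_def Q_def using q
    by (intro integral_unique has_integral_of_real integrable_integral) (simp add: absolutely_integrable_on_def)
  have yw: "is_primitive y w" unfolding w_def by (rule L_dom_primitives[OF q y])
  obtain N where N: "negligible N" "\<And>x. x \<in> {0..1} - N \<Longrightarrow> L_op q y x = complex_of_real (\<mu>\<^sup>2) * y x"
    using ev unfolding leb01_AE_iff by blast
  have w': "is_primitive w (\<lambda>x. qc x * y x - complex_of_real (\<mu>\<^sup>2) * y x)"
    unfolding w_def qc_def
    by (rule is_primitive_cong_AE[OF L_dom_primitives(2)[OF q y] N(1)]) (simp add: N(2))
  have cy: "continuous_on {0..1} y" by (rule is_primitive_continuous[OF yw])
  have bc: "y 1 = \<omega> * y 0" "w 1 = \<omega> * w 0" using y by (auto simp: L_dom_def \<omega>_def w_def)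
  have E: "is_primitive (\<lambda>x. cis (k * x)) (\<lambda>x. \<i> * complex_of_real k * cis (k * x))" for k
    by (rule is_primitive_C1[OF _ cis_has_vector_derivative]) (intro continuous_intros)
  have cE: "continuous_on {0..1} (\<lambda>x. cis (k * x))" for k by (intro continuous_intros)
  \<comment> \<open>\<open>cis (- k * x)\<close> is an integrating factor of \<open>w + \<i> * k * y\<close>\<close>
  have factor: "is_primitive (\<lambda>x. (w x + \<i> * complex_of_real k * y x) * cis (- k * x)) (\<lambda>x. qc x * (y x * cis (- k * x)))"
    if k: "k\<^sup>2 = \<mu>\<^sup>2" for k
  proof -
    have "is_primitive (\<lambda>x. (w x + \<i> * complex_of_real k * y x) * cis (- k * x))
      (\<lambda>x. (w x + \<i> * complex_of_real k * y x) * (\<i> * complex_of_real (- k) * cis (- k * x))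
         + ((qc x * y x - complex_of_real (\<mu>\<^sup>2) * y x) + \<i> * complex_of_real k * w x) * cis (- k * x))"
      by (intro is_primitive_mult is_primitive_add is_primitive_cmult E w' yw)
    also have "(\<lambda>x. (w x + \<i> * complex_of_real k * y x) * (\<i> * complex_of_real (- k) * cis (- k * x))
         + ((qc x * y x - complex_of_real (\<mu>\<^sup>2) * y x) + \<i> * complex_of_real k * w x) * cis (- k * x))
       = (\<lambda>x. qc x * (y x * cis (- k * x)))"
      unfolding k[symmetric] by (rule ext) (simp add: algebra_simps power2_eq_square)
    finally show ?thesis .
  qed
  define I where "I = (\<lambda>k x. integral {0..x} (\<lambda>x. qc x * (y x * cis (- k * x))))"
  define A where "A = (\<lambda>k. w 0 + \<i> * complex_of_real k * y 0)"
  have Ieq: "(w x + \<i> * complex_of_real k * y x) * cis (- k * x) = A k + I k x"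
    if "k\<^sup>2 = \<mu>\<^sup>2" "x \<in> {0..1}" for k x
    using is_primitiveD[OF factor[OF that(1)] that(2)] by (simp add: A_def I_def)
  obtain x0 where x0: "x0 \<in> {0..1}" and ymax: "\<And>x. x \<in> {0..1} \<Longrightarrow> norm (y x) \<le> norm (y x0)"
    using continuous_attains_sup[of "{0..1::real}" "\<lambda>x. norm (y x)"] continuous_on_norm[OF cy] by auto
  define S where "S = norm (y x0)"
  have S0: "0 < S"
  proof (rule ccontr)
    assume "\<not> 0 < S"
    then have "S = 0" by (simp add: S_def)
    then have "y x = 0" if "x \<in> {0..1}" for x using ymax[OF that] by (simp add: S_def)
    then have "AE x in leb01. y x = 0" by (intro AE_I2) simp
    then show False using nz by simp
  qed
  have Ib: "norm (I k x) \<le> S * L" if x: "x \<in> {0..1}" for k x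
    unfolding I_def Lq
    by (rule norm_integral_mult_le[OF qc _ x])
      (use ymax x in \<open>auto intro!: continuous_intros cy simp: norm_mult S_def\<close>)
  define a where "a = A \<mu> / (2 * \<i> * complex_of_real \<mu>)"
  define b where "b = A (- \<mu>) / (2 * \<i> * complex_of_real \<mu>)"
  define r where "r = (\<lambda>x. y x - (a * cis (\<mu> * x) - b * cis (- \<mu> * x)))"
  have cr: "continuous_on {0..1} r" unfolding r_def by (intro continuous_intros cy)
  have cis_cancel: "cis (- \<mu> * x) * cis (\<mu> * x) = 1" for x by (simp add: cis_mult)
  have req: "r x = (I \<mu> x * cis (\<mu> * x) - I (- \<mu>) x * cis (- \<mu> * x)) / (2 * \<i> * complex_of_real \<mu>)"
    if x: "x \<in> {0..1}" for x
  proof -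
    have e1: "A \<mu> + I \<mu> x = (w x + \<i> * complex_of_real \<mu> * y x) * cis (- \<mu> * x)"
      by (rule Ieq[symmetric]) (use x in auto)
    have e2: "A (- \<mu>) + I (- \<mu>) x = (w x + \<i> * complex_of_real (- \<mu>) * y x) * cis (\<mu> * x)"
      using Ieq[of "- \<mu>" x] x by simp
    have "(A \<mu> + I \<mu> x) * cis (\<mu> * x) - (A (- \<mu>) + I (- \<mu>) x) * cis (- \<mu> * x)
        = (w x + \<i> * complex_of_real \<mu> * y x) * (cis (- \<mu> * x) * cis (\<mu> * x))
          - (w x + \<i> * complex_of_real (- \<mu>) * y x) * (cis (- \<mu> * x) * cis (\<mu> * x))"
      unfolding e1 e2 by (simp add: algebra_simps)
    also have "\<dots> = 2 * \<i> * complex_of_real \<mu> * y x" unfolding cis_cancel by (simp add: algebra_simps)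
    finally have "y x = ((A \<mu> + I \<mu> x) * cis (\<mu> * x) - (A (- \<mu>) + I (- \<mu>) x) * cis (- \<mu> * x)) / (2 * \<i> * complex_of_real \<mu>)"
      using \<mu>(1) by simp
    then show ?thesis
      by (simp add: r_def a_def b_def algebra_simps add_divide_distrib diff_divide_distrib)
  qed
  have rb: "norm (r x) \<le> S * L / \<mu>" if x: "x \<in> {0..1}" for x
  proof -
    have "norm (I \<mu> x * cis (\<mu> * x) - I (- \<mu>) x * cis (- \<mu> * x)) \<le> norm (I \<mu> x * cis (\<mu> * x)) + norm (I (- \<mu>) x * cis (- \<mu> * x))"
      by (rule norm_triangle_ineq4)
    also have "\<dots> \<le> S * L + S * L" using Ib[OF x] by (intro add_mono) (simp_all add: norm_mult)
    finally have d: "norm (I \<mu> x * cis (\<mu> * x) - I (- \<mu>) x * cis (- \<mu> * x)) \<le> S * L + S * L" .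
    have "norm (r x) = norm (I \<mu> x * cis (\<mu> * x) - I (- \<mu>) x * cis (- \<mu> * x)) / (2 * \<mu>)"
      unfolding req[OF x] norm_divide using \<mu>(1) by (simp add: norm_mult)
    also have "\<dots> \<le> (S * L + S * L) / (2 * \<mu>)" by (rule divide_right_mono[OF d]) (use \<mu>(1) in simp)
    also have "\<dots> = S * L / \<mu>" by simp
    finally show ?thesis .
  qed
  define T where "T = norm a + norm b"
  have ST: "S \<le> 2 * T"
  proof -
    have "S = norm ((a * cis (\<mu> * x0) - b * cis (- \<mu> * x0)) + r x0)" by (simp add: S_def r_def)
    also have "\<dots> \<le> norm (a * cis (\<mu> * x0) - b * cis (- \<mu> * x0)) + norm (r x0)" by (rule norm_triangle_ineq)
    also have "norm (a * cis (\<mu> * x0) - b * cis (- \<mu> * x0)) \<le> T"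
      unfolding T_def by (rule order_trans[OF norm_triangle_ineq4]) (simp add: norm_mult)
    also have "norm (r x0) \<le> S * L / \<mu>" by (rule rb[OF x0])
    also have "S * L / \<mu> \<le> S * (1/2)" using \<mu> S0 by (simp add: L_def field_simps)
    finally show ?thesis by simp
  qed
  have T0: "0 < T" using ST S0 by simp
  have split: "integral {0..1} (\<lambda>x. qc x * (y x * cis (k * x))) = a * fourier01 q (\<mu> + k) - b * fourier01 q (k - \<mu>)
      + integral {0..1} (\<lambda>x. qc x * (r x * cis (k * x)))" for k
  proof -
    have ff: "fourier01 q j = integral {0..1} (\<lambda>x. qc x * cis (j * x))" for j
      by (simp add: fourier01_def qc_def)
    have i: "(\<lambda>x. qc x * cis (j * x)) integrable_on {0..1}" for j
      using abs_integrable_times_continuous[OF qc cE] by (simp add: absolutely_integrable_on_def)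
    have "(\<lambda>x. qc x * (r x * cis (k * x))) absolutely_integrable_on {0..1}"
      by (intro abs_integrable_times_continuous[OF qc] continuous_intros cr)
    then have ir: "(\<lambda>x. qc x * (r x * cis (k * x))) integrable_on {0..1}" by (simp add: absolutely_integrable_on_def)
    have "((\<lambda>x. a * (qc x * cis ((\<mu> + k) * x)) - b * (qc x * cis ((k - \<mu>) * x)) + qc x * (r x * cis (k * x)))
        has_integral (a * fourier01 q (\<mu> + k) - b * fourier01 q (k - \<mu>)
      + integral {0..1} (\<lambda>x. qc x * (r x * cis (k * x))))) {0..1}"
      unfolding ff by (intro has_integral_add has_integral_diff has_integral_mult_right integrable_integral i ir)
    also have "(\<lambda>x. a * (qc x * cis ((\<mu> + k) * x)) - b * (qc x * cis ((k - \<mu>) * x)) + qc x * (r x * cis (k * x)))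
        = (\<lambda>x. qc x * (y x * cis (k * x)))"
    proof (rule ext)
      fix x
      have "cis ((\<mu> + k) * x) = cis (\<mu> * x) * cis (k * x)" "cis ((k - \<mu>) * x) = cis (- \<mu> * x) * cis (k * x)"
        by (simp_all add: cis_mult algebra_simps)
      then show "a * (qc x * cis ((\<mu> + k) * x)) - b * (qc x * cis ((k - \<mu>) * x)) + qc x * (r x * cis (k * x)) = qc x * (y x * cis (k * x))"
        by (simp add: r_def algebra_simps)
    qed
    finally show ?thesis by (rule integral_unique)
  qed
  have f0: "fourier01 q 0 = complex_of_real Q" using Qc by (simp add: fourier01_def qc_def)
  have rest: "norm (integral {0..1} (\<lambda>x. qc x * (r x * cis (k * x)))) \<le> S * L / \<mu> * L" for k
    unfolding Lq
    by (rule norm_integral_mult_le[OF qc]) (use rb in \<open>auto intro!: continuous_intros cr simp: norm_mult Lq[symmetric]\<close>)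
  have restT: "S * L / \<mu> * L \<le> 2 * T * L\<^sup>2 / \<mu>"
    using mult_right_mono[OF ST, of "L\<^sup>2 / \<mu>"] \<mu>(1) by (simp add: power2_eq_square)
  \<comment> \<open>\<open>q * y\<close> is orthogonal to \<open>cis (- \<mu> * x)\<close>, which satisfies the boundary conditions\<close>
  have end1: "I (- \<mu>) 1 = 0"
  proof -
    have "A (- \<mu>) + I (- \<mu>) 1 = (\<omega> * cis \<mu>) * A (- \<mu>)"
      using Ieq[of "- \<mu>" 1] by (simp add: bc A_def algebra_simps)
    then show ?thesis using phase by (simp add: \<omega>_def)
  qed
  \<comment> \<open>\<open>cis (\<mu> * x)\<close> misses the boundary conditions by the factor \<open>\<omega>\<^sup>2\<close>\<close>
  have end2: "I \<mu> 1 = (\<omega>\<^sup>2 - 1) * (2 * \<i> * complex_of_real \<mu> * a)"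
  proof -
    have "cis (- \<mu>) = (\<omega> * cis \<mu>) * cis (- \<mu>)" using phase by (simp add: \<omega>_def)
    also have "\<dots> = \<omega>" by (simp add: cis_mult mult.assoc)
    finally have "A \<mu> + I \<mu> 1 = \<omega>\<^sup>2 * A \<mu>"
      using Ieq[of \<mu> 1] by (simp add: bc A_def algebra_simps power2_eq_square)
    then have "I \<mu> 1 = (\<omega>\<^sup>2 - 1) * A \<mu>" by (simp add: algebra_simps)
    then show ?thesis using \<mu>(1) by (simp add: a_def)
  qed
  have bQ: "norm b * \<bar>Q\<bar> \<le> norm a * norm (fourier01 q (2 * \<mu>)) + 2 * T * L\<^sup>2 / \<mu>"
  proof -
    have "b * complex_of_real Q = a * fourier01 q (2 * \<mu>) + integral {0..1} (\<lambda>x. qc x * (r x * cis (\<mu> * x)))"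
      using split[of \<mu>] end1 f0 by (simp add: I_def algebra_simps)
    then have "norm b * \<bar>Q\<bar> = norm (a * fourier01 q (2 * \<mu>) + integral {0..1} (\<lambda>x. qc x * (r x * cis (\<mu> * x))))"
      by (metis norm_mult norm_of_real)
    also have "\<dots> \<le> norm (a * fourier01 q (2 * \<mu>)) + norm (integral {0..1} (\<lambda>x. qc x * (r x * cis (\<mu> * x))))"
      by (rule norm_triangle_ineq)
    finally show ?thesis using rest[of \<mu>] restT by (simp add: norm_mult)
  qed
  have aQ: "norm a * \<bar>Q\<bar> \<le> norm b * norm (fourier01 q (- (2 * \<mu>))) + 2 * T * L\<^sup>2 / \<mu> + T * (\<bar>Q\<bar> * L / norm (\<omega>\<^sup>2 - 1)) / \<mu>"
  proof (cases "\<omega>\<^sup>2 = 1")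
    case True
    have "a * complex_of_real Q = b * fourier01 q (- (2 * \<mu>)) - integral {0..1} (\<lambda>x. qc x * (r x * cis (- \<mu> * x)))"
      using split[of "- \<mu>"] end2 f0 True by (simp add: I_def algebra_simps)
    then have "norm a * \<bar>Q\<bar> = norm (b * fourier01 q (- (2 * \<mu>)) - integral {0..1} (\<lambda>x. qc x * (r x * cis (- \<mu> * x))))"
      by (metis norm_mult norm_of_real)
    also have "\<dots> \<le> norm (b * fourier01 q (- (2 * \<mu>))) + norm (integral {0..1} (\<lambda>x. qc x * (r x * cis (- \<mu> * x))))"
      by (rule norm_triangle_ineq4)
    finally show ?thesis using rest[of "- \<mu>"] restT True by (simp add: norm_mult)
  next
    case False
    \<comment> \<open>\<open>I \<mu> 1\<close> is bounded, whereas its exact value grows like \<open>\<mu> * a\<close>\<close>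
    define \<kappa> where "\<kappa> = norm (\<omega>\<^sup>2 - 1)"
    have \<kappa>: "0 < \<kappa>" using False by (simp add: \<kappa>_def)
    have "\<kappa> * (2 * \<mu> * norm a) = norm (I \<mu> 1)" unfolding end2 using \<mu>(1) by (simp add: norm_mult \<kappa>_def)
    also have "\<dots> \<le> S * L" by (rule Ib) simp
    also have "\<dots> \<le> 2 * T * L" by (rule mult_right_mono[OF ST L0])
    finally have "norm a \<le> T * L / (\<kappa> * \<mu>)" using \<kappa> \<mu>(1) by (simp add: field_simps)
    then have "norm a * \<bar>Q\<bar> \<le> T * L / (\<kappa> * \<mu>) * \<bar>Q\<bar>" by (rule mult_right_mono) simp
    also have "\<dots> = T * (\<bar>Q\<bar> * L / \<kappa>) / \<mu>" by (simp add: field_simps)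
    finally have "norm a * \<bar>Q\<bar> \<le> T * (\<bar>Q\<bar> * L / \<kappa>) / \<mu>" .
    moreover have "0 \<le> norm b * norm (fourier01 q (- (2 * \<mu>)))" "0 \<le> 2 * T * L\<^sup>2 / \<mu>" using T0 \<mu>(1) by auto
    ultimately show ?thesis unfolding \<kappa>_def by linarith
  qed
  have "T * \<bar>Q\<bar> = norm a * \<bar>Q\<bar> + norm b * \<bar>Q\<bar>" by (simp add: T_def algebra_simps)
  also have "\<dots> \<le> (norm a * norm (fourier01 q (2 * \<mu>)) + norm b * norm (fourier01 q (- (2 * \<mu>))))
      + (4 * T * L\<^sup>2 / \<mu> + T * (\<bar>Q\<bar> * L / norm (\<omega>\<^sup>2 - 1)) / \<mu>)"
    using aQ bQ by simp
  also have "norm a * norm (fourier01 q (2 * \<mu>)) + norm b * norm (fourier01 q (- (2 * \<mu>)))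
      \<le> T * norm (fourier01 q (2 * \<mu>)) + T * norm (fourier01 q (- (2 * \<mu>)))"
    by (intro add_mono mult_right_mono) (simp_all add: T_def)
  also have "T * norm (fourier01 q (2 * \<mu>)) + T * norm (fourier01 q (- (2 * \<mu>))) + (4 * T * L\<^sup>2 / \<mu> + T * (\<bar>Q\<bar> * L / norm (\<omega>\<^sup>2 - 1)) / \<mu>)
     = T * (norm (fourier01 q (2 * \<mu>)) + norm (fourier01 q (- (2 * \<mu>))) + (4 * L\<^sup>2 + \<bar>Q\<bar> * L / norm (\<omega>\<^sup>2 - 1)) / \<mu>)"
    by (simp add: distrib_left add_divide_distrib)
  finally have "\<bar>Q\<bar> \<le> norm (fourier01 q (2 * \<mu>)) + norm (fourier01 q (- (2 * \<mu>))) + (4 * L\<^sup>2 + \<bar>Q\<bar> * L / norm (\<omega>\<^sup>2 - 1)) / \<mu>"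
    using T0 by (simp only: mult_le_cancel_left_pos)
  then show ?thesis by (simp only: Q_def L_def \<omega>_def)
qed

text \<open>
The right-hand side of \<open>eigenfunction_mean_estimate\<close> tends to zero along \<open>\<mu> = 2 * n * pi - t\<close>.
\<close>

theorem mean_zero_of_spectrum:
  assumes q: "q absolutely_integrable_on {0..1}"
    and spec: "\<And>n::nat. n \<ge> 1 \<Longrightarrow> complex_of_real ((2 * real n * pi - t)\<^sup>2) \<in> L_spectrum t q"
  shows "integral {0..1} q = 0"
proof -
  define L where "L = integral {0..1} (\<lambda>x. \<bar>q x\<bar>)"
  define c where "c = 4 * L\<^sup>2 + \<bar>integral {0..1} q\<bar> * L / norm ((exp (\<i> * complex_of_real t))\<^sup>2 - 1)"
  have "\<bar>integral {0..1} q\<bar> \<le> e" if e: "0 < e" for e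
  proof -
    obtain K where K: "\<And>k. K \<le> \<bar>k\<bar> \<Longrightarrow> norm (fourier01 q k) < e / 3"
      using Riemann_Lebesgue[OF abs_integrable_of_real[OF q], of "e/3"] e unfolding fourier01_def by auto
    obtain n :: nat where n: "\<bar>K\<bar> + 2 * \<bar>L\<bar> + 3 * \<bar>c\<bar> / e + \<bar>t\<bar> + 1 \<le> real n" using real_arch_simple by blast
    have ce: "0 \<le> 3 * \<bar>c\<bar> / e" using e by simp
    define \<mu> where "\<mu> = 2 * real n * pi - t"
    have "2 * real n * 1 \<le> 2 * real n * pi" using pi_gt3 by (intro mult_left_mono) auto
    then have big: "\<bar>K\<bar> + 2 * \<bar>L\<bar> + 3 * \<bar>c\<bar> / e + 1 \<le> \<mu>" using n by (simp add: \<mu>_def)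
    have \<mu>0: "0 < \<mu>" and \<mu>L: "2 * L \<le> \<mu>" and \<mu>c: "3 * \<bar>c\<bar> / e \<le> \<mu>" and \<mu>K: "K \<le> \<bar>2 * \<mu>\<bar>" "K \<le> \<bar>- (2 * \<mu>)\<bar>"
      using big ce by linarith+
    have "n \<ge> 1" using n ce by linarith
    then have "complex_of_real (\<mu>\<^sup>2) \<in> eigenvalues (L_dom t q) (L_op q)"
      using spec[of n] L_spectrum_subset_eigenvalues[OF q] unfolding \<mu>_def by blast
    then obtain y where y: "y \<in> L_dom t q" "\<not> (AE x in leb01. y x = 0)" "AE x in leb01. L_op q y x = complex_of_real (\<mu>\<^sup>2) * y x"
      unfolding eigenvalues_def by blast
    have "exp (\<i> * complex_of_real t) * cis \<mu> = cis (2 * pi * real n)"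
      by (simp add: cis_conv_exp[symmetric] cis_mult \<mu>_def mult.commute mult.left_commute)
    also have "\<dots> = 1" by (rule cis_multiple_2pi) simp
    finally have "\<bar>integral {0..1} q\<bar> \<le> norm (fourier01 q (2 * \<mu>)) + norm (fourier01 q (- (2 * \<mu>))) + c / \<mu>"
      using eigenfunction_mean_estimate[OF q y \<mu>0] \<mu>L unfolding c_def L_def by blast
    moreover have "c / \<mu> \<le> e / 3"
    proof -
      have "c \<le> e / 3 * \<mu>" using \<mu>c e by (simp add: field_simps)
      then show ?thesis using \<mu>0 by (simp add: pos_divide_le_eq)
    qed
    ultimately show ?thesis using K[OF \<mu>K(1)] K[OF \<mu>K(2)] by linarith
  qed
  then show ?thesis by (metis abs_le_zero_iff field_le_epsilon add_0)
qed

section \<open>Varying an extremal trial function\<close>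

lemma real_quadratic_nonneg_imp_linear_coeff_zero:
  fixes J K :: real
  assumes "\<And>\<epsilon>. 0 \<le> 2 * \<epsilon> * J + \<epsilon>\<^sup>2 * K"
  shows "J = 0"
proof (rule ccontr)
  assume J: "J \<noteq> 0"
  define k where "k = \<bar>K\<bar> + 1"
  have k: "0 < k" "K \<le> k" by (simp_all add: k_def)
  \<comment> \<open>for small \<open>\<epsilon>\<close> of sign opposite to \<open>J\<close> the linear term would win\<close>
  have "0 \<le> 2 * (- J / k) * J + (- J / k)\<^sup>2 * K" by (rule assms)
  also have "\<dots> \<le> 2 * (- J / k) * J + (- J / k)\<^sup>2 * k" using k by (intro add_left_mono mult_left_mono) auto
  also have "\<dots> = - (J\<^sup>2 / k)" using k by (simp add: power2_eq_square field_simps)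
  finally show False using J k by (simp add: divide_le_0_iff)
qed

text \<open>
The real amplitude \<open>1 + e * h x\<close> makes \<open>|y'|\<^sup>2\<close> split without a cross term, because the derivatives of the
phase and of the amplitude contribute in orthogonal directions.
\<close>

lemma energy_of_modulated_exponential:
  assumes q: "q absolutely_integrable_on {0..1}" and \<tau>: "cis \<tau> = exp (\<i> * complex_of_real t)"
    and h: "is_primitive h h'" "continuous_on {0..1} h'" "h 0 = 0" "h 1 = 0"
  shows "first_eigenvalue t q * integral {0..1} (\<lambda>x. (1 + e * h x)\<^sup>2)
    \<le> integral {0..1} (\<lambda>x. \<tau>\<^sup>2 * (1 + e * h x)\<^sup>2 + e\<^sup>2 * (h' x)\<^sup>2 + q x * (1 + e * h x)\<^sup>2)"
proof -
  define y where "y = (\<lambda>x. cis (\<tau> * x) * complex_of_real (1 + e * h x))"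
  define w where "w = (\<lambda>x. cis (\<tau> * x) * Complex (e * h' x) (\<tau> * (1 + e * h x)))"
  have ch: "continuous_on {0..1} h" by (rule is_primitive_continuous[OF h(1)])
  have dh: "(h has_vector_derivative h' x) (at x within {0..1})" if "x \<in> {0..1}" for x
    by (rule is_primitive_has_deriv[OF h(1,2) that])
  have cw: "continuous_on {0..1} w"
    unfolding w_def Complex_eq by (intro continuous_intros ch h(2))
  have "in_form_domain t y w"
    unfolding in_form_domain_def
  proof (intro conjI cw)
    show "is_primitive y w"
    proof (rule is_primitive_C1[OF cw])
      fix x :: real assume x: "x \<in> {0..1}"
      have "((\<lambda>x. 1 + e * h x) has_vector_derivative 0 + e * h' x) (at x within {0..1})"
        by (intro has_vector_derivative_add has_vector_derivative_const has_vector_derivative_mult_right dh[OF x])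
      then have "((\<lambda>x. complex_of_real (1 + e * h x)) has_vector_derivative complex_of_real (e * h' x)) (at x within {0..1})"
        by (intro has_vector_derivative_of_real) (simp add: has_real_derivative_iff_has_vector_derivative)
      from has_vector_derivative_mult[OF cis_has_vector_derivative[of \<tau>] this]
      have "(y has_vector_derivative cis (\<tau> * x) * complex_of_real (e * h' x)
          + \<i> * complex_of_real \<tau> * cis (\<tau> * x) * complex_of_real (1 + e * h x)) (at x within {0..1})"
        by (simp add: y_def)
      moreover have "cis (\<tau> * x) * complex_of_real (e * h' x)
          + \<i> * complex_of_real \<tau> * cis (\<tau> * x) * complex_of_real (1 + e * h x) = w x"
        by (simp add: w_def Complex_eq algebra_simps)
      ultimately show "(y has_vector_derivative w x) (at x within {0..1})" by simp
    qed
    show "y 1 = exp (\<i> * complex_of_real t) * y 0" using h(3,4) \<tau> by (simp add: y_def)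
  qed
  from first_eigenvalue_le_energy[OF q this]
  have "first_eigenvalue t q * mass y \<le> energy q y w" .
  moreover have my: "(cmod (y x))\<^sup>2 = (1 + e * h x)\<^sup>2" for x by (simp add: y_def norm_mult del: of_real_add of_real_mult)
  moreover have "(cmod (w x))\<^sup>2 = \<tau>\<^sup>2 * (1 + e * h x)\<^sup>2 + e\<^sup>2 * (h' x)\<^sup>2" for x
    by (simp add: w_def norm_mult cmod_power2 power_mult_distrib)
  ultimately show ?thesis by (simp add: mass_def energy_def)
qed

text \<open>
The derivative \<open>q\<close> exists almost everywhere and is unique there.
\<close>

lemma is_primitive_zero_AE:
  fixes P q :: "real \<Rightarrow> real"
  assumes P: "is_primitive P q" and zero: "\<And>x. x \<in> {0..1} \<Longrightarrow> P x = 0"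
  shows "AE x in leb01. q x = 0"
proof -
  obtain N where N: "negligible N" "\<And>x. x \<in> {0..1} - N \<Longrightarrow> (P has_vector_derivative q x) (at x within {0..1})"
    using is_primitive_deriv_ae[OF P] by blast
  have "q x = 0" if x: "x \<in> {0..1} - N" for x
  proof -
    have "(P has_vector_derivative 0) (at x within {0..1})"
      by (rule has_vector_derivative_transform[OF _ zero has_vector_derivative_const]) (use x in auto)
    with N(2)[OF x] show ?thesis
      by (intro vector_derivative_unique_within[of x "{0..1}" P]) (use x in \<open>auto simp: trivial_limit_within islimpt_Icc\<close>)
  qed
  then show ?thesis unfolding leb01_AE_iff using N(1) by blast
qed

theorem theorem1:
  fixes q :: "real \<Rightarrow> real" and t :: real
  assumes "integrable (lebesgue_on {0..1}) q"
    and "0 \<le> t" and "t < 2 * pi"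
    and "first_eigenvalue t q \<ge> min (t\<^sup>2) ((2 * pi - t)\<^sup>2)"
    and "{complex_of_real ((2 * real n * pi - t)\<^sup>2) | n :: nat. n \<ge> 1} \<subseteq> L_spectrum t q"
  shows "AE x in lebesgue_on {0..1}. q x = 0"
proof -
  have q: "q absolutely_integrable_on {0..1}" using assms(1) by (simp add: leb01_integrable_iff)
  have Q: "integral {0..1} q = 0"
    by (rule mean_zero_of_spectrum[OF q, of t]) (use assms(5) in blast)
  \<comment> \<open>the exponent of smallest modulus compatible with the boundary conditions\<close>
  define \<tau> where "\<tau> = (if t\<^sup>2 \<le> (2 * pi - t)\<^sup>2 then t else t - 2 * pi)"
  have \<tau>m: "\<tau>\<^sup>2 = min (t\<^sup>2) ((2 * pi - t)\<^sup>2)" by (auto simp: \<tau>_def power2_commute)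
  have "cis (t - 2 * pi) = cis t" by (simp flip: cis_divide)
  then have \<tau>: "cis \<tau> = exp (\<i> * complex_of_real t)" by (simp add: \<tau>_def cis_conv_exp)
  define P where "P = (\<lambda>x. integral {0..x} q)"
  have P: "is_primitive P q" unfolding is_primitive_def P_def using q by simp
  have cP: "continuous_on {0..1} P" by (rule is_primitive_continuous[OF P])
  have P01: "P 0 = 0" "P 1 = 0" using Q by (simp_all add: P_def)
  define c where "c = integral {0..1} P"
  \<comment> \<open>subtracting the mean \<open>c\<close> makes \<open>h\<close> vanish at the right end as well\<close>
  define h where "h = (\<lambda>x. integral {0..x} (\<lambda>s. P s - c))"
  have ch': "continuous_on {0..1} (\<lambda>s. P s - c)" by (intro continuous_intros cP)
  have h: "is_primitive h (\<lambda>s. P s - c)"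
    unfolding is_primitive_def h_def using absolutely_integrable_continuous_real[OF ch'] by simp
  have ch: "continuous_on {0..1} h" by (rule is_primitive_continuous[OF h])
  have cint: "integral {0..1} (\<lambda>s. P s - c) = 0"
    using integral_diff[OF integrable_continuous_real[OF cP] integrable_const_ivl[of c 0 1]] by (simp add: c_def)
  then have h01: "h 0 = 0" "h 1 = 0" by (simp_all add: h_def)
  define J where "J = integral {0..1} (\<lambda>x. q x * h x)"
  define K where "K = integral {0..1} (\<lambda>x. (P x - c)\<^sup>2 + q x * (h x)\<^sup>2)"
  have "0 \<le> 2 * e * J + e\<^sup>2 * K" for e
  proof -
    let ?M = "integral {0..1} (\<lambda>x. (1 + e * h x)\<^sup>2)"
    have i1: "(\<lambda>x. (1 + e * h x)\<^sup>2) integrable_on {0..1}" by (intro integrable_continuous_real continuous_intros ch)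
    have M0: "0 \<le> ?M" by (rule integral_nonneg[OF i1]) simp
    have "((\<lambda>x. \<tau>\<^sup>2 * (1 + e * h x)\<^sup>2 + (q x + (2 * e * (q x * h x) + e\<^sup>2 * ((P x - c)\<^sup>2 + q x * (h x)\<^sup>2)))) has_integral
        (\<tau>\<^sup>2 * ?M + (integral {0..1} q + (2 * e * J + e\<^sup>2 * K)))) {0..1}"
      unfolding J_def K_def
      by (intro has_integral_add has_integral_mult_right integrable_integral i1 integrable_add
          integrable_mult_continuous_real[OF q] integrable_continuous_real continuous_intros ch cP
          absolutely_integrable_on_def[THEN iffD1, THEN conjunct1, OF q])
    moreover have "(\<lambda>x. \<tau>\<^sup>2 * (1 + e * h x)\<^sup>2 + e\<^sup>2 * (P x - c)\<^sup>2 + q x * (1 + e * h x)\<^sup>2)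
        = (\<lambda>x. \<tau>\<^sup>2 * (1 + e * h x)\<^sup>2 + (q x + (2 * e * (q x * h x) + e\<^sup>2 * ((P x - c)\<^sup>2 + q x * (h x)\<^sup>2))))"
      by (rule ext) (simp add: power2_eq_square algebra_simps)
    ultimately have "integral {0..1} (\<lambda>x. \<tau>\<^sup>2 * (1 + e * h x)\<^sup>2 + e\<^sup>2 * (P x - c)\<^sup>2 + q x * (1 + e * h x)\<^sup>2)
        = \<tau>\<^sup>2 * ?M + (2 * e * J + e\<^sup>2 * K)" using Q by (simp add: integral_unique)
    then have "first_eigenvalue t q * ?M \<le> \<tau>\<^sup>2 * ?M + (2 * e * J + e\<^sup>2 * K)"
      using energy_of_modulated_exponential[OF q \<tau> h ch' h01, of e] by simp
    moreover have "\<tau>\<^sup>2 * ?M \<le> first_eigenvalue t q * ?M"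
      using assms(4) unfolding \<tau>m by (rule mult_right_mono[OF _ M0])
    ultimately show ?thesis by linarith
  qed
  then have "J = 0" by (rule real_quadratic_nonneg_imp_linear_coeff_zero)
  have "P 1 * h 1 - P 0 * h 0 = integral {0..1} (\<lambda>x. P x * (P x - c) + q x * h x)"
    by (rule is_primitive_diff[OF is_primitive_bilinear[OF bounded_bilinear_mult P h], of 0 1]) auto
  also have "\<dots> = integral {0..1} (\<lambda>x. P x * (P x - c)) + J"
    unfolding J_def
    by (intro integral_add integrable_mult_continuous_real[OF q] integrable_continuous_real continuous_intros ch cP)
  finally have "integral {0..1} (\<lambda>x. P x * (P x - c)) = 0" using \<open>J = 0\<close> P01 by simp
  then have "integral {0..1} (\<lambda>x. P x * (P x - c) - c * (P x - c)) = 0"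
    using cint by (subst integral_diff) (auto intro!: integrable_continuous_real continuous_intros cP)
  then have "integral {0..1} (\<lambda>x. (P x - c)\<^sup>2) = 0" by (simp add: power2_eq_square algebra_simps)
  then have "((\<lambda>x. (P x - c)\<^sup>2) has_integral 0) {0..1}"
    by (metis integrable_integral integrable_continuous_real continuous_on_power ch')
  then have "(P x - c)\<^sup>2 = 0" if "x \<in> {0..1}" for x
    using has_integral_0_cbox_imp_0[of 0 1 "\<lambda>x. (P x - c)\<^sup>2" x] continuous_on_power[OF ch', of 2] that by simp
  then have const: "P x = c" if "x \<in> {0..1}" for x using that by simp
  have "P x = 0" if "x \<in> {0..1}" for x using const[OF that] const[of 0] P01 by simp
  then show ?thesis by (rule is_primitive_zero_AE[OF P])
qed

end
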